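(* Let $M$ be an invariant submanifold of an SQ-Sasakian manifold $M^*$ with structure $(\phi,\xi,\eta,g)$ and structure function $\beta$. Then the following statements are equivalent: (i) $M$ is totally geodesic; (ii) $M$ is parallel; (iii) $M$ is semiparallel; (iv) $M$ is Chaki-pseudo parallel with associated $1$-form $\alpha$ satisfying $\{\alpha(\xi)\}^2+\beta^2\neq 0$; (v) $M$ is Deszcz-pseudo parallel with associated function $L_h$ satisfying $L_h+\beta^2\neq 0$.
   Context: An almost contact metric manifold $(\phi,\xi,\eta,g)$ is a smooth manifold with a $(1,1)$-tensor $\phi$, a vector field $\xi$, a $1$-form $\eta$ and a Riemannian metric $g$ such that $\phi^2X=-X+\eta(X)\xi$, $\phi\xi=0$, $\eta(\xi)=1$, $g(X,\xi)=\eta(X)$, $\eta(\phi X)=0$, $g(\phi X,\phi Y)=g(X,Y)-\eta(X)\eta(Y)$, $g(\phi X,Y)=-g(X,\phi Y)$. Its fundamental $2$-form is $\Phi(X,Y)=g(X,\phi Y)$. It is normal if $[\phi X,\phi Y]+\phi^2[X,Y]-\phi[\phi X,Y]-\phi[X,\phi Y]+2d\eta(X,Y)\xi=0$. An SQ-Sasakian manifold $M^*$ (of dimension $2n+1>3$) is a normal almost contact metric manifold with $d\Phi=0$ and $\bar\nabla_X\xi=-\beta\phi X$ for a smooth function $\beta$ (the structure function) with $\xi\beta=0$, where $\bar\nabla$ is the Levi-Civita connection. $M$ is a submanifold of dimension $2m+1$, $m<n$, with induced metric $g$, induced connection $\nabla$, normal connection $\nabla^\perp$ and second fundamental form $h$,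 so $\bar\nabla_XY=\nabla_XY+h(X,Y)$. $M$ is invariant if $\xi$ is tangent to $M$ and $\phi(TM)\subset TM$ at every point of $M$. $M$ is totally geodesic if $h=0$. Put $(\nabla_Xh)(Y,Z)=\nabla^\perp_X(h(Y,Z))-h(\nabla_XY,Z)-h(Y,\nabla_XZ)$. $M$ is Chaki-pseudo parallel if there is a nowhere vanishing $1$-form $\alpha$ on $M$ with $(\nabla_Xh)(Y,Z)=2\alpha(X)h(Y,Z)+\alpha(Y)h(X,Z)+\alpha(Z)h(X,Y)$ for all $X,Y,Z$ tangent to $M$. $M$ is parallel if $\nabla h=0$. Let $R$, $R^\perp$ be the curvature tensors of $\nabla$, $\nabla^\perp$ (convention $R(X,Y)=\nabla_X\nabla_Y-\nabla_Y\nabla_X-\nabla_{[X,Y]}$), and put $(\bar R(X,Y)\cdot h)(Z,U)=R^\perp(X,Y)h(Z,U)-h(R(X,Y)Z,U)-h(Z,R(X,Y)U)$, $Q(g,h)(Z,U;X,Y)=g(Y,Z)h(X,U)-g(X,Z)h(Y,U)+g(Y,U)h(X,Z)-g(X,U)h(Y,Z)$. $M$ is Deszcz-pseudo parallel if $(\bar R(X,Y)\cdot h)(Z,U)=L_hQ(g,h)(Z,U;X,Y)$ for all $X,Y,Z,U$ tangent to $M$, where $L_h$ is some function on $W=\{x\in M:(h-Hg)_x\neq 0\}$, $H$ being the mean curvature vector. $M$ is semiparallel if this holds with $L_h=0$, i.e. $\bar R(X,Y)\cdot h=0$. Conditions "$\neq 0$" on functions are understood pointwise where the functions are defined.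
   Formalization: (ii)⇒(i) and (iii)⇒(i) are stated only when β has no zero on M; they fail for β=0 (e.g. complex quadric × R in CP^n × R is parallel, invariant, not totally geodesic). (i)⇔(iv), (i)⇔(v), (i)⇒(ii)⇒(iii) are unconditional. *)

theory Defs
  imports "HOL-Analysis.Analysis" "HOL-Library.Function_Algebras"
begin

text \<open>Functions into a real vector space form a real vector space pointwise. Tangent vectors are
  represented below as functions on charts, so this gives the usual vector space notation on them.\<close>

instantiation "fun" :: (type, real_vector) real_vector
begin

definition "r *\<^sub>R f = (\<lambda>x. r *\<^sub>R f x)"

instance
  by standard (simp_all add: scaleR_fun_def fun_eq_iff scaleR_add_right scaleR_add_left)

end

section \<open>Smooth manifolds\<close>

text \<open>Smooth functions on open subsets of Euclidean spaces: all iterated directional derivatives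
  exist and are continuous.\<close>

fun Ck_on :: "nat \<Rightarrow> 'e::euclidean_space set \<Rightarrow> ('e \<Rightarrow> 'f::real_normed_vector) \<Rightarrow> bool" where
  "Ck_on 0 S f \<longleftrightarrow> continuous_on S f"
| "Ck_on (Suc k) S f \<longleftrightarrow>
     (\<forall>x\<in>S. f differentiable (at x)) \<and> (\<forall>v. Ck_on k S (\<lambda>x. frechet_derivative f (at x) v))"

definition smooth_on :: "'e::euclidean_space set \<Rightarrow> ('e \<Rightarrow> 'f::real_normed_vector) \<Rightarrow> bool" where
  "smooth_on S f \<longleftrightarrow> (\<forall>k. Ck_on k S f)"

text \<open>A chart is a pair of its domain and its coordinate map. The dimension of a manifold
  with charts in \<^typ>\<open>'e\<close> is the dimension of \<^typ>\<open>'e\<close>. The point set is the carrier of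
  the topology, so that an immersed submanifold can be a subset carrying its own topology.\<close>

type_synonym ('a, 'e) chart = "'a set \<times> ('a \<Rightarrow> 'e)"

record ('a, 'e) mfd =
  Top :: "'a topology"
  Charts :: "('a, 'e) chart set"

abbreviation points :: "('a, 'e) mfd \<Rightarrow> 'a set" where
  "points M \<equiv> topspace (Top M)"

definition in_chart :: "('a, 'e) chart \<Rightarrow> ('a \<Rightarrow> 'f) \<Rightarrow> 'e \<Rightarrow> 'f" where
  "in_chart c F = F \<circ> inv_into (fst c) (snd c)"

definition smooth_manifold :: "('a, 'e::euclidean_space) mfd \<Rightarrow> bool" where
  "smooth_manifold M \<longleftrightarrow>
     Hausdorff_space (Top M) \<and> second_countable (Top M) \<and>
     (\<Union>c\<in>Charts M. fst c) = points M \<and>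
     (\<forall>c\<in>Charts M. openin (Top M) (fst c) \<and> open (snd c ` fst c) \<and>
        homeomorphic_map (subtopology (Top M) (fst c)) (top_of_set (snd c ` fst c)) (snd c)) \<and>
     (\<forall>c\<in>Charts M. \<forall>c'\<in>Charts M.
        smooth_on (snd c ` (fst c \<inter> fst c')) (in_chart c (snd c')))"

definition charts_at :: "('a, 'e) mfd \<Rightarrow> 'a \<Rightarrow> ('a, 'e) chart set" where
  "charts_at M p = {c \<in> Charts M. p \<in> fst c}"

definition chart_at :: "('a, 'e) mfd \<Rightarrow> 'a \<Rightarrow> ('a, 'e) chart" where
  "chart_at M p = (SOME c. c \<in> charts_at M p)"

definition smooth_fun ::
    "('a, 'e::euclidean_space) mfd \<Rightarrow> 'a set \<Rightarrow> ('a \<Rightarrow> 'f::real_normed_vector) \<Rightarrow> bool" where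
  "smooth_fun M V F \<longleftrightarrow> (\<forall>c\<in>Charts M. smooth_on (snd c ` (fst c \<inter> V)) (in_chart c F))"

section \<open>Tangent vectors and vector fields\<close>

text \<open>A tangent vector at \<open>p\<close> is the family of its component vectors in all charts around \<open>p\<close>,
  subject to the transformation law; the value on all other charts is 0 by convention.\<close>

type_synonym ('a, 'e) tvec = "('a, 'e) chart \<Rightarrow> 'e"

type_synonym ('a, 'e) vfield = "'a \<Rightarrow> ('a, 'e) tvec"

text \<open>The derivative at \<open>p\<close> of a function in the direction with components \<open>u\<close> in the chart \<open>c\<close>.\<close>

definition deriv_in ::
    "('a, 'e::euclidean_space) chart \<Rightarrow> 'a \<Rightarrow> 'e \<Rightarrow> ('a \<Rightarrow> 'f::real_normed_vector) \<Rightarrow> 'f" where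
  "deriv_in c p u F = frechet_derivative (in_chart c F) (at (snd c p)) u"

definition tangent_space :: "('a, 'e::euclidean_space) mfd \<Rightarrow> 'a \<Rightarrow> ('a, 'e) tvec set" where
  "tangent_space M p =
     {v. (\<forall>c\<in>charts_at M p. \<forall>c'\<in>charts_at M p. v c' = deriv_in c p (v c) (snd c')) \<and>
         (\<forall>c. c \<notin> charts_at M p \<longrightarrow> v c = 0)}"

definition coord_vec ::
    "('a, 'e::euclidean_space) mfd \<Rightarrow> ('a, 'e) chart \<Rightarrow> 'a \<Rightarrow> 'e \<Rightarrow> ('a, 'e) tvec" where
  "coord_vec M c p u = (\<lambda>c'. if c' \<in> charts_at M p then deriv_in c p u (snd c') else 0)"

text \<open>The derivative \<open>v F\<close> of a function \<open>F\<close> along a tangent vector \<open>v\<close> at \<open>p\<close>. By the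
  transformation law the choice of chart is immaterial.\<close>

definition vderiv ::
    "('a, 'e::euclidean_space) mfd \<Rightarrow> 'a \<Rightarrow> ('a, 'e) tvec \<Rightarrow> ('a \<Rightarrow> 'f::real_normed_vector) \<Rightarrow> 'f" where
  "vderiv M p v F = deriv_in (chart_at M p) p (v (chart_at M p)) F"

definition smooth_vf :: "('a, 'e::euclidean_space) mfd \<Rightarrow> 'a set \<Rightarrow> ('a, 'e) vfield \<Rightarrow> bool" where
  "smooth_vf M V X \<longleftrightarrow>
     (\<forall>p\<in>V. X p \<in> tangent_space M p) \<and>
     (\<forall>c\<in>Charts M. smooth_on (snd c ` (fst c \<inter> V)) (in_chart c (\<lambda>q. X q c)))"

text \<open>Lie bracket, with components \<open>X(Y\<^sup>k) - Y(X\<^sup>k)\<close> in every chart.\<close>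

definition bracket ::
    "('a, 'e::euclidean_space) mfd \<Rightarrow> ('a, 'e) vfield \<Rightarrow> ('a, 'e) vfield \<Rightarrow> ('a, 'e) vfield" where
  "bracket M X Y p =
     (\<lambda>c. if c \<in> charts_at M p
          then vderiv M p (X p) (\<lambda>q. Y q c) - vderiv M p (Y p) (\<lambda>q. X q c) else 0)"

section \<open>Tensor fields\<close>

definition linear_on_set :: "'v::real_vector set \<Rightarrow> ('v \<Rightarrow> 'w::real_vector) \<Rightarrow> bool" where
  "linear_on_set S f \<longleftrightarrow>
     (\<forall>u\<in>S. \<forall>v\<in>S. f (u + v) = f u + f v) \<and> (\<forall>a. \<forall>u\<in>S. f (a *\<^sub>R u) = a *\<^sub>R f u)"

definition one_form ::
    "('a, 'e::euclidean_space) mfd \<Rightarrow> ('a \<Rightarrow> ('a, 'e) tvec \<Rightarrow> real) \<Rightarrow> bool" where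
  "one_form M \<alpha> \<longleftrightarrow>
     (\<forall>p\<in>points M. linear_on_set (tangent_space M p) (\<alpha> p)) \<and>
     (\<forall>V X. openin (Top M) V \<and> smooth_vf M V X \<longrightarrow> smooth_fun M V (\<lambda>p. \<alpha> p (X p)))"

definition tensor11 ::
    "('a, 'e::euclidean_space) mfd \<Rightarrow> ('a \<Rightarrow> ('a, 'e) tvec \<Rightarrow> ('a, 'e) tvec) \<Rightarrow> bool" where
  "tensor11 M \<phi> \<longleftrightarrow>
     (\<forall>p\<in>points M. linear_on_set (tangent_space M p) (\<phi> p) \<and>
        \<phi> p ` tangent_space M p \<subseteq> tangent_space M p) \<and>
     (\<forall>V X. openin (Top M) V \<and> smooth_vf M V X \<longrightarrow> smooth_vf M V (\<lambda>p. \<phi> p (X p)))"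

definition riemannian_metric ::
    "('a, 'e::euclidean_space) mfd \<Rightarrow> ('a \<Rightarrow> ('a, 'e) tvec \<Rightarrow> ('a, 'e) tvec \<Rightarrow> real) \<Rightarrow> bool" where
  "riemannian_metric M g \<longleftrightarrow>
     (\<forall>p\<in>points M. \<forall>u\<in>tangent_space M p.
        linear_on_set (tangent_space M p) (g p u) \<and>
        (\<forall>v\<in>tangent_space M p. g p u v = g p v u) \<and> (u \<noteq> 0 \<longrightarrow> g p u u > 0)) \<and>
     (\<forall>V X Y. openin (Top M) V \<and> smooth_vf M V X \<and> smooth_vf M V Y \<longrightarrow>
        smooth_fun M V (\<lambda>p. g p (X p) (Y p)))"

section \<open>The Levi-Civita connection\<close>

text \<open>\<open>nab p u Y\<close> is the covariant derivative at \<open>p\<close> of the vector field \<open>Y\<close>, smooth near \<open>p\<close>,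
  in the direction \<open>u\<close>.\<close>

type_synonym ('a, 'e) conn = "'a \<Rightarrow> ('a, 'e) tvec \<Rightarrow> ('a, 'e) vfield \<Rightarrow> ('a, 'e) tvec"

definition affine_connection :: "('a, 'e::euclidean_space) mfd \<Rightarrow> ('a, 'e) conn \<Rightarrow> bool" where
  "affine_connection M nab \<longleftrightarrow>
     (\<forall>V Y. openin (Top M) V \<and> smooth_vf M V Y \<longrightarrow>
        (\<forall>X. smooth_vf M V X \<longrightarrow> smooth_vf M V (\<lambda>p. nab p (X p) Y)) \<and>
        (\<forall>p\<in>V. linear_on_set (tangent_space M p) (\<lambda>u. nab p u Y)) \<and>
        (\<forall>p\<in>V. \<forall>u\<in>tangent_space M p.
           (\<forall>Z. smooth_vf M V Z \<longrightarrow> nab p u (\<lambda>q. Y q + Z q) = nab p u Y + nab p u Z) \<and>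
           (\<forall>F. smooth_fun M V F \<longrightarrow>
              nab p u (\<lambda>q. F q *\<^sub>R Y q) = vderiv M p u F *\<^sub>R Y p + F p *\<^sub>R nab p u Y) \<and>
           (\<forall>Z. (\<forall>q\<in>V. Z q = Y q) \<longrightarrow> nab p u Z = nab p u Y)))"

definition levi_civita ::
    "('a, 'e::euclidean_space) mfd \<Rightarrow> ('a \<Rightarrow> ('a, 'e) tvec \<Rightarrow> ('a, 'e) tvec \<Rightarrow> real) \<Rightarrow>
     ('a, 'e) conn \<Rightarrow> bool" where
  "levi_civita M g nab \<longleftrightarrow>
     affine_connection M nab \<and>
     (\<forall>V X Y. openin (Top M) V \<and> smooth_vf M V X \<and> smooth_vf M V Y \<longrightarrow>
        (\<forall>p\<in>V. nab p (X p) Y - nab p (Y p) X = bracket M X Y p)) \<and>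
     (\<forall>V X Y. openin (Top M) V \<and> smooth_vf M V X \<and> smooth_vf M V Y \<longrightarrow>
        (\<forall>p\<in>V. \<forall>u\<in>tangent_space M p.
           vderiv M p u (\<lambda>q. g q (X q) (Y q)) = g p (nab p u X) (Y p) + g p (X p) (nab p u Y)))"

section \<open>SQ-Sasakian manifolds\<close>

text \<open>Exterior derivatives with the normalising factors 1/2 and 1/3 (Kobayashi-Nomizu, Blair). The
  factor 1/2 is the convention for which the term \<open>2 d\<eta>(X,Y) \<xi>\<close> in the normality condition is
  correct.\<close>

definition ext_d1 ::
    "('a, 'e::euclidean_space) mfd \<Rightarrow> ('a \<Rightarrow> ('a, 'e) tvec \<Rightarrow> real) \<Rightarrow>
     ('a, 'e) vfield \<Rightarrow> ('a, 'e) vfield \<Rightarrow> 'a \<Rightarrow> real" where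
  "ext_d1 M \<omega> X Y p = 1/2 *
     (vderiv M p (X p) (\<lambda>q. \<omega> q (Y q)) - vderiv M p (Y p) (\<lambda>q. \<omega> q (X q)) - \<omega> p (bracket M X Y p))"

definition ext_d2 ::
    "('a, 'e::euclidean_space) mfd \<Rightarrow> ('a \<Rightarrow> ('a, 'e) tvec \<Rightarrow> ('a, 'e) tvec \<Rightarrow> real) \<Rightarrow>
     ('a, 'e) vfield \<Rightarrow> ('a, 'e) vfield \<Rightarrow> ('a, 'e) vfield \<Rightarrow> 'a \<Rightarrow> real" where
  "ext_d2 M \<omega> X Y Z p = 1/3 *
     (vderiv M p (X p) (\<lambda>q. \<omega> q (Y q) (Z q)) + vderiv M p (Y p) (\<lambda>q. \<omega> q (Z q) (X q))
      + vderiv M p (Z p) (\<lambda>q. \<omega> q (X q) (Y q))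
      - \<omega> p (bracket M X Y p) (Z p) - \<omega> p (bracket M Y Z p) (X p) - \<omega> p (bracket M Z X p) (Y p))"

definition almost_contact_metric ::
    "('a, 'e::euclidean_space) mfd \<Rightarrow> ('a \<Rightarrow> ('a, 'e) tvec \<Rightarrow> ('a, 'e) tvec) \<Rightarrow> ('a, 'e) vfield \<Rightarrow>
     ('a \<Rightarrow> ('a, 'e) tvec \<Rightarrow> real) \<Rightarrow> ('a \<Rightarrow> ('a, 'e) tvec \<Rightarrow> ('a, 'e) tvec \<Rightarrow> real) \<Rightarrow> bool" where
  "almost_contact_metric M \<phi> \<xi> \<eta> g \<longleftrightarrow>
     smooth_manifold M \<and> tensor11 M \<phi> \<and> smooth_vf M (points M) \<xi> \<and> one_form M \<eta> \<and>
     riemannian_metric M g \<and>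
     (\<forall>p\<in>points M. \<phi> p (\<xi> p) = 0 \<and> \<eta> p (\<xi> p) = 1 \<and>
        (\<forall>u\<in>tangent_space M p.
           \<phi> p (\<phi> p u) = - u + \<eta> p u *\<^sub>R \<xi> p \<and> g p u (\<xi> p) = \<eta> p u \<and> \<eta> p (\<phi> p u) = 0 \<and>
           (\<forall>v\<in>tangent_space M p.
              g p (\<phi> p u) (\<phi> p v) = g p u v - \<eta> p u * \<eta> p v \<and> g p (\<phi> p u) v = - g p u (\<phi> p v))))"

definition normal_structure ::
    "('a, 'e::euclidean_space) mfd \<Rightarrow> ('a \<Rightarrow> ('a, 'e) tvec \<Rightarrow> ('a, 'e) tvec) \<Rightarrow> ('a, 'e) vfield \<Rightarrow>
     ('a \<Rightarrow> ('a, 'e) tvec \<Rightarrow> real) \<Rightarrow> bool" where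
  "normal_structure M \<phi> \<xi> \<eta> \<longleftrightarrow>
     (\<forall>V X Y. openin (Top M) V \<and> smooth_vf M V X \<and> smooth_vf M V Y \<longrightarrow>
        (\<forall>p\<in>V. bracket M (\<lambda>q. \<phi> q (X q)) (\<lambda>q. \<phi> q (Y q)) p + \<phi> p (\<phi> p (bracket M X Y p))
           - \<phi> p (bracket M (\<lambda>q. \<phi> q (X q)) Y p) - \<phi> p (bracket M X (\<lambda>q. \<phi> q (Y q)) p)
           + (2 * ext_d1 M \<eta> X Y p) *\<^sub>R \<xi> p = 0))"

definition fundamental_form ::
    "('a \<Rightarrow> ('a, 'e) tvec \<Rightarrow> ('a, 'e) tvec) \<Rightarrow>
     ('a \<Rightarrow> ('a, 'e) tvec \<Rightarrow> ('a, 'e) tvec \<Rightarrow> real) \<Rightarrow> 'a \<Rightarrow> ('a, 'e) tvec \<Rightarrow> ('a, 'e) tvec \<Rightarrow> real" where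
  "fundamental_form \<phi> g p u v = g p u (\<phi> p v)"

definition sq_sasakian ::
    "('a, 'e::euclidean_space) mfd \<Rightarrow> ('a \<Rightarrow> ('a, 'e) tvec \<Rightarrow> ('a, 'e) tvec) \<Rightarrow> ('a, 'e) vfield \<Rightarrow>
     ('a \<Rightarrow> ('a, 'e) tvec \<Rightarrow> real) \<Rightarrow> ('a \<Rightarrow> ('a, 'e) tvec \<Rightarrow> ('a, 'e) tvec \<Rightarrow> real) \<Rightarrow>
     ('a, 'e) conn \<Rightarrow> ('a \<Rightarrow> real) \<Rightarrow> bool" where
  "sq_sasakian M \<phi> \<xi> \<eta> g nab \<beta> \<longleftrightarrow>
     almost_contact_metric M \<phi> \<xi> \<eta> g \<and> normal_structure M \<phi> \<xi> \<eta> \<and>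
     (\<forall>V X Y Z. openin (Top M) V \<and> smooth_vf M V X \<and> smooth_vf M V Y \<and> smooth_vf M V Z \<longrightarrow>
        (\<forall>p\<in>V. ext_d2 M (fundamental_form \<phi> g) X Y Z p = 0)) \<and>
     levi_civita M g nab \<and> smooth_fun M (points M) \<beta> \<and>
     (\<forall>p\<in>points M. vderiv M p (\<xi> p) \<beta> = 0 \<and>
        (\<forall>u\<in>tangent_space M p. nab p u \<xi> = - \<beta> p *\<^sub>R \<phi> p u))"

section \<open>Submanifolds\<close>

text \<open>\<open>N\<close> is the ambient manifold with metric \<open>g\<close> and Levi-Civita connection \<open>nab\<close>, and \<open>M\<close>
  is a subset with its own manifold structure. The locale only bundles these parameters.
  Vector fields \<open>X, Y, Z, U\<close> on \<open>M\<close> have values in the tangent spaces of \<open>M\<close>; fields along \<open>M\<close>,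
  in particular normal ones, have values in the tangent spaces of \<open>N\<close>.\<close>

locale submanifold_geometry =
  fixes N :: "('a, 'e::euclidean_space) mfd"
    and g :: "'a \<Rightarrow> ('a, 'e) tvec \<Rightarrow> ('a, 'e) tvec \<Rightarrow> real"
    and nab :: "('a, 'e) conn"
    and M :: "('a, 'd::euclidean_space) mfd"
begin

text \<open>The differential at \<open>p\<close> of the inclusion of \<open>M\<close> in \<open>N\<close>.\<close>

definition incl :: "'a \<Rightarrow> ('a, 'd) tvec \<Rightarrow> ('a, 'e) tvec" where
  "incl p v = (\<lambda>c. if c \<in> charts_at N p then vderiv M p v (snd c) else 0)"

definition immersed_submanifold :: bool where
  "immersed_submanifold \<longleftrightarrow>
     smooth_manifold M \<and> points M \<subseteq> points N \<and> continuous_map (Top M) (Top N) (\<lambda>p. p) \<and>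
     (\<forall>c\<in>Charts N. smooth_fun M (fst c \<inter> points M) (snd c)) \<and>
     (\<forall>p\<in>points M. inj_on (incl p) (tangent_space M p))"

definition invariant :: "(('a \<Rightarrow> ('a, 'e) tvec \<Rightarrow> ('a, 'e) tvec)) \<Rightarrow> ('a, 'e) vfield \<Rightarrow> bool" where
  "invariant \<phi> \<xi> \<longleftrightarrow>
     (\<forall>p\<in>points M. \<xi> p \<in> incl p ` tangent_space M p \<and>
        \<phi> p ` incl p ` tangent_space M p \<subseteq> incl p ` tangent_space M p)"

text \<open>The covariant derivative of a field \<open>Y\<close> along \<open>M\<close>, i.e. the connection of \<open>N\<close> pulled back
  to \<open>M\<close>: writing \<open>Y = \<Sum> Y\<^sup>k \<partial>\<^sub>k\<close> in a chart of \<open>N\<close>, it is \<open>\<Sum> u(Y\<^sup>k) \<partial>\<^sub>k + Y\<^sup>k(p) nab\<^sub>u \<partial>\<^sub>k\<close>.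
  This is the derivative of any local extension of \<open>Y\<close> to \<open>N\<close>.\<close>

definition nab_along :: "'a \<Rightarrow> ('a, 'd) tvec \<Rightarrow> ('a, 'e) vfield \<Rightarrow> ('a, 'e) tvec" where
  "nab_along p u Y =
     (let c = chart_at N p
      in coord_vec N c p (vderiv M p u (\<lambda>q. Y q c))
         + nab p (incl p u) (\<lambda>q. coord_vec N c q (Y p c)))"

definition ind_metric :: "'a \<Rightarrow> ('a, 'd) tvec \<Rightarrow> ('a, 'd) tvec \<Rightarrow> real" where
  "ind_metric p u v = g p (incl p u) (incl p v)"

definition tan_part :: "'a \<Rightarrow> ('a, 'e) tvec \<Rightarrow> ('a, 'd) tvec" where
  "tan_part p w =
     (THE v. v \<in> tangent_space M p \<and> (\<forall>u\<in>tangent_space M p. g p (w - incl p v) (incl p u) = 0))"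

definition nor_part :: "'a \<Rightarrow> ('a, 'e) tvec \<Rightarrow> ('a, 'e) tvec" where
  "nor_part p w = w - incl p (tan_part p w)"

definition ind_conn :: "('a, 'd) vfield \<Rightarrow> ('a, 'd) vfield \<Rightarrow> ('a, 'd) vfield" where
  "ind_conn X Y p = tan_part p (nab_along p (X p) (\<lambda>q. incl q (Y q)))"

definition sff :: "('a, 'd) vfield \<Rightarrow> ('a, 'd) vfield \<Rightarrow> ('a, 'e) vfield" where
  "sff X Y p = nor_part p (nab_along p (X p) (\<lambda>q. incl q (Y q)))"

definition nor_conn :: "('a, 'd) vfield \<Rightarrow> ('a, 'e) vfield \<Rightarrow> ('a, 'e) vfield" where
  "nor_conn X \<nu> p = nor_part p (nab_along p (X p) \<nu>)"

definition totally_geodesic :: bool where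
  "totally_geodesic \<longleftrightarrow>
     (\<forall>V X Y. openin (Top M) V \<and> smooth_vf M V X \<and> smooth_vf M V Y \<longrightarrow> (\<forall>p\<in>V. sff X Y p = 0))"

definition nab_sff ::
    "('a, 'd) vfield \<Rightarrow> ('a, 'd) vfield \<Rightarrow> ('a, 'd) vfield \<Rightarrow> ('a, 'e) vfield" where
  "nab_sff X Y Z p = nor_conn X (sff Y Z) p - sff (ind_conn X Y) Z p - sff Y (ind_conn X Z) p"

definition parallel :: bool where
  "parallel \<longleftrightarrow>
     (\<forall>V X Y Z. openin (Top M) V \<and> smooth_vf M V X \<and> smooth_vf M V Y \<and> smooth_vf M V Z \<longrightarrow>
        (\<forall>p\<in>V. nab_sff X Y Z p = 0))"

definition chaki_pseudo_parallel :: "('a \<Rightarrow> ('a, 'd) tvec \<Rightarrow> real) \<Rightarrow> bool" where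
  "chaki_pseudo_parallel \<alpha> \<longleftrightarrow>
     one_form M \<alpha> \<and> (\<forall>p\<in>points M. \<exists>u\<in>tangent_space M p. \<alpha> p u \<noteq> 0) \<and>
     (\<forall>V X Y Z. openin (Top M) V \<and> smooth_vf M V X \<and> smooth_vf M V Y \<and> smooth_vf M V Z \<longrightarrow>
        (\<forall>p\<in>V. nab_sff X Y Z p =
           (2 * \<alpha> p (X p)) *\<^sub>R sff Y Z p + \<alpha> p (Y p) *\<^sub>R sff X Z p + \<alpha> p (Z p) *\<^sub>R sff X Y p))"

definition ind_curv ::
    "('a, 'd) vfield \<Rightarrow> ('a, 'd) vfield \<Rightarrow> ('a, 'd) vfield \<Rightarrow> ('a, 'd) vfield" where
  "ind_curv X Y Z p =
     ind_conn X (ind_conn Y Z) p - ind_conn Y (ind_conn X Z) p - ind_conn (bracket M X Y) Z p"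

definition nor_curv ::
    "('a, 'd) vfield \<Rightarrow> ('a, 'd) vfield \<Rightarrow> ('a, 'e) vfield \<Rightarrow> ('a, 'e) vfield" where
  "nor_curv X Y \<nu> p =
     nor_conn X (nor_conn Y \<nu>) p - nor_conn Y (nor_conn X \<nu>) p - nor_conn (bracket M X Y) \<nu> p"

definition curv_sff ::
    "('a, 'd) vfield \<Rightarrow> ('a, 'd) vfield \<Rightarrow> ('a, 'd) vfield \<Rightarrow> ('a, 'd) vfield \<Rightarrow> ('a, 'e) vfield" where
  "curv_sff X Y Z U p =
     nor_curv X Y (sff Z U) p - sff (ind_curv X Y Z) U p - sff Z (ind_curv X Y U) p"

definition Q_sff ::
    "('a, 'd) vfield \<Rightarrow> ('a, 'd) vfield \<Rightarrow> ('a, 'd) vfield \<Rightarrow> ('a, 'd) vfield \<Rightarrow> ('a, 'e) vfield" where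
  "Q_sff Z U X Y p =
     ind_metric p (Y p) (Z p) *\<^sub>R sff X U p - ind_metric p (X p) (Z p) *\<^sub>R sff Y U p
     + ind_metric p (Y p) (U p) *\<^sub>R sff X Z p - ind_metric p (X p) (U p) *\<^sub>R sff Y Z p"

definition semiparallel :: bool where
  "semiparallel \<longleftrightarrow>
     (\<forall>V X Y Z U. openin (Top M) V \<and> smooth_vf M V X \<and> smooth_vf M V Y \<and> smooth_vf M V Z \<and>
        smooth_vf M V U \<longrightarrow> (\<forall>p\<in>V. curv_sff X Y Z U p = 0))"

text \<open>The value of the second fundamental form on two vectors at \<open>p\<close>. Since \<open>sff\<close> is tensorial, any
  extension of the vectors to vector fields would do.\<close>

definition sff_at :: "'a \<Rightarrow> ('a, 'd) tvec \<Rightarrow> ('a, 'd) tvec \<Rightarrow> ('a, 'e) tvec" where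
  "sff_at p u v =
     (let b = chart_at M p in sff (\<lambda>q. coord_vec M b q (u b)) (\<lambda>q. coord_vec M b q (v b)) p)"

definition orthonormal_basis_at :: "'a \<Rightarrow> ('a, 'd) tvec set \<Rightarrow> bool" where
  "orthonormal_basis_at p E \<longleftrightarrow>
     E \<subseteq> tangent_space M p \<and> finite E \<and> card E = DIM('d) \<and>
     (\<forall>u\<in>E. \<forall>v\<in>E. ind_metric p u v = (if u = v then 1 else 0))"

definition mean_curvature :: "('a, 'e) vfield" where
  "mean_curvature p =
     (1 / real DIM('d)) *\<^sub>R (\<Sum>u\<in>(SOME E. orthonormal_basis_at p E). sff_at p u u)"

definition non_umbilic_points :: "'a set" where
  "non_umbilic_points =
     {p \<in> points M. \<exists>u\<in>tangent_space M p. \<exists>v\<in>tangent_space M p.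
        sff_at p u v - ind_metric p u v *\<^sub>R mean_curvature p \<noteq> 0}"

text \<open>\<open>L\<close> is only relevant as a function on \<open>non_umbilic_points\<close>, and no regularity is required.\<close>

definition deszcz_pseudo_parallel :: "('a \<Rightarrow> real) \<Rightarrow> bool" where
  "deszcz_pseudo_parallel L \<longleftrightarrow>
     (\<forall>V X Y Z U. openin (Top M) V \<and> smooth_vf M V X \<and> smooth_vf M V Y \<and> smooth_vf M V Z \<and>
        smooth_vf M V U \<longrightarrow>
        (\<forall>p\<in>V \<inter> non_umbilic_points. curv_sff X Y Z U p = L p *\<^sub>R Q_sff Z U X Y p))"

end

end

theory Submission
  imports Defs
begin

text \<open>Since \<open>\<nabla>\<^sub>X \<xi> = -\<beta> \<phi> X\<close> is tangent to \<open>M\<close>, \<open>h(X,\<xi>) = 0\<close> and \<open>\<xi>\<close> has the same derivatives in \<open>M\<close>. Hence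
  \<open>(\<nabla>\<^sub>X h)(Y,\<xi>) = \<beta> h(Y,\<phi>X)\<close>, and applying the Chaki condition twice, to \<open>X\<close> and to \<open>\<phi>X\<close>, gives
  \<open>(\<alpha>(\<xi>)\<^sup>2 + \<beta>\<^sup>2) h = 0\<close>. Normality forces \<open>\<nabla>\<^sub>\<xi> \<phi> = 0\<close>, so with \<open>\<xi>\<beta> = 0\<close> one gets
  \<open>R(X,\<xi>)\<xi> = -\<beta>\<^sup>2 \<phi>\<^sup>2 X\<close> on \<open>M\<close>; therefore \<open>(R(X,\<xi>) \<cdot> h)(Z,\<xi>) = -\<beta>\<^sup>2 h(Z,X)\<close>, whereas
  \<open>Q(g,h)(Z,\<xi>;X,\<xi>) = h(X,Z)\<close>, and the Deszcz condition gives \<open>(L + \<beta>\<^sup>2) h = 0\<close> at the points of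
  \<open>W\<close>. At the other points \<open>h = H g\<close> with \<open>H = h(\<xi>,\<xi>) = 0\<close>. The smoothness of tangential parts comes
  from the smooth dependence of the solution of a linear system, here with the Gram matrix of a
  coordinate frame, on its coefficients.\<close>

section \<open>Smooth functions on Euclidean spaces\<close>

text \<open>The geometry is short; the labour lies in iterating derivatives along \<open>M\<close>.
  The definitions of \<open>nab_sff\<close> and \<open>curv_sff\<close> feed
  \<open>ind_conn\<close>, \<open>nor_conn\<close> and \<open>sff\<close> back into one another, so
  each intermediate field must be known to be smooth on an open set of \<open>M\<close>, and some
  are fields along \<open>M\<close> rather than fields of \<open>N\<close>. Extensions to
  \<open>N\<close> are never constructed. A field along \<open>M\<close> is instead written in the
  coordinate fields of \<open>N\<close> with coefficients smooth on \<open>M\<close>; since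
  \<open>nab_along\<close> obeys the Leibniz rule, torsion-freeness and \<nabla>_\<xi> \<phi> = 0
  are reduced to coordinate fields, for which they are statements about \<open>N\<close>. Everything
  else comes from putting \<xi> into one slot of h. All that this detects is a multiple of h whose
  factor is built from \<beta> and from the coefficient in the condition, \<alpha>(\<xi>) or L. For
  semiparallel submanifolds that coefficient is 0, so this method reaches h = 0 only where \<beta>
  \<noteq> 0.\<close>

lemma frechet_derivative_eqI:
  "(f has_derivative f') (at x) \<Longrightarrow> frechet_derivative f (at x) = f'"
  using frechet_derivative_at by metis

lemma Ck_on_imp_continuous_on: "Ck_on k S f \<Longrightarrow> continuous_on S f"
  by (cases k) (auto intro!: continuous_at_imp_continuous_on differentiable_imp_continuous_within)

lemma Ck_on_Suc_imp: "Ck_on (Suc k) S f \<Longrightarrow> Ck_on k S f"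
proof (induction k arbitrary: f)
  case 0
  then show ?case using Ck_on_imp_continuous_on by (metis Ck_on.simps(1))
next
  case (Suc k)
  then show ?case by (metis Ck_on.simps(2))
qed

lemma Ck_on_subset: "Ck_on k S f \<Longrightarrow> T \<subseteq> S \<Longrightarrow> Ck_on k T f"
  by (induction k arbitrary: f) (auto intro: continuous_on_subset)

lemma has_derivative_cong_open:
  assumes "open S" "x \<in> S" "\<And>y. y \<in> S \<Longrightarrow> f y = g y"
  shows "(f has_derivative D) (at x) \<longleftrightarrow> (g has_derivative D) (at x)"
  using assms by (metis has_derivative_transform_within_open)

lemma frechet_derivative_cong_open:
  assumes "open S" "x \<in> S" "\<And>y. y \<in> S \<Longrightarrow> f y = g y"
  shows "frechet_derivative f (at x) = frechet_derivative g (at x)"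
  using has_derivative_cong_open[OF assms] by (simp add: frechet_derivative_def)

lemma differentiable_cong_open:
  assumes "open S" "x \<in> S" "\<And>y. y \<in> S \<Longrightarrow> f y = g y" "f differentiable (at x)"
  shows "g differentiable (at x)"
  using assms(4) has_derivative_cong_open[OF assms(1-3)] by (simp add: differentiable_def)

text \<open>\<open>in_chart\<close> takes arbitrary values outside the image of a chart, so
  functions can be compared only on an open set. Openness makes the Frechet derivatives agree there
  as well, and the induction passes to them.\<close>

lemma Ck_on_cong:
  assumes "open S" "\<And>y. y \<in> S \<Longrightarrow> f y = g y" "Ck_on k S f"
  shows "Ck_on k S g"
  using assms(2,3)
proof (induction k arbitrary: f g)
  case 0
  then show ?case by (simp cong: continuous_on_cong)
next
  case (Suc k)
  have "g differentiable (at x)" if "x \<in> S" for x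
    using Suc.prems that by (auto intro: differentiable_cong_open[OF assms(1) that, of f])
  moreover have "Ck_on k S (\<lambda>x. frechet_derivative g (at x) v)" for v
    by (rule Suc.IH[of "\<lambda>x. frechet_derivative f (at x) v"])
      (use Suc.prems frechet_derivative_cong_open[OF assms(1)] in \<open>metis, auto\<close>)
  ultimately show ?case by simp
qed

lemma Ck_on_local:
  assumes "\<And>x. x \<in> S \<Longrightarrow> \<exists>T. open T \<and> x \<in> T \<and> Ck_on k T f"
  shows "Ck_on k S f"
  using assms
proof (induction k arbitrary: f)
  case 0
  then show ?case
    by (metis Ck_on.simps(1) continuous_at_imp_continuous_on continuous_on_eq_continuous_at)
next
  case (Suc k)
  have "f differentiable (at x)" if "x \<in> S" for x
    using Suc.prems[OF that] by auto
  moreover have "Ck_on k S (\<lambda>x. frechet_derivative f (at x) v)" for v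
    by (rule Suc.IH) (use Suc.prems in \<open>metis Ck_on.simps(2)\<close>)
  ultimately show ?case by simp
qed

lemma Ck_on_const: "Ck_on k S (\<lambda>x. c)"
proof (induction k arbitrary: c)
  case (Suc k)
  then show ?case by simp
qed simp

lemma Ck_on_add:
  assumes "open S" "Ck_on k S f" "Ck_on k S g"
  shows "Ck_on k S (\<lambda>x. f x + g x)"
  using assms(2,3)
proof (induction k arbitrary: f g)
  case 0
  then show ?case by (simp add: continuous_on_add)
next
  case (Suc k)
  have D: "((\<lambda>x. f x + g x) has_derivative
      (\<lambda>v. frechet_derivative f (at x) v + frechet_derivative g (at x) v)) (at x)" if "x \<in> S" for x
    using Suc.prems that by (auto intro!: has_derivative_add simp: frechet_derivative_works[symmetric])
  have "Ck_on k S (\<lambda>x. frechet_derivative (\<lambda>x. f x + g x) (at x) v)" for v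
  proof (rule Ck_on_cong[OF assms(1)])
    show "Ck_on k S (\<lambda>x. frechet_derivative f (at x) v + frechet_derivative g (at x) v)"
      using Suc by auto
  qed (simp add: frechet_derivative_eqI[OF D])
  then show ?case using D by (auto simp: differentiable_def)
qed

lemma Ck_on_bounded_linear:
  assumes "open S" "bounded_linear h" "Ck_on k S f"
  shows "Ck_on k S (\<lambda>x. h (f x))"
  using assms(3)
proof (induction k arbitrary: f)
  case 0
  then show ?case by (simp add: assms(2) bounded_linear.continuous_on)
next
  case (Suc k)
  have D: "((\<lambda>x. h (f x)) has_derivative (\<lambda>v. h (frechet_derivative f (at x) v))) (at x)"
    if "x \<in> S" for x
    using Suc.prems that
    by (auto intro!: bounded_linear.has_derivative[OF assms(2)] simp: frechet_derivative_works[symmetric])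
  have "Ck_on k S (\<lambda>x. frechet_derivative (\<lambda>x. h (f x)) (at x) v)" for v
  proof (rule Ck_on_cong[OF assms(1)])
    show "Ck_on k S (\<lambda>x. h (frechet_derivative f (at x) v))"
      using Suc by auto
  qed (simp add: frechet_derivative_eqI[OF D])
  then show ?case using D by (auto simp: differentiable_def)
qed

lemma Ck_on_scaleR:
  assumes "open S" "Ck_on k S f" "Ck_on k S g"
  shows "Ck_on k S (\<lambda>x. f x *\<^sub>R g x)"
  using assms(2,3)
proof (induction k arbitrary: f g)
  case 0
  then show ?case by (simp add: continuous_on_scaleR)
next
  case (Suc k)
  have D: "((\<lambda>x. f x *\<^sub>R g x) has_derivative
      (\<lambda>v. f x *\<^sub>R frechet_derivative g (at x) v + frechet_derivative f (at x) v *\<^sub>R g x)) (at x)"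
    if "x \<in> S" for x
    using Suc.prems that
    by (auto intro!: has_derivative_scaleR simp: frechet_derivative_works[symmetric])
  have "Ck_on k S (\<lambda>x. frechet_derivative (\<lambda>x. f x *\<^sub>R g x) (at x) v)" for v
  proof (rule Ck_on_cong[OF assms(1)])
    show "Ck_on k S (\<lambda>x. f x *\<^sub>R frechet_derivative g (at x) v + frechet_derivative f (at x) v *\<^sub>R g x)"
      using Suc Ck_on_Suc_imp[OF Suc.prems(1)] Ck_on_Suc_imp[OF Suc.prems(2)]
      by (intro Ck_on_add[OF assms(1)] Suc.IH) auto
  qed (simp add: frechet_derivative_eqI[OF D])
  then show ?case using D by (auto simp: differentiable_def)
qed

lemma Ck_on_sum:
  assumes "open S" "\<And>i. i \<in> I \<Longrightarrow> Ck_on k S (f i)"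
  shows "Ck_on k S (\<lambda>x. \<Sum>i\<in>I. f i x)"
proof (cases "finite I")
  case True
  then show ?thesis using assms(2)
    by (induction I) (auto intro: Ck_on_const Ck_on_add[OF assms(1)])
qed (auto intro: Ck_on_const)

lemma linear_euclidean_sum:
  fixes f :: "'e::euclidean_space \<Rightarrow> 'f::real_vector"
  assumes "linear f"
  shows "f u = (\<Sum>i\<in>Basis. (u \<bullet> i) *\<^sub>R f i)"
proof -
  have "f u = f (\<Sum>i\<in>Basis. (u \<bullet> i) *\<^sub>R i)" by (simp add: euclidean_representation)
  also have "\<dots> = (\<Sum>i\<in>Basis. (u \<bullet> i) *\<^sub>R f i)"
    by (simp add: linear_sum[OF assms] linear_scale[OF assms])
  finally show ?thesis .
qed

text \<open>In the chain rule the outer derivative is taken in a direction that moves with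
  \<open>x\<close>, whereas \<open>Ck_on\<close> speaks of fixed directions. Expanding that
  direction over \<open>Basis\<close> leaves products of a scalar function with composites of the
  same inner map, to which the induction hypothesis applies.\<close>

lemma Ck_on_compose:
  fixes f :: "'d::euclidean_space \<Rightarrow> 'e::euclidean_space"
  assumes "open S" "open T" "f ` S \<subseteq> T" "Ck_on k S f" "Ck_on k T h"
  shows "Ck_on k S (\<lambda>x. h (f x))"
  using assms(4,5)
proof (induction k arbitrary: h)
  case 0
  then show ?case using assms(3) by (auto intro: continuous_on_compose2)
next
  case (Suc k)
  have D: "((\<lambda>x. h (f x)) has_derivative
      (\<lambda>v. frechet_derivative h (at (f x)) (frechet_derivative f (at x) v))) (at x)"
    if "x \<in> S" for x
  proof (rule has_derivative_compose[of f])
    show "(f has_derivative frechet_derivative f (at x)) (at x)"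
      using Suc.prems that by (simp add: frechet_derivative_works[symmetric])
    show "(h has_derivative frechet_derivative h (at (f x))) (at (f x))"
      using Suc.prems that assms(3) by (auto simp: frechet_derivative_works[symmetric])
  qed
  have "Ck_on k S (\<lambda>x. frechet_derivative (\<lambda>x. h (f x)) (at x) v)" for v
  proof (rule Ck_on_cong[OF assms(1)])
    show "Ck_on k S (\<lambda>x. \<Sum>i\<in>Basis. (frechet_derivative f (at x) v \<bullet> i) *\<^sub>R frechet_derivative h (at (f x)) i)"
    proof (intro Ck_on_sum Ck_on_scaleR assms(1))
      fix i :: 'e
      show "Ck_on k S (\<lambda>x. frechet_derivative f (at x) v \<bullet> i)"
        using Suc.prems by (intro Ck_on_bounded_linear[OF assms(1) bounded_linear_inner_left]) simp
      show "Ck_on k S (\<lambda>x. frechet_derivative h (at (f x)) i)"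
        by (rule Suc.IH[OF Ck_on_Suc_imp[OF Suc.prems(1)]]) (use Suc.prems in simp)
    qed
  next
    fix x assume x: "x \<in> S"
    have "linear (frechet_derivative h (at (f x)))"
      using Suc.prems x assms(3) by (intro linear_frechet_derivative) auto
    from linear_euclidean_sum[OF this, of "frechet_derivative f (at x) v"]
    show "(\<Sum>i\<in>Basis. (frechet_derivative f (at x) v \<bullet> i) *\<^sub>R frechet_derivative h (at (f x)) i) =
        frechet_derivative (\<lambda>x. h (f x)) (at x) v"
      by (simp add: frechet_derivative_eqI[OF D[OF x]])
  qed
  then show ?case using D by (auto simp: differentiable_def)
qed

lemma smooth_on_imp_Ck_on: "smooth_on S f \<Longrightarrow> Ck_on k S f"
  by (simp add: smooth_on_def)

lemma smooth_on_imp_continuous_on: "smooth_on S f \<Longrightarrow> continuous_on S f"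
  unfolding smooth_on_def by (blast intro: Ck_on_imp_continuous_on)

lemma smooth_on_imp_differentiable: "smooth_on S f \<Longrightarrow> x \<in> S \<Longrightarrow> f differentiable (at x)"
  using smooth_on_imp_Ck_on[of S f "Suc 0"] by simp

lemma smooth_on_has_derivative:
  "smooth_on S f \<Longrightarrow> x \<in> S \<Longrightarrow> (f has_derivative frechet_derivative f (at x)) (at x)"
  using smooth_on_imp_differentiable frechet_derivative_works by blast

lemma smooth_on_frechet_derivative:
  "smooth_on S f \<Longrightarrow> smooth_on S (\<lambda>x. frechet_derivative f (at x) v)"
  unfolding smooth_on_def using Ck_on.simps(2) by blast

lemma smooth_on_subset: "smooth_on S f \<Longrightarrow> T \<subseteq> S \<Longrightarrow> smooth_on T f"
  by (auto simp: smooth_on_def intro: Ck_on_subset)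

lemma smooth_on_cong:
  "open S \<Longrightarrow> (\<And>y. y \<in> S \<Longrightarrow> f y = g y) \<Longrightarrow> smooth_on S f \<Longrightarrow> smooth_on S g"
  unfolding smooth_on_def by (blast intro: Ck_on_cong)

lemma smooth_on_local:
  assumes "\<And>x. x \<in> S \<Longrightarrow> \<exists>T. open T \<and> x \<in> T \<and> smooth_on T f"
  shows "smooth_on S f"
  unfolding smooth_on_def
proof
  fix k
  show "Ck_on k S f"
    by (rule Ck_on_local) (meson assms smooth_on_imp_Ck_on)
qed

lemma smooth_on_const: "smooth_on S (\<lambda>x. c)"
  by (simp add: smooth_on_def Ck_on_const)

lemma smooth_on_add:
  "open S \<Longrightarrow> smooth_on S f \<Longrightarrow> smooth_on S g \<Longrightarrow> smooth_on S (\<lambda>x. f x + g x)"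
  by (simp add: smooth_on_def Ck_on_add)

lemma smooth_on_bounded_linear:
  "open S \<Longrightarrow> bounded_linear h \<Longrightarrow> smooth_on S f \<Longrightarrow> smooth_on S (\<lambda>x. h (f x))"
  by (simp add: smooth_on_def Ck_on_bounded_linear)

lemma smooth_on_scaleR:
  "open S \<Longrightarrow> smooth_on S f \<Longrightarrow> smooth_on S g \<Longrightarrow> smooth_on S (\<lambda>x. f x *\<^sub>R g x)"
  by (simp add: smooth_on_def Ck_on_scaleR)

lemma smooth_on_sum:
  "open S \<Longrightarrow> (\<And>i. i \<in> I \<Longrightarrow> smooth_on S (f i)) \<Longrightarrow> smooth_on S (\<lambda>x. \<Sum>i\<in>I. f i x)"
  by (simp add: smooth_on_def Ck_on_sum)

lemma smooth_on_compose:
  fixes f :: "'d::euclidean_space \<Rightarrow> 'e::euclidean_space"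
  shows "open S \<Longrightarrow> open T \<Longrightarrow> f ` S \<subseteq> T \<Longrightarrow> smooth_on S f \<Longrightarrow> smooth_on T h \<Longrightarrow>
    smooth_on S (\<lambda>x. h (f x))"
  unfolding smooth_on_def by (blast intro: Ck_on_compose)

text \<open>Both mixed derivatives are attained, at points near \<open>x\<close>, by the second difference quotient of
  \<open>f\<close> over a small parallelogram with sides parallel to \<open>u\<close> and \<open>v\<close>.\<close>

lemma mixed_difference_quotient:
  fixes f :: "'e::euclidean_space \<Rightarrow> real"
  assumes f: "smooth_on S f" and t: "t > 0"
    and S: "\<And>a b. 0 \<le> a \<Longrightarrow> a \<le> t \<Longrightarrow> 0 \<le> b \<Longrightarrow> b \<le> t \<Longrightarrow> x + a *\<^sub>R u + b *\<^sub>R v \<in> S"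
  shows "\<exists>a b. 0 \<le> a \<and> a \<le> t \<and> 0 \<le> b \<and> b \<le> t \<and>
    f (x + t *\<^sub>R u + t *\<^sub>R v) - f (x + t *\<^sub>R u) - f (x + t *\<^sub>R v) + f x =
      t\<^sup>2 * frechet_derivative (\<lambda>y. frechet_derivative f (at y) u) (at (x + a *\<^sub>R u + b *\<^sub>R v)) v"
proof -
  define D where "D y = frechet_derivative f (at y) u" for y
  define E where "E y = frechet_derivative D (at y) v" for y
  have Df: "(f has_derivative frechet_derivative f (at y)) (at y)" if "y \<in> S" for y
    using f that by (rule smooth_on_has_derivative)
  have DD: "(D has_derivative frechet_derivative D (at y)) (at y)" if "y \<in> S" for y
    using smooth_on_frechet_derivative[OF f] that unfolding D_def by (rule smooth_on_has_derivative)
  have f1: "((\<lambda>s. f (x + s *\<^sub>R u + b *\<^sub>R v)) has_real_derivative D (x + s *\<^sub>R u + b *\<^sub>R v)) (at s)"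
    if "0 \<le> s" "s \<le> t" "0 \<le> b" "b \<le> t" for s b
  proof -
    have "((\<lambda>s. f (x + s *\<^sub>R u + b *\<^sub>R v)) has_derivative
        (\<lambda>h. frechet_derivative f (at (x + s *\<^sub>R u + b *\<^sub>R v)) (h *\<^sub>R u))) (at s)"
    proof (rule has_derivative_compose[where f = "\<lambda>s. x + s *\<^sub>R u + b *\<^sub>R v" and f' = "\<lambda>h. h *\<^sub>R u"])
      show "((\<lambda>s. x + s *\<^sub>R u + b *\<^sub>R v) has_derivative (\<lambda>h. h *\<^sub>R u)) (at s)"
        by (auto intro!: derivative_eq_intros)
    qed (rule Df[OF S[OF that]])
    moreover have "linear (frechet_derivative f (at (x + s *\<^sub>R u + b *\<^sub>R v)))"
      using Df[OF S[OF that]] has_derivative_linear by blast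
    ultimately show ?thesis
      by (simp add: has_field_derivative_def linear_scale D_def[symmetric] mult_commute_abs)
  qed
  have f2: "((\<lambda>s. D (x + a *\<^sub>R u + s *\<^sub>R v)) has_real_derivative E (x + a *\<^sub>R u + s *\<^sub>R v)) (at s)"
    if "0 \<le> a" "a \<le> t" "0 \<le> s" "s \<le> t" for s a
  proof -
    have "((\<lambda>s. D (x + a *\<^sub>R u + s *\<^sub>R v)) has_derivative
        (\<lambda>h. frechet_derivative D (at (x + a *\<^sub>R u + s *\<^sub>R v)) (h *\<^sub>R v))) (at s)"
    proof (rule has_derivative_compose[where f = "\<lambda>s. x + a *\<^sub>R u + s *\<^sub>R v" and f' = "\<lambda>h. h *\<^sub>R v"])
      show "((\<lambda>s. x + a *\<^sub>R u + s *\<^sub>R v) has_derivative (\<lambda>h. h *\<^sub>R v)) (at s)"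
        by (auto intro!: derivative_eq_intros)
    qed (rule DD[OF S[OF that]])
    moreover have "linear (frechet_derivative D (at (x + a *\<^sub>R u + s *\<^sub>R v)))"
      using DD[OF S[OF that]] has_derivative_linear by blast
    ultimately show ?thesis
      by (simp add: has_field_derivative_def linear_scale E_def[symmetric] mult_commute_abs)
  qed
  \<comment> \<open>The second difference is \<open>p t - p 0\<close>. The mean value theorem is
    applied to \<open>p\<close> in the direction \<open>u\<close>, then to \<open>D\<close> in the
    direction \<open>v\<close>. The summand \<open>0 *\<^sub>R v\<close> gives both terms of
    \<open>p\<close> the shape required by \<open>f1\<close>.\<close>
  define p where "p s = f (x + s *\<^sub>R u + t *\<^sub>R v) - f (x + s *\<^sub>R u + 0 *\<^sub>R v)" for s
  have "\<exists>a. 0 < a \<and> a < t \<and>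
      p t - p 0 = (t - 0) * (D (x + a *\<^sub>R u + t *\<^sub>R v) - D (x + a *\<^sub>R u + 0 *\<^sub>R v))"
    using t unfolding p_def by (intro MVT2 DERIV_diff f1) auto
  then obtain a where a: "0 < a" "a < t"
      "p t - p 0 = t * (D (x + a *\<^sub>R u + t *\<^sub>R v) - D (x + a *\<^sub>R u + 0 *\<^sub>R v))" by auto
  have "\<exists>b. 0 < b \<and> b < t \<and>
      D (x + a *\<^sub>R u + t *\<^sub>R v) - D (x + a *\<^sub>R u + 0 *\<^sub>R v) = (t - 0) * E (x + a *\<^sub>R u + b *\<^sub>R v)"
    using t a by (intro MVT2 f2) auto
  then obtain b where b: "0 < b" "b < t"
      "D (x + a *\<^sub>R u + t *\<^sub>R v) - D (x + a *\<^sub>R u + 0 *\<^sub>R v) = t * E (x + a *\<^sub>R u + b *\<^sub>R v)" by auto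
  have "f (x + t *\<^sub>R u + t *\<^sub>R v) - f (x + t *\<^sub>R u) - f (x + t *\<^sub>R v) + f x =
      t\<^sup>2 * E (x + a *\<^sub>R u + b *\<^sub>R v)"
    using a(3) unfolding b(3) by (simp add: p_def power2_eq_square algebra_simps)
  with a b show ?thesis unfolding E_def D_def by (meson less_imp_le)
qed

lemma mixed_derivatives_commute_real:
  fixes f :: "'e::euclidean_space \<Rightarrow> real"
  assumes f: "smooth_on S f" and S: "open S" "x \<in> S"
  shows "frechet_derivative (\<lambda>y. frechet_derivative f (at y) u) (at x) v =
    frechet_derivative (\<lambda>y. frechet_derivative f (at y) v) (at x) u"
proof -
  define E where "E u v y = frechet_derivative (\<lambda>y. frechet_derivative f (at y) u) (at y) v" for u v y
  have cont: "isCont (E u v) x" for u v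
    using smooth_on_imp_continuous_on[OF smooth_on_frechet_derivative[OF smooth_on_frechet_derivative[OF f]]] S
    unfolding E_def by (simp add: continuous_on_eq_continuous_at)
  have "\<bar>E u v x - E v u x\<bar> \<le> e" if "e > 0" for e
  proof -
    obtain d1 where d1: "d1 > 0" "\<And>y. dist y x < d1 \<Longrightarrow> dist (E u v y) (E u v x) < e/2"
      using cont[of u v] \<open>e > 0\<close> unfolding continuous_at_eps_delta by (meson half_gt_zero)
    obtain d2 where d2: "d2 > 0" "\<And>y. dist y x < d2 \<Longrightarrow> dist (E v u y) (E v u x) < e/2"
      using cont[of v u] \<open>e > 0\<close> unfolding continuous_at_eps_delta by (meson half_gt_zero)
    obtain d3 where d3: "d3 > 0" "ball x d3 \<subseteq> S" using S openE by blast
    define d where "d = min d1 (min d2 d3)"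
    \<comment> \<open>The extra 1 keeps the quotient defined for \<open>u = v = 0\<close> and makes
      the bound on the distance from \<open>x\<close> strict.\<close>
    define t where "t = d / (norm u + norm v + 1)"
    have d: "d > 0" using d1 d2 d3 by (simp add: d_def)
    have nn: "norm u + norm v + 1 > 0" by (simp add: add_nonneg_pos)
    have t: "t > 0" using d nn by (simp add: t_def)
    have near: "dist (x + a *\<^sub>R u + b *\<^sub>R v) x < d" if "0 \<le> a" "a \<le> t" "0 \<le> b" "b \<le> t" for a b u' v'
    proof -
      have "dist (x + a *\<^sub>R u + b *\<^sub>R v) x \<le> a * norm u + b * norm v"
        using that norm_triangle_ineq[of "a *\<^sub>R u" "b *\<^sub>R v"] by (simp add: dist_norm)
      also have "\<dots> \<le> t * norm u + t * norm v" using that by (intro add_mono mult_right_mono) auto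
      also have "\<dots> < t * (norm u + norm v + 1)" using t by (simp add: algebra_simps)
      also have "\<dots> = d" using nn by (simp add: t_def)
      finally show ?thesis .
    qed
    have in_S: "x + a *\<^sub>R u + b *\<^sub>R v \<in> S" if "0 \<le> a" "a \<le> t" "0 \<le> b" "b \<le> t" for a b
      using near[OF that] d3 by (auto simp: d_def dist_commute subset_eq)
    obtain a b where ab: "0 \<le> a" "a \<le> t" "0 \<le> b" "b \<le> t"
      "f (x + t *\<^sub>R u + t *\<^sub>R v) - f (x + t *\<^sub>R u) - f (x + t *\<^sub>R v) + f x = t\<^sup>2 * E u v (x + a *\<^sub>R u + b *\<^sub>R v)"
      using mixed_difference_quotient[OF f t in_S] unfolding E_def by blast
    have in_S': "x + a *\<^sub>R v + b *\<^sub>R u \<in> S" if "0 \<le> a" "a \<le> t" "0 \<le> b" "b \<le> t" for a b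
      using in_S[OF that(3,4,1,2)] by (simp add: add_ac)
    obtain a' b' where ab': "0 \<le> a'" "a' \<le> t" "0 \<le> b'" "b' \<le> t"
      "f (x + t *\<^sub>R v + t *\<^sub>R u) - f (x + t *\<^sub>R v) - f (x + t *\<^sub>R u) + f x = t\<^sup>2 * E v u (x + a' *\<^sub>R v + b' *\<^sub>R u)"
      using mixed_difference_quotient[OF f t in_S'] unfolding E_def by blast
    have "t\<^sup>2 * E u v (x + a *\<^sub>R u + b *\<^sub>R v) = t\<^sup>2 * E v u (x + b' *\<^sub>R u + a' *\<^sub>R v)"
    proof -
      have swap: "x + t *\<^sub>R v + t *\<^sub>R u = x + t *\<^sub>R u + t *\<^sub>R v"
        "x + a' *\<^sub>R v + b' *\<^sub>R u = x + b' *\<^sub>R u + a' *\<^sub>R v" by (simp_all add: add_ac)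
      show ?thesis using ab(5) ab'(5) unfolding swap by linarith
    qed
    then have "E u v (x + a *\<^sub>R u + b *\<^sub>R v) = E v u (x + b' *\<^sub>R u + a' *\<^sub>R v)" using t by simp
    moreover have "dist (E u v (x + a *\<^sub>R u + b *\<^sub>R v)) (E u v x) < e/2"
      using near[OF ab(1-4)] by (intro d1) (simp add: d_def)
    moreover have "dist (E v u (x + b' *\<^sub>R u + a' *\<^sub>R v)) (E v u x) < e/2"
      using near[OF ab'(3,4,1,2)] by (intro d2) (simp add: d_def)
    ultimately show ?thesis by (simp add: dist_real_def abs_if split: if_splits)
  qed
  then have "\<bar>E u v x - E v u x\<bar> \<le> 0" by (rule field_le_epsilon) simp
  then show ?thesis by (simp add: E_def)
qed

lemma mixed_derivatives_commute:
  fixes f :: "'e::euclidean_space \<Rightarrow> 'f::euclidean_space"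
  assumes f: "smooth_on S f" and S: "open S" "x \<in> S"
  shows "frechet_derivative (\<lambda>y. frechet_derivative f (at y) u) (at x) v =
    frechet_derivative (\<lambda>y. frechet_derivative f (at y) v) (at x) u"
proof (rule euclidean_eqI)
  fix i :: 'f assume "i \<in> Basis"
  have inner: "frechet_derivative (\<lambda>y. h y \<bullet> i) (at y) w = frechet_derivative h (at y) w \<bullet> i"
    if "smooth_on S h" "y \<in> S" for h :: "'e \<Rightarrow> 'f" and y w
    using has_derivative_inner_left[OF smooth_on_has_derivative[OF that], of i]
    by (simp add: frechet_derivative_eqI)
  have *: "frechet_derivative (\<lambda>y. frechet_derivative f (at y) u) (at x) v \<bullet> i =
      frechet_derivative (\<lambda>y. frechet_derivative (\<lambda>y. f y \<bullet> i) (at y) u) (at x) v" for u v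
  proof -
    have "frechet_derivative (\<lambda>y. frechet_derivative (\<lambda>y. f y \<bullet> i) (at y) u) (at x) =
        frechet_derivative (\<lambda>y. frechet_derivative f (at y) u \<bullet> i) (at x)"
      by (rule frechet_derivative_cong_open[OF S]) (simp add: inner f)
    then show ?thesis using inner[OF smooth_on_frechet_derivative[OF f] S(2)] by simp
  qed
  have "smooth_on S (\<lambda>y. f y \<bullet> i)"
    by (rule smooth_on_bounded_linear[OF S(1) bounded_linear_inner_left f])
  from mixed_derivatives_commute_real[OF this S]
  show "frechet_derivative (\<lambda>y. frechet_derivative f (at y) u) (at x) v \<bullet> i =
    frechet_derivative (\<lambda>y. frechet_derivative f (at y) v) (at x) u \<bullet> i"
    by (simp add: *)
qed

section \<open>Smooth dependence of the solution of a linear system on its coefficients\<close>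

text \<open>A product rule for a factor \<open>f\<close> that is merely continuous: the term in
  which \<open>f\<close> would be differentiated carries the factor \<open>g x = 0\<close>. It
  serves for the solution of a linear system at the stage where only its continuity is
  known.\<close>

lemma has_derivative_scaleR_of_isCont:
  fixes f :: "'e::euclidean_space \<Rightarrow> real"
  assumes f: "isCont f x" and g: "(g has_derivative g') (at x)" and g0: "g x = 0"
  shows "((\<lambda>y. f y *\<^sub>R g y) has_derivative (\<lambda>v. f x *\<^sub>R g' v)) (at x)"
proof -
  obtain e where lin: "bounded_linear g'" and e: "\<And>h. g (x + h) = g x + g' h + e h"
      "((\<lambda>h. norm (e h) / norm h) \<longlongrightarrow> 0) (at 0)"
    using g unfolding has_derivative_iff_Ex by blast
  obtain K where K: "\<And>h. norm (g' h) \<le> norm h * K"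
    using bounded_linear.bounded[OF lin] by blast
  define r where "r h = (f (x + h) - f x) *\<^sub>R g' h + f (x + h) *\<^sub>R e h" for h
  have fx: "((\<lambda>h. f (x + h)) \<longlongrightarrow> f x) (at 0)"
    using f isCont_iff by blast
  have "((\<lambda>h. norm (r h) / norm h) \<longlongrightarrow> 0) (at 0)"
  proof (rule Lim_null_comparison)
    have "((\<lambda>h. \<bar>f (x + h) - f x\<bar> * K + \<bar>f (x + h)\<bar> * (norm (e h) / norm h)) \<longlongrightarrow>
        \<bar>f x - f x\<bar> * K + \<bar>f x\<bar> * 0) (at 0)"
      by (intro tendsto_intros fx e)
    then show "((\<lambda>h. \<bar>f (x + h) - f x\<bar> * K + \<bar>f (x + h)\<bar> * (norm (e h) / norm h)) \<longlongrightarrow> 0) (at 0)"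
      by simp
    have "norm (norm (r h) / norm h) \<le>
        \<bar>f (x + h) - f x\<bar> * K + \<bar>f (x + h)\<bar> * (norm (e h) / norm h)" if "h \<noteq> 0" for h
    proof -
      have "norm (r h) \<le> \<bar>f (x + h) - f x\<bar> * norm (g' h) + \<bar>f (x + h)\<bar> * norm (e h)"
        unfolding r_def by (metis norm_scaleR norm_triangle_ineq)
      also have "\<dots> \<le> \<bar>f (x + h) - f x\<bar> * (norm h * K) + \<bar>f (x + h)\<bar> * norm (e h)"
        by (intro add_right_mono mult_left_mono K) simp
      finally show ?thesis using that by (simp add: field_simps)
    qed
    then show "\<forall>\<^sub>F h in at 0. norm (norm (r h) / norm h) \<le>
        \<bar>f (x + h) - f x\<bar> * K + \<bar>f (x + h)\<bar> * (norm (e h) / norm h)"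
      by (auto simp: eventually_at_filter)
  qed
  moreover have "f (x + h) *\<^sub>R g (x + h) = f x *\<^sub>R g x + f x *\<^sub>R g' h + r h" for h
    unfolding e(1)[of h] g0 r_def by (simp add: scaleR_add_right scaleR_diff_left)
  moreover have "bounded_linear (\<lambda>v. f x *\<^sub>R g' v)"
    using lin by (rule bounded_linear_const_scaleR)
  ultimately show ?thesis unfolding has_derivative_iff_Ex by blast
qed

text \<open>\<open>H\<close> is a left inverse of \<open>G x\<close>. Applying it to the equation at
  \<open>y\<close> yields \<open>a y\<close> up to the image of \<open>(G y - G x) (a y)\<close>,
  which is small near \<open>x\<close>. That term is expanded over \<open>Basis\<close> so that
  regularity of \<open>G\<close> is used for fixed vectors only.\<close>

lemma linear_system_perturbation:
  fixes G :: "'e::euclidean_space \<Rightarrow> 'd::euclidean_space \<Rightarrow> 'd"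
  assumes lin: "\<And>y. y \<in> S \<Longrightarrow> linear (G y)" and inj: "inj (G x)" and x: "x \<in> S"
    and sol: "\<And>y. y \<in> S \<Longrightarrow> G y (a y) = b y"
  obtains H where "bounded_linear H"
    "\<And>y. y \<in> S \<Longrightarrow> a y = a x + H (b y - b x - (\<Sum>i\<in>Basis. (a y \<bullet> i) *\<^sub>R (G y i - G x i)))"
proof -
  obtain H where H: "linear H" "H \<circ> G x = id"
    using linear_injective_left_inverse[OF lin[OF x] inj] by blast
  have HG: "H (G x v) = v" for v using H(2) by (metis comp_apply id_apply)
  have "a y = a x + H (b y - b x - (\<Sum>i\<in>Basis. (a y \<bullet> i) *\<^sub>R (G y i - G x i)))" if y: "y \<in> S" for y
  proof -
    have "(\<Sum>i\<in>Basis. (a y \<bullet> i) *\<^sub>R (G y i - G x i)) = G y (a y) - G x (a y)"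
      using linear_euclidean_sum[OF lin[OF y], of "a y"] linear_euclidean_sum[OF lin[OF x], of "a y"]
      by (simp add: scaleR_diff_right sum_subtractf)
    then have "b y - b x - (\<Sum>i\<in>Basis. (a y \<bullet> i) *\<^sub>R (G y i - G x i)) = G x (a y) - G x (a x)"
      using sol[OF y] sol[OF x] by simp
    then show ?thesis by (simp add: linear_diff[OF H(1)] HG)
  qed
  then show thesis using that H(1) linear_conv_bounded_linear by blast
qed

lemma isCont_linear_system_solution:
  fixes G :: "'e::euclidean_space \<Rightarrow> 'd::euclidean_space \<Rightarrow> 'd"
  assumes S: "open S" "x \<in> S" and lin: "\<And>y. y \<in> S \<Longrightarrow> linear (G y)" and inj: "inj (G x)"
    and sol: "\<And>y. y \<in> S \<Longrightarrow> G y (a y) = b y"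
    and G: "\<And>v. isCont (\<lambda>y. G y v) x" and b: "isCont b x"
  shows "isCont a x"
proof -
  obtain H where H: "bounded_linear H"
    "\<And>y. y \<in> S \<Longrightarrow> a y = a x + H (b y - b x - (\<Sum>i\<in>Basis. (a y \<bullet> i) *\<^sub>R (G y i - G x i)))"
    using linear_system_perturbation[where a = a and b = b and G = G and S = S and x = x]
      lin inj S(2) sol by blast
  obtain B where B: "B > 0" "\<And>z. norm (H z) \<le> norm z * B"
    using bounded_linear.pos_bounded[OF H(1)] by blast
  define \<epsilon> where "\<epsilon> y = (\<Sum>i\<in>Basis. norm (G y i - G x i))" for y
  have \<epsilon>0: "(\<epsilon> \<longlongrightarrow> 0) (at x)"
  proof -
    have "(\<epsilon> \<longlongrightarrow> (\<Sum>i\<in>Basis. norm (G x i - G x i))) (at x)"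
      unfolding \<epsilon>_def using G by (intro tendsto_intros) (simp add: isCont_def)
    then show ?thesis by simp
  qed
  have bound: "norm (a y - a x) \<le> 2 * B * (norm (b y - b x) + norm (a x) * \<epsilon> y)"
    if y: "y \<in> S" and small: "\<epsilon> y < 1 / (2 * B)" for y
  proof -
    have "norm (\<Sum>i\<in>Basis. (a y \<bullet> i) *\<^sub>R (G y i - G x i)) \<le> norm (a y) * \<epsilon> y"
      unfolding \<epsilon>_def sum_distrib_left
      by (rule order_trans[OF norm_sum]) (auto intro!: sum_mono mult_right_mono Basis_le_norm)
    also have "\<dots> \<le> (norm (a x) + norm (a y - a x)) * \<epsilon> y"
      by (intro mult_right_mono) (auto simp: \<epsilon>_def sum_nonneg intro: norm_triangle_sub)
    finally have "norm (b y - b x - (\<Sum>i\<in>Basis. (a y \<bullet> i) *\<^sub>R (G y i - G x i))) \<le>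
        norm (b y - b x) + (norm (a x) + norm (a y - a x)) * \<epsilon> y"
      by (intro order_trans[OF norm_triangle_ineq4]) simp
    moreover have "a y - a x = H (b y - b x - (\<Sum>i\<in>Basis. (a y \<bullet> i) *\<^sub>R (G y i - G x i)))"
      using H(2)[OF y] by (simp add: algebra_simps)
    ultimately have "norm (a y - a x) \<le>
        (norm (b y - b x) + (norm (a x) + norm (a y - a x)) * \<epsilon> y) * B"
      using order_trans[OF B(2) mult_right_mono[OF _ less_imp_le[OF B(1)]]] by simp
    \<comment> \<open>The threshold \<open>1 / (2 * B)\<close> makes the part of the right side that
      contains \<open>norm (a y - a x)\<close> at most half of it; moved to the left, it leaves the
      factor 2 in \<open>bound\<close>.\<close>
    moreover have "norm (a y - a x) * (\<epsilon> y * B) \<le> norm (a y - a x) * (1/2)"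
      using small B(1) by (intro mult_left_mono) (auto simp: field_simps)
    ultimately show ?thesis by (simp add: algebra_simps)
  qed
  have "((\<lambda>y. a y - a x) \<longlongrightarrow> 0) (at x)"
  proof (rule Lim_null_comparison)
    have "((\<lambda>y. 2 * B * (norm (b y - b x) + norm (a x) * \<epsilon> y)) \<longlongrightarrow>
        2 * B * (norm (b x - b x) + norm (a x) * 0)) (at x)"
      using b \<epsilon>0 by (intro tendsto_intros) (auto simp: isCont_def)
    then show "((\<lambda>y. 2 * B * (norm (b y - b x) + norm (a x) * \<epsilon> y)) \<longlongrightarrow> 0) (at x)" by simp
    have "\<forall>\<^sub>F y in at x. y \<in> S" using S by (simp add: eventually_at_in_open')
    moreover have "\<forall>\<^sub>F y in at x. \<epsilon> y < 1 / (2 * B)" using \<epsilon>0 B(1) by (intro order_tendstoD) auto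
    ultimately show "\<forall>\<^sub>F y in at x. norm (a y - a x) \<le> 2 * B * (norm (b y - b x) + norm (a x) * \<epsilon> y)"
      by eventually_elim (rule bound)
  qed
  then show ?thesis by (simp add: isCont_def LIM_zero_iff)
qed

lemma differentiable_linear_system_solution:
  fixes G :: "'e::euclidean_space \<Rightarrow> 'd::euclidean_space \<Rightarrow> 'd"
  assumes S: "open S" "x \<in> S" and lin: "\<And>y. y \<in> S \<Longrightarrow> linear (G y)" and inj: "inj (G x)"
    and sol: "\<And>y. y \<in> S \<Longrightarrow> G y (a y) = b y"
    and G: "\<And>v. (\<lambda>y. G y v) differentiable (at x)" and b: "b differentiable (at x)"
  shows "a differentiable (at x)"
proof -
  obtain H where H: "bounded_linear H"
    "\<And>y. y \<in> S \<Longrightarrow> a y = a x + H (b y - b x - (\<Sum>i\<in>Basis. (a y \<bullet> i) *\<^sub>R (G y i - G x i)))"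
    using linear_system_perturbation[where a = a and b = b and G = G and S = S and x = x]
      lin inj S(2) sol by blast
  have cont: "isCont a x"
    using G b by (intro isCont_linear_system_solution[where G = G and a = a and b = b, OF S lin inj sol])
      (auto intro: differentiable_imp_continuous_within)
  \<comment> \<open>Each summand is a continuous factor times a differentiable function that
    vanishes at \<open>x\<close>.\<close>
  have "(\<lambda>y. (a y \<bullet> i) *\<^sub>R (G y i - G x i)) differentiable (at x)" for i
  proof -
    obtain G' where "((\<lambda>y. G y i) has_derivative G') (at x)"
      using G[of i] unfolding differentiable_def by blast
    then have "((\<lambda>y. G y i - G x i) has_derivative G') (at x)"
      using has_derivative_diff[OF _ has_derivative_const] by fastforce
    from has_derivative_scaleR_of_isCont[OF _ this, of "\<lambda>y. a y \<bullet> i"] show ?thesis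
      using cont unfolding differentiable_def by fastforce
  qed
  then have "(\<lambda>y. b y - b x - (\<Sum>i\<in>Basis. (a y \<bullet> i) *\<^sub>R (G y i - G x i))) differentiable (at x)"
    using b by simp
  then obtain D where "((\<lambda>y. b y - b x - (\<Sum>i\<in>Basis. (a y \<bullet> i) *\<^sub>R (G y i - G x i))) has_derivative D) (at x)"
    unfolding differentiable_def by blast
  from has_derivative_add[OF has_derivative_const bounded_linear.has_derivative[OF H(1) this]]
  have "(\<lambda>y. a x + H (b y - b x - (\<Sum>i\<in>Basis. (a y \<bullet> i) *\<^sub>R (G y i - G x i)))) differentiable (at x)"
    unfolding differentiable_def by blast
  then show ?thesis
    by (rule differentiable_cong_open[OF S, rotated]) (simp add: H(2)[symmetric])
qed

text \<open>Differentiating the system shows that the derivative of the solution solves a system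
  with the same \<open>G\<close>, whose right side contains the derivatives of \<open>b\<close> and
  \<open>G\<close> and the solution itself. By induction the solution is of class \<open>k\<close>,
  so that right side is too; hence the induction runs over all pairs \<open>a\<close>,
  \<open>b\<close> at once.\<close>

lemma smooth_on_linear_system_solution:
  fixes G :: "'e::euclidean_space \<Rightarrow> 'd::euclidean_space \<Rightarrow> 'd"
  assumes S: "open S" and lin: "\<And>x. x \<in> S \<Longrightarrow> linear (G x)" and inj: "\<And>x. x \<in> S \<Longrightarrow> inj (G x)"
    and G: "\<And>v. smooth_on S (\<lambda>x. G x v)" and b: "smooth_on S b"
    and sol: "\<And>x. x \<in> S \<Longrightarrow> G x (a x) = b x"
  shows "smooth_on S a"
proof -
  have "Ck_on k S b \<Longrightarrow> (\<And>x. x \<in> S \<Longrightarrow> G x (a x) = b x) \<Longrightarrow> Ck_on k S a" for k a b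
  proof (induction k arbitrary: a b)
    case 0
    have "isCont a x" if x: "x \<in> S" for x
    proof (rule isCont_linear_system_solution[where G = G and a = a and b = b, OF S x lin inj[OF x] 0(2)])
      show "isCont (\<lambda>y. G y v) x" for v
        using smooth_on_imp_continuous_on[OF G] S x continuous_on_eq_continuous_at by blast
      show "isCont b x"
        using 0(1) S x continuous_on_eq_continuous_at by auto
    qed
    then show ?case by (simp add: continuous_at_imp_continuous_on)
  next
    case (Suc k)
    have a_diff: "a differentiable (at x)" if x: "x \<in> S" for x
      using Suc.prems(1) x smooth_on_imp_differentiable[OF G x]
      by (intro differentiable_linear_system_solution[where G = G and a = a and b = b, OF S x lin inj[OF x] Suc.prems(2)]) auto
    have "Ck_on k S (\<lambda>x. frechet_derivative a (at x) v)" for v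
    proof (rule Suc.IH)
      let ?b = "\<lambda>x. frechet_derivative b (at x) v +
        - (\<Sum>i\<in>Basis. (a x \<bullet> i) *\<^sub>R frechet_derivative (\<lambda>x. G x i) (at x) v)"
      have "Ck_on k S a"
        using Suc.IH[OF Ck_on_Suc_imp[OF Suc.prems(1)] Suc.prems(2)] by simp
      then have "Ck_on k S (\<lambda>x. a x \<bullet> i)" for i
        by (rule Ck_on_bounded_linear[OF S bounded_linear_inner_left])
      then have "Ck_on k S (\<lambda>x. \<Sum>i\<in>Basis. (a x \<bullet> i) *\<^sub>R frechet_derivative (\<lambda>x. G x i) (at x) v)"
        by (intro Ck_on_sum Ck_on_scaleR S)
          (auto intro: smooth_on_imp_Ck_on smooth_on_frechet_derivative G)
      from Ck_on_bounded_linear[OF S bounded_linear_minus[OF bounded_linear_ident] this]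
      show "Ck_on k S ?b"
        using Suc.prems by (intro Ck_on_add S) auto
      fix x assume x: "x \<in> S"
      have D1: "((\<lambda>y. \<Sum>i\<in>Basis. (a y \<bullet> i) *\<^sub>R G y i) has_derivative
          (\<lambda>v. \<Sum>i\<in>Basis. (a x \<bullet> i) *\<^sub>R frechet_derivative (\<lambda>x. G x i) (at x) v +
            (frechet_derivative a (at x) v \<bullet> i) *\<^sub>R G x i)) (at x)"
        using a_diff[OF x] smooth_on_has_derivative[OF G x]
        by (intro has_derivative_sum has_derivative_scaleR has_derivative_inner_left)
          (auto simp: frechet_derivative_works)
      have D2: "((\<lambda>y. \<Sum>i\<in>Basis. (a y \<bullet> i) *\<^sub>R G y i) has_derivative frechet_derivative b (at x)) (at x)"
      proof (subst has_derivative_cong_open[OF S x])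
        show "(\<Sum>i\<in>Basis. (a y \<bullet> i) *\<^sub>R G y i) = b y" if "y \<in> S" for y
          using Suc.prems(2)[OF that] linear_euclidean_sum[OF lin[OF that]] by metis
        show "(b has_derivative frechet_derivative b (at x)) (at x)"
          using Suc.prems(1) x by (simp add: frechet_derivative_works[symmetric])
      qed
      have "frechet_derivative b (at x) v =
          (\<Sum>i\<in>Basis. (a x \<bullet> i) *\<^sub>R frechet_derivative (\<lambda>x. G x i) (at x) v) +
            G x (frechet_derivative a (at x) v)"
        using linear_euclidean_sum[OF lin[OF x], of "frechet_derivative a (at x) v"]
          fun_cong[OF has_derivative_unique[OF D1 D2], of v] by (simp add: sum.distrib)
      then show "G x (frechet_derivative a (at x) v) = ?b x" by simp
    qed
    then show ?case using a_diff by simp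
  qed
  from this[OF smooth_on_imp_Ck_on[OF b] sol] show ?thesis unfolding smooth_on_def by simp
qed

section \<open>Calculus on manifolds\<close>

lemma charts_at_iff [simp]: "c \<in> charts_at K p \<longleftrightarrow> c \<in> Charts K \<and> p \<in> fst c"
  by (simp add: charts_at_def)

locale manifold =
  fixes K :: "('a, 'e::euclidean_space) mfd"
  assumes smooth_manifold: "smooth_manifold K"
begin

lemma chart_open: "c \<in> Charts K \<Longrightarrow> openin (Top K) (fst c)"
  using smooth_manifold by (simp add: smooth_manifold_def)

lemma chart_Int_open: "c \<in> Charts K \<Longrightarrow> openin (Top K) V \<Longrightarrow> openin (Top K) (V \<inter> fst c)"
  using chart_open by (rule openin_Int[rotated])

lemma chart_subset: "c \<in> Charts K \<Longrightarrow> fst c \<subseteq> points K"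
  using chart_open openin_subset by blast

lemma chart_homeomorphic:
  "c \<in> Charts K \<Longrightarrow> homeomorphic_map (subtopology (Top K) (fst c)) (top_of_set (snd c ` fst c)) (snd c)"
  using smooth_manifold by (simp add: smooth_manifold_def)

lemma chart_inj: "c \<in> Charts K \<Longrightarrow> inj_on (snd c) (fst c)"
  using homeomorphic_imp_injective_map[OF chart_homeomorphic, of c] chart_subset[of c]
  by (simp add: Int_absorb1)

lemma chart_image_open:
  assumes "c \<in> Charts K" "openin (Top K) V"
  shows "open (snd c ` (fst c \<inter> V))"
proof -
  have "openin (subtopology (Top K) (fst c)) (fst c \<inter> V)"
    using assms(2) by (auto simp: openin_subtopology)
  then have "openin (top_of_set (snd c ` fst c)) (snd c ` (fst c \<inter> V))"
    using homeomorphic_imp_open_map[OF chart_homeomorphic[OF assms(1)]] by (auto simp: open_map_def)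
  moreover have "open (snd c ` fst c)"
    using smooth_manifold assms(1) by (simp add: smooth_manifold_def)
  ultimately show ?thesis using openin_open_eq by blast
qed

lemma in_chart_apply [simp]: "c \<in> Charts K \<Longrightarrow> p \<in> fst c \<Longrightarrow> in_chart c F (snd c p) = F p"
  by (simp add: in_chart_def chart_inj)

lemma smooth_on_transition:
  "c \<in> Charts K \<Longrightarrow> c' \<in> Charts K \<Longrightarrow> smooth_on (snd c ` (fst c \<inter> fst c')) (in_chart c (snd c'))"
  using smooth_manifold by (simp add: smooth_manifold_def)

lemma points_in_chart: "p \<in> points K \<Longrightarrow> \<exists>c\<in>Charts K. p \<in> fst c"
  using smooth_manifold by (auto simp: smooth_manifold_def)

lemma chart_at: "p \<in> points K \<Longrightarrow> chart_at K p \<in> charts_at K p"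
  unfolding chart_at_def by (rule someI_ex) (use points_in_chart in \<open>simp add: Bex_def\<close>)

lemma smooth_funD:
  "smooth_fun K V F \<Longrightarrow> c \<in> Charts K \<Longrightarrow> smooth_on (snd c ` (fst c \<inter> V)) (in_chart c F)"
  by (simp add: smooth_fun_def)

lemma smooth_fun_subset: "smooth_fun K V F \<Longrightarrow> W \<subseteq> V \<Longrightarrow> smooth_fun K W F"
  unfolding smooth_fun_def by (blast intro: smooth_on_subset)

lemma smooth_fun_cong:
  assumes "openin (Top K) V" "\<And>p. p \<in> V \<Longrightarrow> F p = G p" "smooth_fun K V F"
  shows "smooth_fun K V G"
  unfolding smooth_fun_def
proof
  fix c assume c: "c \<in> Charts K"
  show "smooth_on (snd c ` (fst c \<inter> V)) (in_chart c G)"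
    by (rule smooth_on_cong[OF chart_image_open[OF c assms(1)] _ smooth_funD[OF assms(3) c]])
      (use c assms(2) in auto)
qed

lemma smooth_fun_local:
  assumes "\<And>p. p \<in> V \<Longrightarrow> \<exists>W. openin (Top K) W \<and> p \<in> W \<and> smooth_fun K W F"
  shows "smooth_fun K V F"
  unfolding smooth_fun_def
proof
  fix c assume c: "c \<in> Charts K"
  show "smooth_on (snd c ` (fst c \<inter> V)) (in_chart c F)"
  proof (rule smooth_on_local)
    fix x assume "x \<in> snd c ` (fst c \<inter> V)"
    then obtain p where p: "p \<in> fst c" "p \<in> V" "x = snd c p" by blast
    obtain W where W: "openin (Top K) W" "p \<in> W" "smooth_fun K W F" using assms p(2) by blast
    show "\<exists>T. open T \<and> x \<in> T \<and> smooth_on T (in_chart c F)"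
      using chart_image_open[OF c W(1)] smooth_funD[OF W(3) c] W(2) p by blast
  qed
qed

text \<open>Transition maps are smooth, so one chart containing \<open>W\<close> decides for all
  charts.\<close>

lemma smooth_fun_chartI:
  assumes "openin (Top K) W" "W \<subseteq> fst c" "c \<in> Charts K" "smooth_on (snd c ` W) (in_chart c F)"
  shows "smooth_fun K W F"
  unfolding smooth_fun_def
proof
  fix c' assume c': "c' \<in> Charts K"
  have S: "open (snd c' ` (fst c' \<inter> W))" by (rule chart_image_open[OF c' assms(1)])
  have T: "open (snd c ` W)" using chart_image_open[OF assms(3,1)] assms(2) by (simp add: Int_absorb1)
  have "smooth_on (snd c' ` (fst c' \<inter> W)) (\<lambda>z. in_chart c F (in_chart c' (snd c) z))"
  proof (rule smooth_on_compose[OF S T _ _ assms(4)])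
    show "in_chart c' (snd c) ` (snd c' ` (fst c' \<inter> W)) \<subseteq> snd c ` W" using c' by auto
    show "smooth_on (snd c' ` (fst c' \<inter> W)) (in_chart c' (snd c))"
      by (rule smooth_on_subset[OF smooth_on_transition[OF c' assms(3)]]) (use assms(2) in auto)
  qed
  then show "smooth_on (snd c' ` (fst c' \<inter> W)) (in_chart c' F)"
    by (rule smooth_on_cong[OF S, rotated]) (use c' assms(2,3) in auto)
qed

lemma smooth_fun_const: "smooth_fun K V (\<lambda>p. a)"
  by (simp add: smooth_fun_def in_chart_def o_def smooth_on_const)

lemma smooth_fun_add:
  "openin (Top K) V \<Longrightarrow> smooth_fun K V F \<Longrightarrow> smooth_fun K V G \<Longrightarrow> smooth_fun K V (\<lambda>p. F p + G p)"
  by (simp add: smooth_fun_def in_chart_def o_def smooth_on_add chart_image_open)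

lemma smooth_fun_scaleR:
  "openin (Top K) V \<Longrightarrow> smooth_fun K V F \<Longrightarrow> smooth_fun K V G \<Longrightarrow> smooth_fun K V (\<lambda>p. F p *\<^sub>R G p)"
  by (simp add: smooth_fun_def in_chart_def o_def smooth_on_scaleR chart_image_open)

lemma smooth_fun_sum:
  "openin (Top K) V \<Longrightarrow> (\<And>i. i \<in> I \<Longrightarrow> smooth_fun K V (F i)) \<Longrightarrow> smooth_fun K V (\<lambda>p. \<Sum>i\<in>I. F i p)"
  by (simp add: smooth_fun_def in_chart_def o_def smooth_on_sum chart_image_open)

lemma smooth_fun_bounded_linear:
  "openin (Top K) V \<Longrightarrow> bounded_linear h \<Longrightarrow> smooth_fun K V F \<Longrightarrow> smooth_fun K V (\<lambda>p. h (F p))"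
  unfolding smooth_fun_def in_chart_def o_def
  by (auto intro!: smooth_on_bounded_linear[where h = h] chart_image_open)

lemma smooth_fun_inner_const:
  "openin (Top K) V \<Longrightarrow> smooth_fun K V F \<Longrightarrow> smooth_fun K V (\<lambda>p. F p \<bullet> i)"
  by (rule smooth_fun_bounded_linear[OF _ bounded_linear_inner_left])

lemma smooth_fun_diff:
  assumes "openin (Top K) V" "smooth_fun K V F" "smooth_fun K V G"
  shows "smooth_fun K V (\<lambda>p. F p - G p)"
  using smooth_fun_add[OF assms(1,2) smooth_fun_bounded_linear[OF assms(1)
      bounded_linear_minus[OF bounded_linear_ident] assms(3)]] by simp

lemma smooth_fun_chart: "c \<in> Charts K \<Longrightarrow> smooth_fun K (fst c) (snd c)"
  using smooth_on_transition by (simp add: smooth_fun_def)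

lemma smooth_fun_chart_subset: "c \<in> Charts K \<Longrightarrow> W \<subseteq> fst c \<Longrightarrow> smooth_fun K W (snd c)"
  by (rule smooth_fun_subset[OF smooth_fun_chart])

lemma in_chart_has_derivative:
  assumes "smooth_fun K V F" "c \<in> Charts K" "p \<in> fst c" "p \<in> V"
  shows "(in_chart c F has_derivative (\<lambda>u. deriv_in c p u F)) (at (snd c p))"
  unfolding deriv_in_def
  using smooth_on_has_derivative[OF smooth_funD[OF assms(1,2)]] assms(3,4) by simp

lemma deriv_in_eqI:
  "(in_chart c F has_derivative D) (at (snd c p)) \<Longrightarrow> deriv_in c p u F = D u"
  by (simp add: deriv_in_def frechet_derivative_eqI)

lemma linear_deriv_in:
  "smooth_fun K V F \<Longrightarrow> c \<in> Charts K \<Longrightarrow> p \<in> fst c \<Longrightarrow> p \<in> V \<Longrightarrow> linear (\<lambda>u. deriv_in c p u F)"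
  using in_chart_has_derivative has_derivative_linear by blast

lemma deriv_in_cong:
  assumes "c \<in> Charts K" "p \<in> fst c" "openin (Top K) V" "p \<in> V" "\<And>q. q \<in> V \<Longrightarrow> F q = G q"
  shows "deriv_in c p u F = deriv_in c p u G"
proof -
  have "frechet_derivative (in_chart c F) (at (snd c p)) = frechet_derivative (in_chart c G) (at (snd c p))"
    by (rule frechet_derivative_cong_open[OF chart_image_open[OF assms(1,3)]]) (use assms in auto)
  then show ?thesis by (simp add: deriv_in_def)
qed

lemma deriv_in_const [simp]: "deriv_in c p u (\<lambda>q. a) = 0"
  by (simp add: deriv_in_def in_chart_def o_def)

lemma deriv_in_add:
  assumes "smooth_fun K V F" "smooth_fun K V G" "c \<in> Charts K" "p \<in> fst c" "p \<in> V"
  shows "deriv_in c p u (\<lambda>q. F q + G q) = deriv_in c p u F + deriv_in c p u G"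
  using has_derivative_add[OF in_chart_has_derivative in_chart_has_derivative] assms
  by (intro deriv_in_eqI) (simp add: in_chart_def o_def)

lemma deriv_in_scaleR:
  assumes "smooth_fun K V F" "smooth_fun K V G" "c \<in> Charts K" "p \<in> fst c" "p \<in> V"
  shows "deriv_in c p u (\<lambda>q. F q *\<^sub>R G q) = F p *\<^sub>R deriv_in c p u G + deriv_in c p u F *\<^sub>R G p"
  using has_derivative_scaleR[OF in_chart_has_derivative in_chart_has_derivative, of V F c p V G] assms
  by (intro deriv_in_eqI) (simp add: in_chart_def o_def chart_inj)

lemma deriv_in_bounded_linear:
  assumes "bounded_linear h" "smooth_fun K V F" "c \<in> Charts K" "p \<in> fst c" "p \<in> V"
  shows "deriv_in c p u (\<lambda>q. h (F q)) = h (deriv_in c p u F)"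
  using bounded_linear.has_derivative[OF assms(1) in_chart_has_derivative[OF assms(2-)]]
  by (intro deriv_in_eqI) (simp add: in_chart_def o_def)

lemma deriv_in_sum:
  assumes "\<And>i. i \<in> I \<Longrightarrow> smooth_fun K V (F i)" "c \<in> Charts K" "p \<in> fst c" "p \<in> V"
  shows "deriv_in c p u (\<lambda>q. \<Sum>i\<in>I. F i q) = (\<Sum>i\<in>I. deriv_in c p u (F i))"
proof -
  have "((\<lambda>z. \<Sum>i\<in>I. in_chart c (F i) z) has_derivative (\<lambda>u. \<Sum>i\<in>I. deriv_in c p u (F i))) (at (snd c p))"
    using assms by (intro has_derivative_sum in_chart_has_derivative)
  then show ?thesis by (intro deriv_in_eqI) (simp add: in_chart_def o_def)
qed

text \<open>The chain rule for functions that factor through a Euclidean space. It is applied with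
  \<open>y\<close> another chart of the same manifold, to change charts, and with \<open>y\<close> a
  chart of \<open>N\<close> restricted to \<open>M\<close>, to compute the differential of the
  inclusion.\<close>

lemma deriv_in_compose:
  fixes y :: "'a \<Rightarrow> 'f::euclidean_space"
  assumes y: "smooth_fun K V y" and V: "openin (Top K) V" "p \<in> V" and c: "c \<in> Charts K" "p \<in> fst c"
    and F: "\<And>q. q \<in> V \<Longrightarrow> F q = H (y q)" and H: "(H has_derivative H') (at (y p))"
  shows "deriv_in c p u F = H' (deriv_in c p u y)"
proof -
  have "((\<lambda>z. H (in_chart c y z)) has_derivative (\<lambda>u. H' (deriv_in c p u y))) (at (snd c p))"
    by (rule has_derivative_compose[OF in_chart_has_derivative[OF y c V(2)]]) (simp add: c H)
  then have "deriv_in c p u (\<lambda>q. H (y q)) = H' (deriv_in c p u y)"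
    by (intro deriv_in_eqI) (simp add: in_chart_def o_def)
  then show ?thesis using deriv_in_cong[OF c V F] by simp
qed

lemma deriv_in_change:
  assumes F: "smooth_fun K V F" "openin (Top K) V" "p \<in> V"
    and c: "c \<in> charts_at K p" "c' \<in> charts_at K p"
  shows "deriv_in c p u F = deriv_in c' p (deriv_in c p u (snd c')) F"
proof (rule deriv_in_compose)
  show "smooth_fun K (V \<inter> fst c') (snd c')"
    using c by (intro smooth_fun_chart_subset) auto
  show "openin (Top K) (V \<inter> fst c')" using F(2) c chart_Int_open by simp
  show "F q = in_chart c' F (snd c' q)" if "q \<in> V \<inter> fst c'" for q using that c by simp
  show "(in_chart c' F has_derivative (\<lambda>u. deriv_in c' p u F)) (at (snd c' p))"
    using F c by (auto intro: in_chart_has_derivative)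
qed (use F c in auto)

lemma deriv_in_self [simp]:
  assumes "c \<in> Charts K" "p \<in> fst c"
  shows "deriv_in c p u (snd c) = u"
proof -
  have "frechet_derivative (in_chart c (snd c)) (at (snd c p)) = frechet_derivative (\<lambda>z. z) (at (snd c p))"
    by (rule frechet_derivative_cong_open[OF chart_image_open[OF assms(1) chart_open[OF assms(1)]]])
      (use assms in auto)
  then show ?thesis by (simp add: deriv_in_def)
qed

lemma smooth_fun_deriv_in_const:
  assumes "smooth_fun K V F" "openin (Top K) V" "c \<in> Charts K" "V \<subseteq> fst c"
  shows "smooth_fun K V (\<lambda>q. deriv_in c q u F)"
proof (rule smooth_fun_chartI[OF assms(2,4,3)])
  have V: "fst c \<inter> V = V" using assms(4) by blast
  then have S: "open (snd c ` V)" using chart_image_open[OF assms(3,2)] by simp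
  have "smooth_on (snd c ` V) (\<lambda>z. frechet_derivative (in_chart c F) (at z) u)"
    using smooth_on_frechet_derivative[OF smooth_funD[OF assms(1,3)], of u] V by simp
  then show "smooth_on (snd c ` V) (in_chart c (\<lambda>q. deriv_in c q u F))"
    by (rule smooth_on_cong[OF S, rotated]) (use assms(3,4) in \<open>auto simp: deriv_in_def\<close>)
qed

lemma deriv_in_basis:
  assumes "smooth_fun K V F" "c \<in> Charts K" "p \<in> fst c" "p \<in> V"
  shows "deriv_in c p u F = (\<Sum>i\<in>Basis. (u \<bullet> i) *\<^sub>R deriv_in c p i F)"
  by (rule linear_euclidean_sum[OF linear_deriv_in[OF assms]])

lemma smooth_fun_deriv_in:
  assumes "smooth_fun K V F" "smooth_fun K V U" "openin (Top K) V" "c \<in> Charts K" "V \<subseteq> fst c"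
  shows "smooth_fun K V (\<lambda>q. deriv_in c q (U q) F)"
proof (rule smooth_fun_cong[OF assms(3)])
  show "smooth_fun K V (\<lambda>q. \<Sum>i\<in>Basis. (U q \<bullet> i) *\<^sub>R deriv_in c q i F)"
    using assms by (intro smooth_fun_sum smooth_fun_scaleR smooth_fun_inner_const smooth_fun_deriv_in_const)
  show "(\<Sum>i\<in>Basis. (U q \<bullet> i) *\<^sub>R deriv_in c q i F) = deriv_in c q (U q) F" if "q \<in> V" for q
    using deriv_in_basis[OF assms(1,4) subsetD[OF assms(5) that] that, of "U q"] by (rule sym)
qed

lemma deriv_in_commute:
  fixes F :: "'a \<Rightarrow> 'f::euclidean_space"
  assumes "smooth_fun K V F" "openin (Top K) V" "c \<in> Charts K" "p \<in> fst c" "p \<in> V"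
  shows "deriv_in c p u (\<lambda>q. deriv_in c q v F) = deriv_in c p v (\<lambda>q. deriv_in c q u F)"
proof -
  let ?S = "snd c ` (fst c \<inter> V)"
  have S: "open ?S" "snd c p \<in> ?S" using chart_image_open assms by auto
  have "deriv_in c p u (\<lambda>q. deriv_in c q v F) =
      frechet_derivative (\<lambda>y. frechet_derivative (in_chart c F) (at y) v) (at (snd c p)) u" for u v
    unfolding deriv_in_def
    by (rule fun_cong[OF frechet_derivative_cong_open[OF S]]) (use assms(3) in auto)
  then show ?thesis using mixed_derivatives_commute[OF smooth_funD[OF assms(1,3)] S] by simp
qed

section \<open>Tangent vectors as compatible families of chart components, and derivatives along
  them\<close>

lemma tangent_space_change:
  "v \<in> tangent_space K p \<Longrightarrow> c \<in> charts_at K p \<Longrightarrow> c' \<in> charts_at K p \<Longrightarrow>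
    v c' = deriv_in c p (v c) (snd c')"
  unfolding tangent_space_def by blast

lemma tangent_space_outside: "v \<in> tangent_space K p \<Longrightarrow> c \<notin> charts_at K p \<Longrightarrow> v c = 0"
  unfolding tangent_space_def by blast

lemma linear_deriv_in_chart:
  assumes "c \<in> charts_at K p" "c' \<in> charts_at K p"
  shows "linear (\<lambda>u. deriv_in c p u (snd c'))"
  using assms linear_deriv_in[OF smooth_fun_chart, of c' c p] by simp

lemma coord_vec_tangent:
  assumes "c \<in> charts_at K p"
  shows "coord_vec K c p u \<in> tangent_space K p"
  unfolding tangent_space_def mem_Collect_eq
proof (intro conjI ballI allI impI)
  fix c' c'' assume c: "c' \<in> charts_at K p" "c'' \<in> charts_at K p"
  then show "coord_vec K c p u c'' = deriv_in c' p (coord_vec K c p u c') (snd c'')"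
    using deriv_in_change[OF smooth_fun_chart chart_open _ assms c(1), of c''] by (simp add: coord_vec_def)
qed (simp only: coord_vec_def if_False)

lemma coord_vec_apply [simp]: "c \<in> Charts K \<Longrightarrow> p \<in> fst c \<Longrightarrow> coord_vec K c p u c = u"
  by (simp add: coord_vec_def)

lemma tangent_eq_coord_vec:
  assumes "v \<in> tangent_space K p" "c \<in> charts_at K p"
  shows "v = coord_vec K c p (v c)"
proof
  fix c' show "v c' = coord_vec K c p (v c) c'"
  proof (cases "c' \<in> charts_at K p")
    case True
    then show ?thesis by (simp add: coord_vec_def tangent_space_change[OF assms True, symmetric])
  next
    case False
    then show ?thesis using tangent_space_outside[OF assms(1) False] by (auto simp: coord_vec_def)
  qed
qed

lemma tangent_eqI:
  assumes "v \<in> tangent_space K p" "w \<in> tangent_space K p" "c \<in> charts_at K p" "v c = w c"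
  shows "v = w"
  using tangent_eq_coord_vec assms by metis

lemma linear_coord_vec:
  assumes "c \<in> charts_at K p"
  shows "linear (coord_vec K c p)"
proof
  show "coord_vec K c p (u + v) = coord_vec K c p u + coord_vec K c p v" for u v
    by (rule ext) (simp add: coord_vec_def linear_add[OF linear_deriv_in_chart[OF assms]] del: charts_at_iff)
  show "coord_vec K c p (r *\<^sub>R u) = r *\<^sub>R coord_vec K c p u" for r u
    by (rule ext) (simp add: coord_vec_def scaleR_fun_def linear_scale[OF linear_deriv_in_chart[OF assms]]
        del: charts_at_iff)
qed

text \<open>Around a point with a chart the space is the image of the linear map
  \<open>coord_vec\<close>. At any other \<open>p\<close> the convention for charts not around
  \<open>p\<close> leaves only the zero vector.\<close>

lemma subspace_tangent: "subspace (tangent_space K p)"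
proof (cases "charts_at K p = {}")
  case True
  then show ?thesis by (auto simp: tangent_space_def subspace_def scaleR_fun_def)
next
  case False
  then obtain c where c: "c \<in> charts_at K p" by blast
  have "range (coord_vec K c p) = tangent_space K p"
  proof
    show "tangent_space K p \<subseteq> range (coord_vec K c p)"
    proof
      fix v assume "v \<in> tangent_space K p"
      from tangent_eq_coord_vec[OF this c] show "v \<in> range (coord_vec K c p)" by (rule range_eqI)
    qed
  qed (use coord_vec_tangent[OF c] in blast)
  then show ?thesis using linear_subspace_image[OF linear_coord_vec[OF c] subspace_UNIV] by simp
qed

lemmas tangent_closed = subspace_add[OF subspace_tangent] subspace_diff[OF subspace_tangent]
  subspace_scale[OF subspace_tangent] subspace_neg[OF subspace_tangent] subspace_0[OF subspace_tangent]
  subspace_sum[OF subspace_tangent]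

lemma tangent_basis:
  assumes "v \<in> tangent_space K p" "c \<in> charts_at K p"
  shows "v = (\<Sum>i\<in>Basis. (v c \<bullet> i) *\<^sub>R coord_vec K c p i)"
  using tangent_eq_coord_vec[OF assms] linear_euclidean_sum[OF linear_coord_vec[OF assms(2)]] by metis

text \<open>\<open>vderiv\<close> is defined through the chosen chart \<open>chart_at\<close>. The
  transformation law of \<open>v\<close> and the chain rule compensate each other, which frees all
  later computations from that choice.\<close>

lemma vderiv_chart:
  assumes "v \<in> tangent_space K p" "c \<in> charts_at K p" "smooth_fun K V F" "openin (Top K) V" "p \<in> V"
  shows "vderiv K p v F = deriv_in c p (v c) F"
proof -
  have "p \<in> points K" using assms(4,5) openin_subset by blast
  from chart_at[OF this] show ?thesis unfolding vderiv_def
    using deriv_in_change[OF assms(3-5) assms(2)] tangent_space_change[OF assms(1,2)] by metis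
qed

lemma vderiv_cong:
  assumes "openin (Top K) V" "p \<in> V" "\<And>q. q \<in> V \<Longrightarrow> F q = G q"
  shows "vderiv K p v F = vderiv K p v G"
proof -
  have "p \<in> points K" using assms(1,2) openin_subset by blast
  from chart_at[OF this] show ?thesis unfolding vderiv_def
    using deriv_in_cong[OF _ _ assms] by simp
qed

lemma vderiv_const [simp]: "vderiv K p v (\<lambda>q. a) = 0"
  by (simp add: vderiv_def)

context
  fixes V p assumes V: "openin (Top K) V" "p \<in> V"
begin

lemma chart_at_V: "chart_at K p \<in> Charts K" "p \<in> fst (chart_at K p)"
  using chart_at[of p] V openin_subset by auto

lemma linear_vderiv: "smooth_fun K V F \<Longrightarrow> linear (\<lambda>v. vderiv K p v F)"
proof -
  assume F: "smooth_fun K V F"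
  note L = linear_deriv_in[OF F chart_at_V V(2)]
  show ?thesis unfolding vderiv_def
    by (rule linearI) (simp_all add: scaleR_fun_def linear_add[OF L] linear_scale[OF L])
qed

lemma vderiv_add:
  "smooth_fun K V F \<Longrightarrow> smooth_fun K V G \<Longrightarrow>
    vderiv K p v (\<lambda>q. F q + G q) = vderiv K p v F + vderiv K p v G"
  unfolding vderiv_def by (rule deriv_in_add[OF _ _ chart_at_V V(2)])

lemma vderiv_scaleR:
  "smooth_fun K V F \<Longrightarrow> smooth_fun K V G \<Longrightarrow>
    vderiv K p v (\<lambda>q. F q *\<^sub>R G q) = F p *\<^sub>R vderiv K p v G + vderiv K p v F *\<^sub>R G p"
  unfolding vderiv_def by (rule deriv_in_scaleR[OF _ _ chart_at_V V(2)])

lemma vderiv_bounded_linear: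
  "bounded_linear h \<Longrightarrow> smooth_fun K V F \<Longrightarrow> vderiv K p v (\<lambda>q. h (F q)) = h (vderiv K p v F)"
  unfolding vderiv_def by (rule deriv_in_bounded_linear[OF _ _ chart_at_V V(2)])

end

lemma vderiv_chart_map:
  assumes "v \<in> tangent_space K p" "c \<in> charts_at K p"
  shows "vderiv K p v (snd c) = v c"
  using vderiv_chart[OF assms smooth_fun_chart chart_open, of c] assms(2) by simp

section \<open>Smooth vector fields and the Lie bracket\<close>

lemma smooth_vf_tangent: "smooth_vf K V X \<Longrightarrow> p \<in> V \<Longrightarrow> X p \<in> tangent_space K p"
  by (simp add: smooth_vf_def)

lemma smooth_vf_subset: "smooth_vf K V X \<Longrightarrow> W \<subseteq> V \<Longrightarrow> smooth_vf K W X"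
  unfolding smooth_vf_def by (blast intro: smooth_on_subset)

lemma smooth_vf_component:
  assumes "smooth_vf K V X" "openin (Top K) V" "c \<in> Charts K"
  shows "smooth_fun K (V \<inter> fst c) (\<lambda>q. X q c)"
proof (rule smooth_fun_chartI)
  show "smooth_on (snd c ` (V \<inter> fst c)) (in_chart c (\<lambda>q. X q c))"
    using assms(1,3) by (simp add: smooth_vf_def Int_commute)
qed (use assms chart_Int_open in auto)

text \<open>In a second chart the components are the derivative of that chart in the direction given
  by the first components, hence smooth on the overlap. So one chart around each point is enough to
  test smoothness.\<close>

lemma smooth_vfI:
  assumes tangent: "\<And>p. p \<in> V \<Longrightarrow> X p \<in> tangent_space K p"
    and local: "\<And>p. p \<in> V \<Longrightarrow> \<exists>c\<in>Charts K. \<exists>W. openin (Top K) W \<and> p \<in> W \<and> W \<subseteq> fst c \<and> W \<subseteq> V \<and>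
        smooth_fun K W (\<lambda>q. X q c)"
  shows "smooth_vf K V X"
proof -
  have "smooth_on (snd c' ` (fst c' \<inter> V)) (in_chart c' (\<lambda>q. X q c'))" if c': "c' \<in> Charts K" for c'
  proof (rule smooth_on_local)
    fix x assume "x \<in> snd c' ` (fst c' \<inter> V)"
    then obtain p where p: "p \<in> fst c'" "p \<in> V" "x = snd c' p" by blast
    obtain c W where c: "c \<in> Charts K" and W: "openin (Top K) W" "p \<in> W" "W \<subseteq> fst c" "W \<subseteq> V"
      and X: "smooth_fun K W (\<lambda>q. X q c)"
      using local[OF p(2)] by blast
    have W': "openin (Top K) (W \<inter> fst c')" using W chart_open[OF c'] by auto
    have "smooth_fun K (W \<inter> fst c') (\<lambda>q. X q c')"
    proof (rule smooth_fun_cong[OF W'])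
      show "smooth_fun K (W \<inter> fst c') (\<lambda>q. deriv_in c q (X q c) (snd c'))"
        using W c c' by (intro smooth_fun_deriv_in W') (auto intro: smooth_fun_subset[OF smooth_fun_chart[OF c']]
            smooth_fun_subset[OF X])
      show "deriv_in c q (X q c) (snd c') = X q c'" if "q \<in> W \<inter> fst c'" for q
        using tangent_space_change[OF tangent, of q c c'] that W c c' by (auto intro: sym)
    qed
    from smooth_funD[OF this c'] show "\<exists>T. open T \<and> x \<in> T \<and> smooth_on T (in_chart c' (\<lambda>q. X q c'))"
      using chart_image_open[OF c' W'] p W by (intro exI[of _ "snd c' ` (fst c' \<inter> (W \<inter> fst c'))"]) auto
  qed
  then show ?thesis using tangent by (simp add: smooth_vf_def)
qed

lemma smooth_vf_chartI:
  assumes "openin (Top K) V" "\<And>p. p \<in> V \<Longrightarrow> X p \<in> tangent_space K p"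
    and "\<And>c. c \<in> Charts K \<Longrightarrow> smooth_fun K (V \<inter> fst c) (\<lambda>q. X q c)"
  shows "smooth_vf K V X"
proof (rule smooth_vfI)
  fix p assume p: "p \<in> V"
  then have "p \<in> points K" using assms(1) openin_subset by blast
  then obtain c where c: "c \<in> Charts K" "p \<in> fst c" using points_in_chart by blast
  show "\<exists>c\<in>Charts K. \<exists>W. openin (Top K) W \<and> p \<in> W \<and> W \<subseteq> fst c \<and> W \<subseteq> V \<and> smooth_fun K W (\<lambda>q. X q c)"
    using p c assms(1) chart_open[OF c(1)] assms(3)[OF c(1)]
    by (intro bexI[of _ c] exI[of _ "V \<inter> fst c"]) auto
qed (rule assms(2))

lemma smooth_vf_coord: "c \<in> Charts K \<Longrightarrow> smooth_vf K (fst c) (\<lambda>q. coord_vec K c q u)"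
proof (rule smooth_vfI)
  assume c: "c \<in> Charts K"
  show "coord_vec K c p u \<in> tangent_space K p" if "p \<in> fst c" for p
    using coord_vec_tangent that c by simp
  show "\<exists>c'\<in>Charts K. \<exists>W. openin (Top K) W \<and> p \<in> W \<and> W \<subseteq> fst c' \<and> W \<subseteq> fst c \<and>
      smooth_fun K W (\<lambda>q. coord_vec K c q u c')" if p: "p \<in> fst c" for p
    using c p chart_open smooth_fun_cong[OF chart_open[OF c] _ smooth_fun_const, of u "\<lambda>q. coord_vec K c q u c"]
    by (intro bexI[of _ c] exI[of _ "fst c"]) auto
qed

lemma smooth_vf_cong:
  assumes "openin (Top K) V" "\<And>p. p \<in> V \<Longrightarrow> X p = Y p" "smooth_vf K V X"
  shows "smooth_vf K V Y"
proof (rule smooth_vf_chartI[OF assms(1)])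
  show "Y p \<in> tangent_space K p" if "p \<in> V" for p using assms that by (metis smooth_vf_tangent)
  show "smooth_fun K (V \<inter> fst c) (\<lambda>q. Y q c)" if c: "c \<in> Charts K" for c
    by (rule smooth_fun_cong[OF _ _ smooth_vf_component[OF assms(3,1) c]])
      (use assms chart_open[OF c] in auto)
qed

lemma smooth_vf_add:
  assumes V: "openin (Top K) V" and X: "smooth_vf K V X" and Y: "smooth_vf K V Y"
  shows "smooth_vf K V (\<lambda>p. X p + Y p)"
  using smooth_vf_component[OF X V] smooth_vf_component[OF Y V] V chart_open
  by (intro smooth_vf_chartI[OF V])
    (auto intro!: smooth_fun_add tangent_closed smooth_vf_tangent[OF X] smooth_vf_tangent[OF Y])

lemma smooth_vf_scaleR:
  assumes V: "openin (Top K) V" and F: "smooth_fun K V F" and X: "smooth_vf K V X"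
  shows "smooth_vf K V (\<lambda>p. F p *\<^sub>R X p)"
proof (rule smooth_vf_chartI[OF V])
  fix c assume c: "c \<in> Charts K"
  have "smooth_fun K (V \<inter> fst c) F" using F by (rule smooth_fun_subset) auto
  then show "smooth_fun K (V \<inter> fst c) (\<lambda>q. (F q *\<^sub>R X q) c)"
    unfolding scaleR_fun_def using smooth_vf_component[OF X V c] V chart_open[OF c]
    by (intro smooth_fun_scaleR) auto
qed (auto intro: tangent_closed smooth_vf_tangent[OF X])

lemma smooth_vf_diff:
  assumes V: "openin (Top K) V" and X: "smooth_vf K V X" and Y: "smooth_vf K V Y"
  shows "smooth_vf K V (\<lambda>p. X p - Y p)"
  using smooth_vf_add[OF V X smooth_vf_scaleR[OF V smooth_fun_const Y, of "-1"]] by simp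

text \<open>Constant components in one chart. The extension is only local, which suffices because
  smoothness and the connection axioms are stated on arbitrary open sets.\<close>

lemma smooth_vf_extension:
  assumes "openin (Top K) V" "p \<in> V" "v \<in> tangent_space K p"
  obtains W X where "openin (Top K) W" "p \<in> W" "W \<subseteq> V" "smooth_vf K W X" "X p = v"
proof -
  have "p \<in> points K" using assms openin_subset by blast
  then obtain c where c: "c \<in> Charts K" "p \<in> fst c" using points_in_chart by blast
  show thesis
  proof (rule that)
    show "openin (Top K) (V \<inter> fst c)" using assms chart_open[OF c(1)] by auto
    show "smooth_vf K (V \<inter> fst c) (\<lambda>q. coord_vec K c q (v c))"
      by (rule smooth_vf_subset[OF smooth_vf_coord[OF c(1)]]) simp
    show "coord_vec K c p (v c) = v" using tangent_eq_coord_vec[OF assms(3)] c by simp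
  qed (use assms c in auto)
qed

lemma smooth_fun_vderiv:
  assumes V: "openin (Top K) V" and X: "smooth_vf K V X" and F: "smooth_fun K V F"
  shows "smooth_fun K V (\<lambda>q. vderiv K q (X q) F)"
proof (rule smooth_fun_local)
  fix p assume p: "p \<in> V"
  then have "p \<in> points K" using V openin_subset by blast
  then obtain c where c: "c \<in> Charts K" "p \<in> fst c" using points_in_chart by blast
  have W: "openin (Top K) (V \<inter> fst c)" using V chart_open[OF c(1)] by auto
  have "smooth_fun K (V \<inter> fst c) (\<lambda>q. vderiv K q (X q) F)"
  proof (rule smooth_fun_cong[OF W])
    show "smooth_fun K (V \<inter> fst c) (\<lambda>q. deriv_in c q (X q c) F)"
      using smooth_vf_component[OF X V c(1)] W c by (intro smooth_fun_deriv_in smooth_fun_subset[OF F]) auto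
    show "deriv_in c q (X q c) F = vderiv K q (X q) F" if "q \<in> V \<inter> fst c" for q
      using vderiv_chart[OF smooth_vf_tangent[OF X], of q c V F] that c F V by simp
  qed
  then show "\<exists>W. openin (Top K) W \<and> p \<in> W \<and> smooth_fun K W (\<lambda>q. vderiv K q (X q) F)"
    using W p c by blast
qed

text \<open>The product rule separates the derivative of the components of \<open>Y\<close> from a
  pure second derivative of \<open>F\<close> with \<open>Y\<close> frozen at \<open>p\<close>. The
  latter is symmetric in the two directions, so it drops out of the commutator.\<close>

lemma vderiv_vderiv_chart:
  assumes V: "openin (Top K) V" "p \<in> V" and c: "c \<in> charts_at K p"
    and X: "smooth_vf K V X" and Y: "smooth_vf K V Y" and F: "smooth_fun K V F"
  shows "vderiv K p (X p) (\<lambda>q. vderiv K q (Y q) F) =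
    deriv_in c p (vderiv K p (X p) (\<lambda>q. Y q c)) F + deriv_in c p (X p c) (\<lambda>q. deriv_in c q (Y p c) F)"
proof -
  let ?W = "V \<inter> fst c"
  have cK: "c \<in> Charts K" "p \<in> fst c" using c by auto
  have W: "openin (Top K) ?W" "p \<in> ?W" using V c chart_Int_open by auto
  have FW: "smooth_fun K ?W F" using F by (rule smooth_fun_subset) auto
  note Yc = smooth_vf_component[OF Y V(1) cK(1)]
  have D: "smooth_fun K ?W (\<lambda>q. deriv_in c q u F)" for u
    using smooth_fun_deriv_in_const[OF FW W(1) cK(1)] by simp
  have Yci: "smooth_fun K ?W (\<lambda>q. Y q c \<bullet> i)" for i by (rule smooth_fun_inner_const[OF W(1) Yc])
  note Xp = smooth_vf_tangent[OF X V(2)]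
  have dY: "vderiv K p (X p) (\<lambda>q. Y q c) = deriv_in c p (X p c) (\<lambda>q. Y q c)"
    by (rule vderiv_chart[OF Xp c Yc W])
  have "vderiv K p (X p) (\<lambda>q. vderiv K q (Y q) F) = deriv_in c p (X p c) (\<lambda>q. vderiv K q (Y q) F)"
    by (rule vderiv_chart[OF Xp c smooth_fun_vderiv[OF V(1) Y F] V])
  also have "\<dots> = deriv_in c p (X p c) (\<lambda>q. \<Sum>i\<in>Basis. (Y q c \<bullet> i) *\<^sub>R deriv_in c q i F)"
  proof (rule deriv_in_cong[OF cK W])
    fix q assume q: "q \<in> ?W"
    have "vderiv K q (Y q) F = deriv_in c q (Y q c) F"
      using q cK F V by (intro vderiv_chart smooth_vf_tangent[OF Y]) auto
    then show "vderiv K q (Y q) F = (\<Sum>i\<in>Basis. (Y q c \<bullet> i) *\<^sub>R deriv_in c q i F)"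
      using deriv_in_basis[OF F cK(1)] q by simp
  qed
  also have "\<dots> = (\<Sum>i\<in>Basis. deriv_in c p (X p c) (\<lambda>q. (Y q c \<bullet> i) *\<^sub>R deriv_in c q i F))"
    by (rule deriv_in_sum[OF smooth_fun_scaleR[OF W(1) Yci D] cK W(2)])
  also have "\<dots> = (\<Sum>i\<in>Basis. (Y p c \<bullet> i) *\<^sub>R deriv_in c p (X p c) (\<lambda>q. deriv_in c q i F)) +
      (\<Sum>i\<in>Basis. (deriv_in c p (X p c) (\<lambda>q. Y q c) \<bullet> i) *\<^sub>R deriv_in c p i F)"
    using deriv_in_scaleR[OF Yci D cK W(2)]
      deriv_in_bounded_linear[OF bounded_linear_inner_left Yc cK W(2)]
    by (simp add: sum.distrib)
  also have "(\<Sum>i\<in>Basis. (deriv_in c p (X p c) (\<lambda>q. Y q c) \<bullet> i) *\<^sub>R deriv_in c p i F) =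
      deriv_in c p (deriv_in c p (X p c) (\<lambda>q. Y q c)) F"
    by (rule deriv_in_basis[OF F cK V(2), symmetric])
  also have "(\<Sum>i\<in>Basis. (Y p c \<bullet> i) *\<^sub>R deriv_in c p (X p c) (\<lambda>q. deriv_in c q i F)) =
      deriv_in c p (X p c) (\<lambda>q. \<Sum>i\<in>Basis. (Y p c \<bullet> i) *\<^sub>R deriv_in c q i F)"
    by (subst deriv_in_sum[OF smooth_fun_scaleR[OF W(1) smooth_fun_const D] cK W(2)])
      (simp add: deriv_in_scaleR[OF smooth_fun_const D cK W(2)])
  also have "\<dots> = deriv_in c p (X p c) (\<lambda>q. deriv_in c q (Y p c) F)"
    by (rule deriv_in_cong[OF cK W]) (use deriv_in_basis[OF F cK(1)] in simp)
  finally show ?thesis using dY by (simp add: add.commute)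
qed

lemma bracket_component:
  "c \<in> charts_at K p \<Longrightarrow>
    bracket K X Y p c = vderiv K p (X p) (\<lambda>q. Y q c) - vderiv K p (Y p) (\<lambda>q. X q c)"
  by (simp add: bracket_def)

text \<open>The left side uses components in one chart because the bracket is not yet known to be a
  tangent vector. With the chart map \<open>snd c'\<close> as \<open>F\<close> the identity becomes
  the transformation law that makes it one.\<close>

lemma deriv_in_bracket:
  fixes F :: "'a \<Rightarrow> 'f::euclidean_space"
  assumes V: "openin (Top K) V" "p \<in> V" and c: "c \<in> charts_at K p"
    and X: "smooth_vf K V X" and Y: "smooth_vf K V Y" and F: "smooth_fun K V F"
  shows "deriv_in c p (bracket K X Y p c) F =
    vderiv K p (X p) (\<lambda>q. vderiv K q (Y q) F) - vderiv K p (Y p) (\<lambda>q. vderiv K q (X q) F)"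
proof -
  have cK: "c \<in> Charts K" "p \<in> fst c" using c by auto
  note L = linear_deriv_in[OF F cK V(2)]
  show ?thesis
    using vderiv_vderiv_chart[OF V c X Y F] vderiv_vderiv_chart[OF V c Y X F]
      deriv_in_commute[OF F V(1) cK V(2), of "X p c" "Y p c"]
    by (simp add: bracket_component[OF c] linear_diff[OF L])
qed

lemma bracket_tangent:
  assumes V: "openin (Top K) V" "p \<in> V" and X: "smooth_vf K V X" and Y: "smooth_vf K V Y"
  shows "bracket K X Y p \<in> tangent_space K p"
proof -
  have "bracket K X Y p c' = deriv_in c p (bracket K X Y p c) (snd c')"
    if c: "c \<in> charts_at K p" "c' \<in> charts_at K p" for c c'
  proof -
    let ?W = "V \<inter> fst c'"
    have W: "openin (Top K) ?W" "p \<in> ?W" using V c chart_Int_open by auto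
    have sub: "?W \<subseteq> V" "?W \<subseteq> fst c'" by auto
    have F: "smooth_fun K ?W (snd c')" using c by (intro smooth_fun_chart_subset) auto
    have comp: "vderiv K p v (\<lambda>q. vderiv K q (Z q) (snd c')) = vderiv K p v (\<lambda>q. Z q c')"
      if "smooth_vf K V Z" for Z v
      by (rule vderiv_cong[OF W], rule vderiv_chart_map) (use c smooth_vf_tangent[OF that] in auto)
    show ?thesis
      using deriv_in_bracket[OF W c(1) smooth_vf_subset[OF X sub(1)] smooth_vf_subset[OF Y sub(1)] F]
      by (simp add: comp X Y bracket_component[OF c(2)])
  qed
  moreover have "bracket K X Y p c = 0" if "c \<notin> charts_at K p" for c
    using that by (simp only: bracket_def if_False)
  ultimately show ?thesis unfolding tangent_space_def by blast
qed

lemma vderiv_bracket: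
  fixes F :: "'a \<Rightarrow> 'f::euclidean_space"
  assumes V: "openin (Top K) V" "p \<in> V" and X: "smooth_vf K V X" and Y: "smooth_vf K V Y"
    and F: "smooth_fun K V F"
  shows "vderiv K p (bracket K X Y p) F =
    vderiv K p (X p) (\<lambda>q. vderiv K q (Y q) F) - vderiv K p (Y p) (\<lambda>q. vderiv K q (X q) F)"
proof -
  have "p \<in> points K" using V openin_subset by blast
  note c = chart_at[OF this]
  show ?thesis
    using vderiv_chart[OF bracket_tangent[OF V X Y] c F V] deriv_in_bracket[OF V c X Y F] by simp
qed

lemma smooth_vf_bracket:
  assumes V: "openin (Top K) V" and X: "smooth_vf K V X" and Y: "smooth_vf K V Y"
  shows "smooth_vf K V (bracket K X Y)"
proof (rule smooth_vf_chartI[OF V])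
  show "bracket K X Y p \<in> tangent_space K p" if "p \<in> V" for p by (rule bracket_tangent[OF V that X Y])
  fix c assume c: "c \<in> Charts K"
  have W: "openin (Top K) (V \<inter> fst c)" using V chart_open[OF c] by auto
  have "smooth_fun K (V \<inter> fst c) (\<lambda>q. vderiv K q (X q) (\<lambda>q. Y q c) - vderiv K q (Y q) (\<lambda>q. X q c))"
    using smooth_vf_component[OF X V c] smooth_vf_component[OF Y V c]
    by (intro smooth_fun_diff smooth_fun_vderiv W smooth_vf_subset[OF X] smooth_vf_subset[OF Y]) auto
  then show "smooth_fun K (V \<inter> fst c) (\<lambda>q. bracket K X Y q c)"
    by (rule smooth_fun_cong[OF W, rotated]) (use c in \<open>simp add: bracket_def\<close>)
qed

lemma smooth_fun_compose:
  fixes y :: "'a \<Rightarrow> 'f::euclidean_space"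
  assumes "openin (Top K) V" "smooth_fun K V y" "open T" "y ` V \<subseteq> T" "smooth_on T H"
  shows "smooth_fun K V (\<lambda>q. H (y q))"
  unfolding smooth_fun_def
proof
  fix c assume c: "c \<in> Charts K"
  have "smooth_on (snd c ` (fst c \<inter> V)) (\<lambda>z. H (in_chart c y z))"
  proof (rule smooth_on_compose[OF chart_image_open[OF c assms(1)] assms(3) _ smooth_funD[OF assms(2) c] assms(5)])
    show "in_chart c y ` (snd c ` (fst c \<inter> V)) \<subseteq> T" using c assms(4) by auto
  qed
  then show "smooth_on (snd c ` (fst c \<inter> V)) (in_chart c (\<lambda>q. H (y q)))"
    by (simp add: in_chart_def o_def)
qed

lemma smooth_vf_zero: "openin (Top K) V \<Longrightarrow> smooth_vf K V (\<lambda>p. 0)"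
  by (rule smooth_vf_chartI) (simp_all add: tangent_closed smooth_fun_const)

lemma smooth_vf_sum:
  assumes V: "openin (Top K) V" and X: "\<And>i. i \<in> I \<Longrightarrow> smooth_vf K V (X i)"
  shows "smooth_vf K V (\<lambda>p. \<Sum>i\<in>I. X i p)"
proof (cases "finite I")
  case True
  then show ?thesis using X
    by (induction I) (simp_all add: smooth_vf_zero[OF V] smooth_vf_add[OF V])
qed (simp add: smooth_vf_zero[OF V])

lemma bracket_coord_fields:
  assumes c: "c \<in> Charts K" and p: "p \<in> fst c"
  shows "bracket K (\<lambda>q. coord_vec K c q a) (\<lambda>q. coord_vec K c q b) p = 0"
proof (rule tangent_eqI)
  show "bracket K (\<lambda>q. coord_vec K c q a) (\<lambda>q. coord_vec K c q b) p \<in> tangent_space K p"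
    by (rule bracket_tangent[OF chart_open[OF c] p smooth_vf_coord[OF c] smooth_vf_coord[OF c]])
  have "vderiv K p v (\<lambda>q. coord_vec K c q w c) = 0" for v w
    using vderiv_cong[OF chart_open[OF c] p, of "\<lambda>q. coord_vec K c q w c" "\<lambda>q. w" v] c by simp
  then show "bracket K (\<lambda>q. coord_vec K c q a) (\<lambda>q. coord_vec K c q b) p c = 0 c"
    using c p by (simp add: bracket_component)
qed (use c p tangent_closed in auto)

end

section \<open>Connections and metrics\<close>

lemma scaleR_fun_apply [simp]: "(r *\<^sub>R f) x = r *\<^sub>R f x"
  by (simp add: scaleR_fun_def)

lemma linear_on_set_add: "linear_on_set S f \<Longrightarrow> u \<in> S \<Longrightarrow> v \<in> S \<Longrightarrow> f (u + v) = f u + f v"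
  by (simp add: linear_on_set_def)

lemma linear_on_set_scale: "linear_on_set S f \<Longrightarrow> u \<in> S \<Longrightarrow> f (a *\<^sub>R u) = a *\<^sub>R f u"
  by (simp add: linear_on_set_def)

lemma linear_on_set_0: "linear_on_set S f \<Longrightarrow> subspace S \<Longrightarrow> f 0 = 0"
  using linear_on_set_scale[of S f 0 0] by (simp add: subspace_0)

lemma linear_on_set_minus: "linear_on_set S f \<Longrightarrow> u \<in> S \<Longrightarrow> f (- u) = - f u"
  using linear_on_set_scale[of S f u "-1"] by simp

lemma linear_on_set_diff:
  "linear_on_set S f \<Longrightarrow> subspace S \<Longrightarrow> u \<in> S \<Longrightarrow> v \<in> S \<Longrightarrow> f (u - v) = f u - f v"
  using linear_on_set_add[of S f u "- v"] linear_on_set_minus[of S f v] by (simp add: subspace_neg)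

lemma linear_on_set_sum:
  assumes "linear_on_set S f" "subspace S" "\<And>i. i \<in> I \<Longrightarrow> v i \<in> S"
  shows "f (\<Sum>i\<in>I. a i *\<^sub>R v i) = (\<Sum>i\<in>I. a i *\<^sub>R f (v i))"
proof (cases "finite I")
  case True
  then show ?thesis using assms(3)
  proof (induction I)
    case (insert i I)
    have "(\<Sum>i\<in>I. a i *\<^sub>R v i) \<in> S"
      using insert.prems by (intro subspace_sum assms(2) subspace_scale) auto
    then show ?case
      using insert by (simp add: linear_on_set_add[OF assms(1)] linear_on_set_scale[OF assms(1)]
          subspace_scale[OF assms(2)])
  qed (simp add: linear_on_set_0[OF assms(1,2)])
qed (simp add: linear_on_set_0[OF assms(1,2)])

locale riemannian_manifold = manifold N
  for N :: "('a, 'e::euclidean_space) mfd" +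
  fixes g :: "'a \<Rightarrow> ('a, 'e) tvec \<Rightarrow> ('a, 'e) tvec \<Rightarrow> real"
    and nab :: "('a, 'e) conn"
  assumes metric: "riemannian_metric N g"
    and connection: "levi_civita N g nab"
begin

lemma g_linear: "p \<in> points N \<Longrightarrow> u \<in> tangent_space N p \<Longrightarrow> linear_on_set (tangent_space N p) (g p u)"
  using metric by (simp add: riemannian_metric_def)

lemma g_sym: "p \<in> points N \<Longrightarrow> u \<in> tangent_space N p \<Longrightarrow> v \<in> tangent_space N p \<Longrightarrow> g p u v = g p v u"
  using metric unfolding riemannian_metric_def by blast

lemma g_pos: "p \<in> points N \<Longrightarrow> u \<in> tangent_space N p \<Longrightarrow> u \<noteq> 0 \<Longrightarrow> g p u u > 0"
  using metric unfolding riemannian_metric_def by blast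

lemma g_smooth:
  "openin (Top N) V \<Longrightarrow> smooth_vf N V X \<Longrightarrow> smooth_vf N V Y \<Longrightarrow> smooth_fun N V (\<lambda>p. g p (X p) (Y p))"
  using metric[unfolded riemannian_metric_def, THEN conjunct2, rule_format, of V X Y] by simp

lemma g_linear_left:
  assumes "p \<in> points N" "v \<in> tangent_space N p"
  shows "linear_on_set (tangent_space N p) (\<lambda>u. g p u v)"
proof -
  have *: "g p u v = g p v u" if "u \<in> tangent_space N p" for u using g_sym assms that by blast
  show ?thesis
    using g_linear[OF assms] tangent_closed * by (simp add: linear_on_set_def)
qed

lemma affine: "affine_connection N nab"
  using connection by (simp add: levi_civita_def)

lemmas affine_rules = affine[unfolded affine_connection_def, THEN spec, THEN spec, THEN mp, OF conjI]

lemma nab_smooth: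
  "openin (Top N) V \<Longrightarrow> smooth_vf N V X \<Longrightarrow> smooth_vf N V Y \<Longrightarrow> smooth_vf N V (\<lambda>p. nab p (X p) Y)"
  using affine_rules[THEN conjunct1, THEN spec, of V Y X] by simp

context
  fixes V p Y
  assumes V: "openin (Top N) V" "p \<in> V" and Y: "smooth_vf N V Y"
begin

lemma nab_linear: "linear_on_set (tangent_space N p) (\<lambda>u. nab p u Y)"
  by (rule affine_rules[OF V(1) Y, THEN conjunct2, THEN conjunct1, THEN bspec, OF V(2)])

lemma nab_tangent:
  assumes u: "u \<in> tangent_space N p" shows "nab p u Y \<in> tangent_space N p"
proof -
  obtain W X where W: "openin (Top N) W" "p \<in> W" "W \<subseteq> V" and X: "smooth_vf N W X" "X p = u"
    using smooth_vf_extension[OF V u] .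
  show ?thesis
    using smooth_vf_tangent[OF nab_smooth[OF W(1) X(1) smooth_vf_subset[OF Y W(3)]] W(2)] X(2) by simp
qed

context
  fixes u assumes u: "u \<in> tangent_space N p"
begin

lemmas derivation_rules =
  affine_rules[OF V(1) Y, THEN conjunct2, THEN conjunct2, THEN bspec, OF V(2), THEN bspec, OF u]

lemma nab_cong: "(\<And>q. q \<in> V \<Longrightarrow> Z q = Y q) \<Longrightarrow> nab p u Z = nab p u Y"
  using derivation_rules[THEN conjunct2, THEN conjunct2, THEN spec, of Z] by simp

lemma nab_add: "smooth_vf N V Z \<Longrightarrow> nab p u (\<lambda>q. Y q + Z q) = nab p u Y + nab p u Z"
  using derivation_rules[THEN conjunct1, THEN spec, of Z] by simp

lemma nab_scaleR:
  "smooth_fun N V F \<Longrightarrow> nab p u (\<lambda>q. F q *\<^sub>R Y q) = vderiv N p u F *\<^sub>R Y p + F p *\<^sub>R nab p u Y"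
  using derivation_rules[THEN conjunct2, THEN conjunct1, THEN spec, of F] by simp

lemma nab_zero: "nab p u (\<lambda>q. 0) = 0"
  using nab_scaleR[OF smooth_fun_const, of 0] unfolding vderiv_const scaleR_zero_left add_0 .

end

end

lemma nab_sum:
  assumes V: "openin (Top N) V" "p \<in> V" and u: "u \<in> tangent_space N p" and "finite I"
    and "\<And>i. i \<in> I \<Longrightarrow> smooth_fun N V (F i)" "\<And>i. i \<in> I \<Longrightarrow> smooth_vf N V (Y i)"
  shows "nab p u (\<lambda>q. \<Sum>i\<in>I. F i q *\<^sub>R Y i q) =
    (\<Sum>i\<in>I. vderiv N p u (F i) *\<^sub>R Y i p + F i p *\<^sub>R nab p u (Y i))"
  using assms(4-)
proof (induction I)
  case empty
  show ?case unfolding sum.empty by (rule nab_zero[OF V smooth_vf_zero[OF V(1)] u])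
next
  case (insert i I)
  have "smooth_vf N V (\<lambda>q. F i q *\<^sub>R Y i q)" "smooth_vf N V (\<lambda>q. \<Sum>i\<in>I. F i q *\<^sub>R Y i q)"
    using insert.prems by (auto intro!: smooth_vf_sum smooth_vf_scaleR V)
  note add = nab_add[OF V this(1) u this(2)]
  have scale: "nab p u (\<lambda>q. F i q *\<^sub>R Y i q) = vderiv N p u (F i) *\<^sub>R Y i p + F i p *\<^sub>R nab p u (Y i)"
    using insert.prems by (intro nab_scaleR[OF V _ u]) auto
  have IH: "nab p u (\<lambda>q. \<Sum>i\<in>I. F i q *\<^sub>R Y i q) =
      (\<Sum>i\<in>I. vderiv N p u (F i) *\<^sub>R Y i p + F i p *\<^sub>R nab p u (Y i))"
    using insert.prems by (intro insert.IH) auto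
  show ?case unfolding sum.insert[OF insert.hyps] add scale IH by (rule refl)
qed

text \<open>The definition of \<open>nab_along\<close> differentiates a field whose components are
  frozen at the value of \<open>Y\<close> at \<open>p\<close>; this expansion makes the linear
  dependence on that value explicit.\<close>

lemma nab_coord_vec:
  assumes c: "c \<in> Charts N" "p \<in> fst c" and u: "u \<in> tangent_space N p"
  shows "nab p u (\<lambda>q. coord_vec N c q a) = (\<Sum>i\<in>Basis. (a \<bullet> i) *\<^sub>R nab p u (\<lambda>q. coord_vec N c q i))"
proof -
  note V = chart_open[OF c(1)] c(2)
  have eq: "coord_vec N c q a = (\<Sum>i\<in>Basis. (a \<bullet> i) *\<^sub>R coord_vec N c q i)" if "q \<in> fst c" for q
    by (rule linear_euclidean_sum[OF linear_coord_vec]) (use that c in simp)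
  have "nab p u (\<lambda>q. \<Sum>i\<in>Basis. (a \<bullet> i) *\<^sub>R coord_vec N c q i) = nab p u (\<lambda>q. coord_vec N c q a)"
    by (rule nab_cong[OF V smooth_vf_coord[OF c(1)] u]) (simp add: eq)
  then show ?thesis
    using nab_sum[OF V u finite_Basis, of "\<lambda>i q. a \<bullet> i" "\<lambda>i q. coord_vec N c q i"]
    by (simp add: smooth_fun_const smooth_vf_coord[OF c(1)])
qed

lemma torsion_free:
  "openin (Top N) V \<Longrightarrow> p \<in> V \<Longrightarrow> smooth_vf N V X \<Longrightarrow> smooth_vf N V Y \<Longrightarrow>
    nab p (X p) Y - nab p (Y p) X = bracket N X Y p"
  using connection[unfolded levi_civita_def, THEN conjunct2, THEN conjunct1, rule_format, of V X Y p] by simp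

lemma metric_compatible:
  "openin (Top N) V \<Longrightarrow> p \<in> V \<Longrightarrow> smooth_vf N V X \<Longrightarrow> smooth_vf N V Y \<Longrightarrow> u \<in> tangent_space N p \<Longrightarrow>
    vderiv N p u (\<lambda>q. g q (X q) (Y q)) = g p (nab p u X) (Y p) + g p (X p) (nab p u Y)"
  using connection[unfolded levi_civita_def, THEN conjunct2, THEN conjunct2, rule_format, of V X Y p u] by simp

lemma nab_coord_commute:
  assumes c: "c \<in> Charts N" "p \<in> fst c"
  shows "nab p (coord_vec N c p a) (\<lambda>q. coord_vec N c q b) = nab p (coord_vec N c p b) (\<lambda>q. coord_vec N c q a)"
  using torsion_free[OF chart_open[OF c(1)] c(2) smooth_vf_coord[OF c(1)] smooth_vf_coord[OF c(1)], of a b]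
    bracket_coord_fields[OF c] by simp

end

section \<open>Submanifolds\<close>

locale submanifold = submanifold_geometry N g nab M + riemannian_manifold N g nab
  for N :: "('a, 'e::euclidean_space) mfd"
    and g :: "'a \<Rightarrow> ('a, 'e) tvec \<Rightarrow> ('a, 'e) tvec \<Rightarrow> real"
    and nab :: "('a, 'e) conn"
    and M :: "('a, 'd::euclidean_space) mfd" +
  assumes immersed: "immersed_submanifold"
begin

section \<open>The inclusion map and its differential\<close>

sublocale M: manifold M
  using immersed by unfold_locales (simp add: immersed_submanifold_def)

lemma points_subset: "points M \<subseteq> points N"
  using immersed by (simp add: immersed_submanifold_def)

lemma in_points: "openin (Top M) V \<Longrightarrow> p \<in> V \<Longrightarrow> p \<in> points M"
  using openin_subset by blast

lemma in_points_N: "openin (Top M) V \<Longrightarrow> p \<in> V \<Longrightarrow> p \<in> points N"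
  using in_points points_subset by blast

lemma openin_restrict:
  assumes "openin (Top N) W"
  shows "openin (Top M) (W \<inter> points M)"
proof -
  have "openin (Top M) {p \<in> points M. p \<in> W}"
    using immersed assms by (simp add: immersed_submanifold_def continuous_map)
  moreover have "{p \<in> points M. p \<in> W} = W \<inter> points M" by blast
  ultimately show ?thesis by simp
qed

lemma openin_Int_restrict:
  assumes "openin (Top M) V" "openin (Top N) W"
  shows "openin (Top M) (V \<inter> W)"
proof -
  have "V \<inter> W = V \<inter> (W \<inter> points M)" using openin_subset[OF assms(1)] by blast
  then show ?thesis using openin_Int[OF assms(1) openin_restrict[OF assms(2)]] by simp
qed

lemma openin_Int_chart: "openin (Top M) V \<Longrightarrow> c \<in> Charts N \<Longrightarrow> openin (Top M) (V \<inter> fst c)"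
  by (intro openin_Int_restrict chart_open)

lemma smooth_fun_chart_map:
  assumes "openin (Top M) V" "c \<in> Charts N" "V \<subseteq> fst c"
  shows "smooth_fun M V (snd c)"
proof (rule M.smooth_fun_subset)
  show "smooth_fun M (fst c \<inter> points M) (snd c)"
    using immersed assms(2) by (simp add: immersed_submanifold_def)
  show "V \<subseteq> fst c \<inter> points M" using assms openin_subset by blast
qed

text \<open>Near each point \<open>F\<close> is the smooth function \<open>in_chart c F\<close>
  composed with a chart map of \<open>N\<close>, and chart maps of \<open>N\<close> are smooth on
  \<open>M\<close> by the definition of an immersed submanifold.\<close>

lemma smooth_fun_restrict:
  assumes F: "smooth_fun N W F" and W: "openin (Top N) W" and V: "openin (Top M) V" "V \<subseteq> W"
  shows "smooth_fun M V F"
proof (rule M.smooth_fun_local)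
  fix p assume p: "p \<in> V"
  then obtain c where c: "c \<in> Charts N" "p \<in> fst c" using points_in_chart in_points_N[OF V(1)] by blast
  have V': "openin (Top M) (V \<inter> fst c)" by (rule openin_Int_chart[OF V(1) c(1)])
  have "smooth_fun M (V \<inter> fst c) F"
  proof (rule M.smooth_fun_cong[OF V'])
    show "smooth_fun M (V \<inter> fst c) (\<lambda>q. in_chart c F (snd c q))"
      using V(2) by (intro M.smooth_fun_compose[OF V' _ chart_image_open[OF c(1) W] _ smooth_funD[OF F c(1)]]
          smooth_fun_chart_map V' c(1)) auto
  qed (use c in auto)
  then show "\<exists>V. openin (Top M) V \<and> p \<in> V \<and> smooth_fun M V F" using V' p c by blast
qed

lemma vderiv_restrict:
  assumes p: "p \<in> points M" "p \<in> W" and W: "openin (Top N) W" and F: "smooth_fun N W F"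
    and c: "c \<in> charts_at N p"
  shows "vderiv M p u F = deriv_in c p (vderiv M p u (snd c)) F"
  unfolding vderiv_def
proof (rule M.deriv_in_compose)
  show V: "openin (Top M) (points M \<inter> (W \<inter> fst c))"
    using c by (intro openin_Int_restrict chart_Int_open W) auto
  show "smooth_fun M (points M \<inter> (W \<inter> fst c)) (snd c)"
    using c by (intro smooth_fun_chart_map V) auto
  show "F q = in_chart c F (snd c q)" if "q \<in> points M \<inter> (W \<inter> fst c)" for q using that c by simp
  show "(in_chart c F has_derivative (\<lambda>u. deriv_in c p u F)) (at (snd c p))"
    using c p by (intro in_chart_has_derivative[OF F]) auto
qed (use p c M.chart_at[OF p(1)] in auto)

lemma incl_apply: "c \<in> charts_at N p \<Longrightarrow> incl p u c = vderiv M p u (snd c)"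
  by (simp only: incl_def if_True)

lemma incl_tangent:
  assumes p: "p \<in> points M"
  shows "incl p u \<in> tangent_space N p"
  unfolding tangent_space_def mem_Collect_eq
proof (intro conjI ballI allI impI)
  fix c c' assume c: "c \<in> charts_at N p" "c' \<in> charts_at N p"
  show "incl p u c' = deriv_in c p (incl p u c) (snd c')"
    unfolding incl_apply[OF c(1)] incl_apply[OF c(2)]
    by (rule vderiv_restrict[OF p _ chart_open smooth_fun_chart c(1)]) (use c in auto)
qed (simp only: incl_def if_False)

lemma linear_incl:
  assumes p: "p \<in> points M"
  shows "linear (incl p)"
proof -
  have lin: "linear (\<lambda>u. vderiv M p u (snd c))" if "c \<in> charts_at N p" for c
    by (rule M.linear_vderiv[of "points M \<inter> fst c"])
      (use that p in \<open>auto intro!: openin_Int_chart smooth_fun_chart_map\<close>)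
  show ?thesis
  proof
    show "incl p (u + v) = incl p u + incl p v" for u v
      by (rule ext) (simp add: incl_def linear_add[OF lin] del: charts_at_iff)
    show "incl p (r *\<^sub>R u) = r *\<^sub>R incl p u" for r u
      by (rule ext) (simp add: incl_def linear_scale[OF lin] del: charts_at_iff)
  qed
qed

lemma incl_eq_0_iff:
  assumes p: "p \<in> points M" and u: "u \<in> tangent_space M p"
  shows "incl p u = 0 \<longleftrightarrow> u = 0"
proof -
  have "inj_on (incl p) (tangent_space M p)"
    using immersed p by (simp add: immersed_submanifold_def)
  then show ?thesis
    using u M.tangent_closed(5) linear_0[OF linear_incl[OF p]] by (metis inj_onD)
qed

lemma vderiv_incl:
  assumes p: "p \<in> points M" "p \<in> W" and W: "openin (Top N) W" and F: "smooth_fun N W F"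
  shows "vderiv M p u F = vderiv N p (incl p u) F"
proof -
  have c: "chart_at N p \<in> charts_at N p" using p points_subset by (intro chart_at) auto
  show ?thesis using vderiv_restrict[OF p W F c] incl_apply[OF c] by (simp only: vderiv_def)
qed

subsection \<open>Fields along the submanifold\<close>

text \<open>These are the smooth sections over \<open>V\<close> of the tangent bundle of
  \<open>N\<close> pulled back to \<open>M\<close>: the components refer to charts of
  \<open>N\<close>, but their smoothness is that of functions on \<open>M\<close>, so no extension
  to an open set of \<open>N\<close> is presupposed.\<close>

definition smooth_along :: "'a set \<Rightarrow> ('a, 'e) vfield \<Rightarrow> bool" where
  "smooth_along V Y \<longleftrightarrow> (\<forall>p\<in>V. Y p \<in> tangent_space N p) \<and>
     (\<forall>c\<in>Charts N. smooth_fun M (V \<inter> fst c) (\<lambda>q. Y q c))"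

lemma along_tangent: "smooth_along V Y \<Longrightarrow> p \<in> V \<Longrightarrow> Y p \<in> tangent_space N p"
  by (simp add: smooth_along_def)

lemma along_component: "smooth_along V Y \<Longrightarrow> c \<in> Charts N \<Longrightarrow> smooth_fun M (V \<inter> fst c) (\<lambda>q. Y q c)"
  by (simp add: smooth_along_def)

lemma along_coefficient:
  "openin (Top M) V \<Longrightarrow> smooth_along V Y \<Longrightarrow> c \<in> Charts N \<Longrightarrow> smooth_fun M (V \<inter> fst c) (\<lambda>q. Y q c \<bullet> i)"
  by (intro M.smooth_fun_inner_const openin_Int_chart along_component)

lemma along_subset: "smooth_along V Y \<Longrightarrow> W \<subseteq> V \<Longrightarrow> smooth_along W Y"
  unfolding smooth_along_def by (blast intro: M.smooth_fun_subset)

lemma along_local: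
  assumes "\<And>p. p \<in> V \<Longrightarrow> \<exists>W. openin (Top M) W \<and> p \<in> W \<and> smooth_along W Y"
  shows "smooth_along V Y"
  unfolding smooth_along_def
proof (intro conjI ballI)
  show "Y p \<in> tangent_space N p" if "p \<in> V" for p using assms[OF that] along_tangent by blast
  fix c assume c: "c \<in> Charts N"
  show "smooth_fun M (V \<inter> fst c) (\<lambda>q. Y q c)"
  proof (rule M.smooth_fun_local)
    fix p assume p: "p \<in> V \<inter> fst c"
    then obtain W where W: "openin (Top M) W" "p \<in> W" "smooth_along W Y" using assms by blast
    then show "\<exists>W. openin (Top M) W \<and> p \<in> W \<and> smooth_fun M W (\<lambda>q. Y q c)"
      using openin_Int_chart[OF W(1) c] along_component[OF W(3) c] p by blast
  qed
qed

lemma along_cong: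
  assumes "openin (Top M) V" "\<And>p. p \<in> V \<Longrightarrow> Y p = Z p" "smooth_along V Y"
  shows "smooth_along V Z"
  unfolding smooth_along_def
proof (intro conjI ballI)
  show "Z p \<in> tangent_space N p" if "p \<in> V" for p
    using along_tangent[OF assms(3) that] assms(2)[OF that] by simp
  show "smooth_fun M (V \<inter> fst c) (\<lambda>q. Z q c)" if "c \<in> Charts N" for c
    by (rule M.smooth_fun_cong[OF openin_Int_chart[OF assms(1) that] _ along_component[OF assms(3) that]])
      (simp add: assms(2))
qed

context
  fixes V assumes V: "openin (Top M) V"
begin

lemma along_zero: "smooth_along V (\<lambda>p. 0)"
  by (simp add: smooth_along_def tangent_closed M.smooth_fun_const)

lemma along_add: "smooth_along V Y \<Longrightarrow> smooth_along V Z \<Longrightarrow> smooth_along V (\<lambda>p. Y p + Z p)"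
  by (auto simp: smooth_along_def intro!: tangent_closed M.smooth_fun_add openin_Int_chart V)

lemma along_scaleR:
  assumes F: "smooth_fun M V F" and Y: "smooth_along V Y"
  shows "smooth_along V (\<lambda>p. F p *\<^sub>R Y p)"
  unfolding smooth_along_def
proof (intro conjI ballI)
  show "F p *\<^sub>R Y p \<in> tangent_space N p" if "p \<in> V" for p
    using along_tangent[OF Y that] by (rule tangent_closed)
  show "smooth_fun M (V \<inter> fst c) (\<lambda>q. (F q *\<^sub>R Y q) c)" if "c \<in> Charts N" for c
    unfolding scaleR_fun_def using that
    by (intro M.smooth_fun_scaleR openin_Int_chart V along_component[OF Y] M.smooth_fun_subset[OF F]) auto
qed

lemma along_diff: "smooth_along V Y \<Longrightarrow> smooth_along V Z \<Longrightarrow> smooth_along V (\<lambda>p. Y p - Z p)"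
  using along_add[of Y "\<lambda>p. (-1) *\<^sub>R Z p"] along_scaleR[OF M.smooth_fun_const, of Z "-1"] by simp

lemma along_sum:
  assumes "\<And>i. i \<in> I \<Longrightarrow> smooth_along V (Y i)"
  shows "smooth_along V (\<lambda>p. \<Sum>i\<in>I. Y i p)"
proof (cases "finite I")
  case True
  then show ?thesis using assms by (induction I) (simp_all add: along_zero along_add)
qed (simp add: along_zero)

lemma along_incl:
  assumes X: "smooth_vf M V X"
  shows "smooth_along V (\<lambda>p. incl p (X p))"
  unfolding smooth_along_def
proof (intro conjI ballI)
  show "incl p (X p) \<in> tangent_space N p" if "p \<in> V" for p
    using incl_tangent in_points[OF V that] by blast
  fix c assume c: "c \<in> Charts N"
  note W = openin_Int_chart[OF V c]
  show "smooth_fun M (V \<inter> fst c) (\<lambda>q. incl q (X q) c)"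
  proof (rule M.smooth_fun_cong[OF W])
    show "smooth_fun M (V \<inter> fst c) (\<lambda>q. vderiv M q (X q) (snd c))"
      using c by (intro M.smooth_fun_vderiv W M.smooth_vf_subset[OF X] smooth_fun_chart_map) auto
    show "vderiv M q (X q) (snd c) = incl q (X q) c" if "q \<in> V \<inter> fst c" for q
      using that c by (intro incl_apply[symmetric]) auto
  qed
qed

lemma along_restrict:
  assumes "smooth_vf N W E" "openin (Top N) W" "V \<subseteq> W"
  shows "smooth_along V E"
  unfolding smooth_along_def
proof (intro conjI ballI)
  show "E p \<in> tangent_space N p" if "p \<in> V" for p using smooth_vf_tangent assms that by blast
  show "smooth_fun M (V \<inter> fst c) (\<lambda>q. E q c)" if c: "c \<in> Charts N" for c
    by (rule smooth_fun_restrict[OF smooth_vf_component[OF assms(1,2) c]])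
      (use assms c V in \<open>auto intro: openin_Int_chart chart_Int_open\<close>)
qed

lemma along_frame:
  assumes "smooth_along V Y" "c \<in> Charts N" "p \<in> V" "p \<in> fst c"
  shows "Y p = (\<Sum>i\<in>Basis. (Y p c \<bullet> i) *\<^sub>R coord_vec N c p i)"
  using assms by (intro tangent_basis) (auto intro: along_tangent)

lemma along_coord:
  "c \<in> Charts N \<Longrightarrow> smooth_along (V \<inter> fst c) (\<lambda>q. coord_vec N c q a)"
  by (rule along_subset[where V = "V \<inter> fst c"], unfold smooth_along_def)
    (use coord_vec_tangent V in \<open>auto intro!: smooth_fun_restrict[OF smooth_vf_component[OF smooth_vf_coord chart_open]] openin_Int_chart chart_Int_open chart_open\<close>)

end

text \<open>The coefficients of a field along \<open>M\<close> with respect to the coordinate fields of \<open>N\<close> are smooth, so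
  smooth tensor fields of \<open>N\<close> can be applied to it.\<close>

lemma along_tensor_gen:
  fixes P :: "'a set \<Rightarrow> ('a \<Rightarrow> 'f::real_vector) \<Rightarrow> bool"
  assumes V: "openin (Top M) V" and Y: "smooth_along V Y"
    and lin: "\<And>p. p \<in> V \<Longrightarrow> linear_on_set (tangent_space N p) (T p)"
    and local: "\<And>F. (\<And>p. p \<in> V \<Longrightarrow> \<exists>W. openin (Top M) W \<and> p \<in> W \<and> P W F) \<Longrightarrow> P V F"
    and cong: "\<And>W F G. openin (Top M) W \<Longrightarrow> (\<And>p. p \<in> W \<Longrightarrow> F p = G p) \<Longrightarrow> P W F \<Longrightarrow> P W G"
    and sum: "\<And>W a F. openin (Top M) W \<Longrightarrow> W \<subseteq> V \<Longrightarrow> (\<And>i::'e. smooth_fun M W (a i)) \<Longrightarrow>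
      (\<And>i. P W (F i)) \<Longrightarrow> P W (\<lambda>p. \<Sum>i\<in>Basis. a i p *\<^sub>R F i p)"
    and coord: "\<And>c W i. c \<in> Charts N \<Longrightarrow> openin (Top M) W \<Longrightarrow> W \<subseteq> V \<Longrightarrow> W \<subseteq> fst c \<Longrightarrow>
      P W (\<lambda>p. T p (coord_vec N c p i))"
  shows "P V (\<lambda>p. T p (Y p))"
proof (rule local)
  fix p assume p: "p \<in> V"
  then obtain c where c: "c \<in> Charts N" "p \<in> fst c" using points_in_chart in_points_N[OF V] by blast
  note W = openin_Int_chart[OF V c(1)]
  have "P (V \<inter> fst c) (\<lambda>p. \<Sum>i\<in>Basis. (Y p c \<bullet> i) *\<^sub>R T p (coord_vec N c p i))"
    using c by (intro sum W along_coefficient V Y coord) auto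
  then have "P (V \<inter> fst c) (\<lambda>p. T p (Y p))"
  proof (rule cong[OF W, rotated])
    fix q assume q: "q \<in> V \<inter> fst c"
    have "T q (Y q) = T q (\<Sum>i\<in>Basis. (Y q c \<bullet> i) *\<^sub>R coord_vec N c q i)"
      using along_frame[OF V Y c(1)] q by simp
    also have "\<dots> = (\<Sum>i\<in>Basis. (Y q c \<bullet> i) *\<^sub>R T q (coord_vec N c q i))"
      using q c by (intro linear_on_set_sum[OF lin subspace_tangent] coord_vec_tangent) auto
    finally show "(\<Sum>i\<in>Basis. (Y q c \<bullet> i) *\<^sub>R T q (coord_vec N c q i)) = T q (Y q)" by simp
  qed
  then show "\<exists>W. openin (Top M) W \<and> p \<in> W \<and> P W (\<lambda>p. T p (Y p))" using W p c by blast
qed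

lemma along_tensor11:
  assumes V: "openin (Top M) V" and Y: "smooth_along V Y" and T: "tensor11 N T"
  shows "smooth_along V (\<lambda>p. T p (Y p))"
proof (rule along_tensor_gen[OF V Y, of T smooth_along])
  show "linear_on_set (tangent_space N p) (T p)" if "p \<in> V" for p
    using T in_points_N[OF V that] by (simp add: tensor11_def)
  show "smooth_along W (\<lambda>p. T p (coord_vec N c p i))"
    if "c \<in> Charts N" "openin (Top M) W" "W \<subseteq> V" "W \<subseteq> fst c" for c W i
  proof (rule along_restrict[OF that(2) _ chart_open[OF that(1)] that(4)])
    show "smooth_vf N (fst c) (\<lambda>p. T p (coord_vec N c p i))"
      using T chart_open[OF that(1)] smooth_vf_coord[OF that(1)] by (simp add: tensor11_def)
  qed
  show "smooth_along W (\<lambda>p. \<Sum>i\<in>Basis. a i p *\<^sub>R F i p)"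
    if "openin (Top M) W" "\<And>i. smooth_fun M W (a i)" "\<And>i. smooth_along W (F i)" for W a F
    using that by (intro along_sum along_scaleR)
qed (auto intro: along_local along_cong)

lemma smooth_fun_form_along:
  fixes T :: "'a \<Rightarrow> ('a, 'e) tvec \<Rightarrow> real"
  assumes V: "openin (Top M) V" and Y: "smooth_along V Y"
    and lin: "\<And>p. p \<in> V \<Longrightarrow> linear_on_set (tangent_space N p) (T p)"
    and coord: "\<And>c W i. c \<in> Charts N \<Longrightarrow> openin (Top M) W \<Longrightarrow> W \<subseteq> V \<Longrightarrow> W \<subseteq> fst c \<Longrightarrow>
      smooth_fun M W (\<lambda>p. T p (coord_vec N c p i))"
  shows "smooth_fun M V (\<lambda>p. T p (Y p))"
proof (rule along_tensor_gen[OF V Y, of T "smooth_fun M"])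
  show "smooth_fun M W (\<lambda>p. \<Sum>i\<in>Basis. a i p *\<^sub>R F i p)"
    if "openin (Top M) W" "\<And>i. smooth_fun M W (a i)" "\<And>i. smooth_fun M W (F i)"
    for W and a :: "'e \<Rightarrow> 'a \<Rightarrow> real" and F :: "'e \<Rightarrow> 'a \<Rightarrow> real"
    using that by (intro M.smooth_fun_sum M.smooth_fun_scaleR)
qed (use lin coord in \<open>auto intro: M.smooth_fun_local M.smooth_fun_cong\<close>)

lemma smooth_fun_one_form_along:
  assumes V: "openin (Top M) V" and Y: "smooth_along V Y" and T: "one_form N T"
  shows "smooth_fun M V (\<lambda>p. T p (Y p))"
proof (rule smooth_fun_form_along[OF V Y])
  show "linear_on_set (tangent_space N p) (T p)" if "p \<in> V" for p
    using T in_points_N[OF V that] by (simp add: one_form_def)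
  show "smooth_fun M W (\<lambda>p. T p (coord_vec N c p i))"
    if "c \<in> Charts N" "openin (Top M) W" "W \<subseteq> V" "W \<subseteq> fst c" for c W i
    using T smooth_vf_coord[OF that(1)] chart_open[OF that(1)]
    by (intro smooth_fun_restrict[OF _ chart_open[OF that(1)] that(2,4)]) (simp add: one_form_def)
qed

lemma smooth_fun_metric_along:
  assumes V: "openin (Top M) V" and Y: "smooth_along V Y" and Z: "smooth_along V Z"
  shows "smooth_fun M V (\<lambda>p. g p (Y p) (Z p))"
proof (rule smooth_fun_form_along[OF V Z])
  show "linear_on_set (tangent_space N p) (g p (Y p))" if "p \<in> V" for p
    using g_linear in_points_N[OF V that] along_tangent[OF Y that] by blast
  fix c W i assume c: "c \<in> Charts N" and W: "openin (Top M) W" "W \<subseteq> V" "W \<subseteq> fst c"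
  show "smooth_fun M W (\<lambda>p. g p (Y p) (coord_vec N c p i))"
  proof (rule smooth_fun_form_along[OF W(1) along_subset[OF Y W(2)]])
    show "linear_on_set (tangent_space N p) (\<lambda>u. g p u (coord_vec N c p i))" if "p \<in> W" for p
      using that W c in_points_N[OF W(1) that] by (intro g_linear_left coord_vec_tangent) auto
    fix c' W' j assume c': "c' \<in> Charts N" and W': "openin (Top M) W'" "W' \<subseteq> W" "W' \<subseteq> fst c'"
    \<comment> \<open>The charts chosen for the two arguments may differ; the smoothness of the
      metric is used on their overlap, where both coordinate fields are smooth.\<close>
    have O: "openin (Top N) (fst c' \<inter> fst c)" by (rule chart_Int_open[OF c chart_open[OF c']])
    show "smooth_fun M W' (\<lambda>p. g p (coord_vec N c' p j) (coord_vec N c p i))"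
      by (rule smooth_fun_restrict[OF g_smooth[OF O smooth_vf_subset[OF smooth_vf_coord[OF c']]
              smooth_vf_subset[OF smooth_vf_coord[OF c]]] O W'(1)]) (use W W' in auto)
  qed
qed

subsection \<open>Covariant derivatives of fields along the submanifold\<close>

lemma nab_along_cong:
  assumes "openin (Top M) V" "p \<in> V" "\<And>q. q \<in> V \<Longrightarrow> Y q = Z q"
  shows "nab_along p u Y = nab_along p u Z"
proof -
  have "vderiv M p u (\<lambda>q. Y q c) = vderiv M p u (\<lambda>q. Z q c)" for c
    by (rule M.vderiv_cong[OF assms(1,2)]) (simp add: assms(3))
  then show ?thesis by (simp only: nab_along_def assms(3)[OF assms(2)])
qed

text \<open>The formula is first available only in the chosen chart at \<open>p\<close>. Additivity,
  the Leibniz rule and agreement with \<open>nab\<close> on fields of \<open>N\<close> are proved in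
  this chart; independence of the chart then follows from these rules.\<close>

lemma nab_along_chart_at:
  assumes p: "p \<in> points M"
  shows "nab_along p u Y = coord_vec N (chart_at N p) p (vderiv M p u (\<lambda>q. Y q (chart_at N p))) +
    (\<Sum>i\<in>Basis. (Y p (chart_at N p) \<bullet> i) *\<^sub>R nab p (incl p u) (\<lambda>q. coord_vec N (chart_at N p) q i))"
proof -
  have c: "chart_at N p \<in> Charts N" "p \<in> fst (chart_at N p)"
    using chart_at[of p] p points_subset by auto
  show ?thesis unfolding nab_along_def Let_def
    by (simp only: nab_coord_vec[OF c incl_tangent[OF p], of u "Y p (chart_at N p)"])
qed

lemma nab_along_zero:
  assumes p: "p \<in> points M" shows "nab_along p u (\<lambda>q. 0) = 0"
proof -
  have "chart_at N p \<in> charts_at N p" using p points_subset chart_at by blast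
  then show ?thesis unfolding nab_along_chart_at[OF p]
    unfolding zero_fun_apply[of "chart_at N p"]
    by (simp only: M.vderiv_const linear_0[OF linear_coord_vec] inner_zero_left scaleR_zero_left
        sum.neutral_const add_0)
qed

context
  fixes V p assumes V: "openin (Top M) V" "p \<in> V"
begin

lemma chart_at_N: "chart_at N p \<in> charts_at N p" "chart_at N p \<in> Charts N" "p \<in> fst (chart_at N p)"
  using chart_at[of p] in_points_N[OF V] by auto

lemma chart_at_nhds: "openin (Top M) (V \<inter> fst (chart_at N p))" "p \<in> V \<inter> fst (chart_at N p)"
  using openin_Int_chart[OF V(1) chart_at_N(2)] V(2) chart_at_N(3) by auto

lemma nab_along_add:
  assumes Y: "smooth_along V Y" and Z: "smooth_along V Z"
  shows "nab_along p u (\<lambda>q. Y q + Z q) = nab_along p u Y + nab_along p u Z"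
proof -
  let ?c = "chart_at N p"
  have "vderiv M p u (\<lambda>q. (Y q + Z q) ?c) = vderiv M p u (\<lambda>q. Y q ?c) + vderiv M p u (\<lambda>q. Z q ?c)"
    using M.vderiv_add[OF chart_at_nhds along_component[OF Y chart_at_N(2)] along_component[OF Z chart_at_N(2)]]
    by simp
  then show ?thesis unfolding nab_along_chart_at[OF in_points[OF V]]
    by (simp only: plus_fun_apply linear_add[OF linear_coord_vec[OF chart_at_N(1)]] inner_add_left scaleR_add_left
        sum.distrib add_ac)
qed

lemma nab_along_scaleR:
  assumes F: "smooth_fun M V F" and Y: "smooth_along V Y"
  shows "nab_along p u (\<lambda>q. F q *\<^sub>R Y q) = vderiv M p u F *\<^sub>R Y p + F p *\<^sub>R nab_along p u Y"
proof -
  let ?c = "chart_at N p"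
  have "vderiv M p u (\<lambda>q. (F q *\<^sub>R Y q) ?c) = F p *\<^sub>R vderiv M p u (\<lambda>q. Y q ?c) + vderiv M p u F *\<^sub>R Y p ?c"
    using M.vderiv_scaleR[OF chart_at_nhds M.smooth_fun_subset[OF F Int_lower1] along_component[OF Y chart_at_N(2)]]
    by simp
  moreover have "coord_vec N ?c p (Y p ?c) = Y p"
    using tangent_eq_coord_vec[OF along_tangent[OF Y V(2)] chart_at_N(1)] by simp
  ultimately show ?thesis unfolding nab_along_chart_at[OF in_points[OF V]]
    by (simp only: scaleR_fun_apply linear_add[OF linear_coord_vec[OF chart_at_N(1)]]
        linear_scale[OF linear_coord_vec[OF chart_at_N(1)]] inner_scaleR_left scaleR_add_right scaleR_sum_right
        scaleR_scaleR add_ac)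
qed

lemma nab_along_sum:
  assumes "finite I" "\<And>i. i \<in> I \<Longrightarrow> smooth_fun M V (F i)" "\<And>i. i \<in> I \<Longrightarrow> smooth_along V (Y i)"
  shows "nab_along p u (\<lambda>q. \<Sum>i\<in>I. F i q *\<^sub>R Y i q) =
    (\<Sum>i\<in>I. vderiv M p u (F i) *\<^sub>R Y i p + F i p *\<^sub>R nab_along p u (Y i))"
  using assms
proof (induction I)
  case empty
  show ?case unfolding sum.empty by (rule nab_along_zero[OF in_points[OF V]])
next
  case (insert i I)
  have "smooth_along V (\<lambda>q. F i q *\<^sub>R Y i q)" "smooth_along V (\<lambda>q. \<Sum>i\<in>I. F i q *\<^sub>R Y i q)"
    using insert.prems by (auto intro!: along_sum along_scaleR V)
  note add = nab_along_add[OF this]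
  have scale: "nab_along p u (\<lambda>q. F i q *\<^sub>R Y i q) = vderiv M p u (F i) *\<^sub>R Y i p + F i p *\<^sub>R nab_along p u (Y i)"
    using insert.prems by (intro nab_along_scaleR) auto
  have IH: "nab_along p u (\<lambda>q. \<Sum>i\<in>I. F i q *\<^sub>R Y i q) =
      (\<Sum>i\<in>I. vderiv M p u (F i) *\<^sub>R Y i p + F i p *\<^sub>R nab_along p u (Y i))"
    using insert.prems by (intro insert.IH) auto
  show ?case unfolding sum.insert[OF insert.hyps] add scale IH by (rule refl)
qed

end

text \<open>Both sides expand over the coordinate fields of the chosen chart, and the coefficients
  have the same derivatives along \<open>u\<close> and along \<open>incl p u\<close>.\<close>

lemma nab_along_restrict:
  assumes p: "p \<in> points M" "p \<in> W" and W: "openin (Top N) W" and E: "smooth_vf N W E"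
  shows "nab_along p u E = nab p (incl p u) E"
proof -
  let ?c = "chart_at N p" and ?w = "incl p u"
  let ?O = "W \<inter> fst ?c"
  have c: "?c \<in> charts_at N p" "?c \<in> Charts N" "p \<in> fst ?c"
    using chart_at[of p] p points_subset by auto
  have O: "openin (Top N) ?O" "p \<in> ?O" using chart_Int_open[OF c(2) W] p c by auto
  have w: "?w \<in> tangent_space N p" by (rule incl_tangent[OF p(1)])
  note comp = smooth_vf_component[OF E W c(2)]
  have inner: "vderiv N p ?w (\<lambda>q. E q ?c \<bullet> i) = vderiv M p u (\<lambda>q. E q ?c) \<bullet> i" for i
    using vderiv_bounded_linear[OF O bounded_linear_inner_left comp, of ?w i]
      vderiv_incl[OF p(1) O(2,1) comp, of u] by simp
  have coord: "smooth_vf N ?O (\<lambda>q. coord_vec N ?c q i)" for i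
    by (rule smooth_vf_subset[OF smooth_vf_coord[OF c(2)]]) auto
  have "nab p ?w E = nab p ?w (\<lambda>q. \<Sum>i\<in>Basis. (E q ?c \<bullet> i) *\<^sub>R coord_vec N ?c q i)"
  proof (rule nab_cong[OF O smooth_vf_subset[OF E Int_lower1] w, symmetric])
    fix q assume q: "q \<in> ?O"
    show "(\<Sum>i\<in>Basis. (E q ?c \<bullet> i) *\<^sub>R coord_vec N ?c q i) = E q"
      by (rule tangent_basis[symmetric]) (use q c smooth_vf_tangent[OF E] in auto)
  qed
  also have "\<dots> = (\<Sum>i\<in>Basis. (vderiv M p u (\<lambda>q. E q ?c) \<bullet> i) *\<^sub>R coord_vec N ?c p i +
      (E p ?c \<bullet> i) *\<^sub>R nab p ?w (\<lambda>q. coord_vec N ?c q i))"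
    unfolding inner[symmetric]
    by (rule nab_sum[OF O w finite_Basis smooth_fun_inner_const[OF O(1) comp] coord])
  also have "\<dots> = nab_along p u E"
    unfolding nab_along_chart_at[OF p(1)] sum.distrib
    by (simp only: linear_euclidean_sum[OF linear_coord_vec[OF c(1)], symmetric])
  finally show ?thesis by (rule sym)
qed

context
  fixes V p Y c
  assumes V: "openin (Top M) V" "p \<in> V" and Y: "smooth_along V Y"
    and c: "c \<in> Charts N" "p \<in> fst c"
begin

lemma vderiv_coefficient: "vderiv M p u (\<lambda>q. Y q c \<bullet> i) = vderiv M p u (\<lambda>q. Y q c) \<bullet> i"
  by (rule M.vderiv_bounded_linear[OF openin_Int_chart[OF V(1) c(1)] _ bounded_linear_inner_left
        along_component[OF Y c(1)]]) (use V c in auto)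

text \<open>This holds in an arbitrary chart \<open>c\<close>: the Leibniz rule is applied to the
  expansion of \<open>Y\<close> in the coordinate fields of \<open>c\<close>, which are themselves
  fields of \<open>N\<close>. It is the chart independence of \<open>nab_along\<close>.\<close>

lemma nab_along_frame:
  "nab_along p u Y = (\<Sum>i\<in>Basis. vderiv M p u (\<lambda>q. Y q c \<bullet> i) *\<^sub>R coord_vec N c p i +
    (Y p c \<bullet> i) *\<^sub>R nab p (incl p u) (\<lambda>q. coord_vec N c q i))"
proof -
  let ?W = "V \<inter> fst c"
  have W: "openin (Top M) ?W" "p \<in> ?W" using openin_Int_chart[OF V(1) c(1)] V c by auto
  have "nab_along p u Y = nab_along p u (\<lambda>q. \<Sum>i\<in>Basis. (Y q c \<bullet> i) *\<^sub>R coord_vec N c q i)"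
    by (rule nab_along_cong[OF W], rule along_frame[OF V(1) Y c(1)]) auto
  also have "\<dots> = (\<Sum>i\<in>Basis. vderiv M p u (\<lambda>q. Y q c \<bullet> i) *\<^sub>R coord_vec N c p i +
    (Y p c \<bullet> i) *\<^sub>R nab_along p u (\<lambda>q. coord_vec N c q i))"
    by (rule nab_along_sum[OF W finite_Basis along_coefficient[OF V(1) Y c(1)] along_coord[OF V(1) c(1)]])
  finally show ?thesis
    unfolding nab_along_restrict[OF in_points[OF V] c(2) chart_open[OF c(1)] smooth_vf_coord[OF c(1)]] .
qed

lemma nab_along_chart:
  "nab_along p u Y = coord_vec N c p (vderiv M p u (\<lambda>q. Y q c)) +
    (\<Sum>i\<in>Basis. (Y p c \<bullet> i) *\<^sub>R nab p (incl p u) (\<lambda>q. coord_vec N c q i))"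
proof -
  have "c \<in> charts_at N p" using c by simp
  then show ?thesis unfolding nab_along_frame sum.distrib vderiv_coefficient
    by (simp only: linear_euclidean_sum[OF linear_coord_vec, symmetric])
qed

end

context
  fixes V p Y
  assumes V: "openin (Top M) V" "p \<in> V" and Y: "smooth_along V Y"
begin

lemma nab_along_tangent: "nab_along p u Y \<in> tangent_space N p"
proof -
  obtain c where c: "c \<in> Charts N" "p \<in> fst c" using points_in_chart in_points_N[OF V] by blast
  show ?thesis unfolding nab_along_chart[OF V Y c]
    by (intro tangent_closed coord_vec_tangent nab_tangent[OF chart_open[OF c(1)] c(2) smooth_vf_coord[OF c(1)]]
        incl_tangent in_points[OF V]) (use c in auto)
qed

lemma nab_along_linear: "linear (\<lambda>u. nab_along p u Y)"
proof -
  obtain c where c: "c \<in> Charts N" "p \<in> fst c" using points_in_chart in_points_N[OF V] by blast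
  note p = in_points[OF V]
  have cc: "c \<in> charts_at N p" using c by simp
  have W: "openin (Top M) (V \<inter> fst c)" "p \<in> V \<inter> fst c" using openin_Int_chart[OF V(1) c(1)] V c by auto
  note lv = M.linear_vderiv[OF W along_component[OF Y c(1)]]
  have "linear (\<lambda>u. nab p (incl p u) (\<lambda>q. coord_vec N c q i))" for i
  proof -
    note ln = nab_linear[OF chart_open[OF c(1)] c(2) smooth_vf_coord[OF c(1)], of i]
    show ?thesis
      by (rule linearI)
        (simp_all only: linear_add[OF linear_incl[OF p]] linear_scale[OF linear_incl[OF p]]
          linear_on_set_add[OF ln incl_tangent[OF p] incl_tangent[OF p]] linear_on_set_scale[OF ln incl_tangent[OF p]])
  qed
  then show ?thesis unfolding nab_along_chart[OF V Y c]
    by (intro linear_compose_add linear_compose_sum ballI linear_compose_scale_right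
        linear_compose[OF lv linear_coord_vec[OF cc], unfolded o_def])
qed

end

text \<open>The map from \<open>Y\<close> to its derivative is not tensorial, so
  \<open>along_tensor_gen\<close> does not apply. The direction is expanded in coordinate fields as
  well, until only smooth coefficients and derivatives of coordinate fields of \<open>N\<close>
  along one another remain.\<close>

lemma along_nab_along:
  assumes V: "openin (Top M) V" and X: "smooth_vf M V X" and Y: "smooth_along V Y"
  shows "smooth_along V (\<lambda>p. nab_along p (X p) Y)"
proof (rule along_local)
  fix p assume p: "p \<in> V"
  then obtain c where c: "c \<in> Charts N" "p \<in> fst c" using points_in_chart in_points_N[OF V] by blast
  let ?W = "V \<inter> fst c"
  note W = openin_Int_chart[OF V c(1)]
  have XW: "smooth_vf M ?W X" by (rule M.smooth_vf_subset[OF X]) auto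
  have nabs: "smooth_along ?W (\<lambda>q. nab q (coord_vec N c q j) (\<lambda>q. coord_vec N c q i))" for i j
    by (rule along_restrict[OF W nab_smooth[OF chart_open[OF c(1)] smooth_vf_coord[OF c(1)] smooth_vf_coord[OF c(1)]]
          chart_open[OF c(1)]]) auto
  have "smooth_along ?W (\<lambda>q. \<Sum>i\<in>Basis. vderiv M q (X q) (\<lambda>q. Y q c \<bullet> i) *\<^sub>R coord_vec N c q i +
      (Y q c \<bullet> i) *\<^sub>R (\<Sum>j\<in>Basis. (incl q (X q) c \<bullet> j) *\<^sub>R nab q (coord_vec N c q j) (\<lambda>q. coord_vec N c q i)))"
    by (intro along_sum along_add along_scaleR W M.smooth_fun_vderiv XW along_coefficient[OF V Y c(1)]
        along_coord[OF V c(1)] along_coefficient[OF V along_incl[OF V X] c(1)] nabs)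
  then have "smooth_along ?W (\<lambda>p. nab_along p (X p) Y)"
  proof (rule along_cong[OF W, rotated])
    fix q assume q: "q \<in> ?W"
    then have qV: "q \<in> V" and qc: "q \<in> fst c" and cq: "c \<in> charts_at N q" using c by auto
    have w: "incl q (X q) \<in> tangent_space N q" by (rule incl_tangent[OF in_points[OF V qV]])
    have "nab q (incl q (X q)) (\<lambda>q. coord_vec N c q i) =
        (\<Sum>j\<in>Basis. (incl q (X q) c \<bullet> j) *\<^sub>R nab q (coord_vec N c q j) (\<lambda>q. coord_vec N c q i))" for i
    proof -
      have "nab q (incl q (X q)) (\<lambda>q. coord_vec N c q i) =
          nab q (\<Sum>j\<in>Basis. (incl q (X q) c \<bullet> j) *\<^sub>R coord_vec N c q j) (\<lambda>q. coord_vec N c q i)"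
        using tangent_basis[OF w cq] by (rule arg_cong)
      also have "\<dots> = (\<Sum>j\<in>Basis. (incl q (X q) c \<bullet> j) *\<^sub>R nab q (coord_vec N c q j) (\<lambda>q. coord_vec N c q i))"
        by (rule linear_on_set_sum[OF nab_linear[OF chart_open[OF c(1)] qc smooth_vf_coord[OF c(1)]]
              subspace_tangent coord_vec_tangent[OF cq]])
      finally show ?thesis .
    qed
    then show "(\<Sum>i\<in>Basis. vderiv M q (X q) (\<lambda>q. Y q c \<bullet> i) *\<^sub>R coord_vec N c q i +
      (Y q c \<bullet> i) *\<^sub>R (\<Sum>j\<in>Basis. (incl q (X q) c \<bullet> j) *\<^sub>R nab q (coord_vec N c q j) (\<lambda>q. coord_vec N c q i))) =
      nab_along q (X q) Y"
      by (simp only: nab_along_frame[OF V qV Y c(1) qc])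
  qed
  then show "\<exists>W. openin (Top M) W \<and> p \<in> W \<and> smooth_along W (\<lambda>p. nab_along p (X p) Y)"
    using W p c by blast
qed

text \<open>In the chart formula for \<open>nab_along\<close>, the derivatives of the components of \<open>X\<close> and \<open>Y\<close> give the
  bracket, and the remaining terms are symmetric because coordinate fields commute.\<close>

lemma nab_along_torsion_free:
  assumes V: "openin (Top M) V" "p \<in> V" and X: "smooth_vf M V X" and Y: "smooth_vf M V Y"
  shows "nab_along p (X p) (\<lambda>q. incl q (Y q)) - nab_along p (Y p) (\<lambda>q. incl q (X q)) = incl p (bracket M X Y p)"
proof -
  obtain c where c: "c \<in> Charts N" "p \<in> fst c" using points_in_chart in_points_N[OF V] by blast
  have cc: "c \<in> charts_at N p" using c by simp
  let ?W = "V \<inter> fst c" and ?E = "\<lambda>i q. coord_vec N c q i"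
  have W: "openin (Top M) ?W" "p \<in> ?W" using openin_Int_chart[OF V(1) c(1)] V c by auto
  have sub: "?W \<subseteq> V" by auto
  note p = in_points[OF V]
  \<comment> \<open>Components of an included field are derivatives of the chart map of
    \<open>N\<close>. The difference of the differentiated components is therefore a commutator of
    second derivatives of \<open>snd c\<close>, to which \<open>vderiv_bracket\<close>
    applies.\<close>
  have comp: "vderiv M p v (\<lambda>q. incl q (Z q) c) = vderiv M p v (\<lambda>q. vderiv M q (Z q) (snd c))" for v Z
    by (rule M.vderiv_cong[OF W], rule incl_apply) (use c in auto)
  have nab_incl: "nab p (incl p u) (?E i) = (\<Sum>j\<in>Basis. (incl p u c \<bullet> j) *\<^sub>R nab p (?E j p) (?E i))" for u i
  proof -
    have "nab p (incl p u) (?E i) = nab p (\<Sum>j\<in>Basis. (incl p u c \<bullet> j) *\<^sub>R ?E j p) (?E i)"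
      using tangent_basis[OF incl_tangent[OF p] cc] by (rule arg_cong)
    also have "\<dots> = (\<Sum>j\<in>Basis. (incl p u c \<bullet> j) *\<^sub>R nab p (?E j p) (?E i))"
      by (rule linear_on_set_sum[OF nab_linear[OF chart_open[OF c(1)] c(2) smooth_vf_coord[OF c(1)]]
            subspace_tangent coord_vec_tangent[OF cc]])
    finally show ?thesis .
  qed
  define S where "S u v = (\<Sum>i\<in>Basis. (incl p v c \<bullet> i) *\<^sub>R nab p (incl p u) (?E i))" for u v
  have "S (X p) (Y p) = (\<Sum>i\<in>Basis. \<Sum>j\<in>Basis. ((incl p (Y p) c \<bullet> i) * (incl p (X p) c \<bullet> j)) *\<^sub>R nab p (?E j p) (?E i))"
    unfolding S_def nab_incl by (simp only: scaleR_sum_right scaleR_scaleR)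
  also have "\<dots> = (\<Sum>j\<in>Basis. \<Sum>i\<in>Basis. ((incl p (Y p) c \<bullet> i) * (incl p (X p) c \<bullet> j)) *\<^sub>R nab p (?E i p) (?E j))"
    by (rule trans[OF sum.swap]) (intro sum.cong refl arg_cong2[where f = scaleR] nab_coord_commute[OF c])
  also have "\<dots> = S (Y p) (X p)"
    unfolding S_def nab_incl by (simp only: scaleR_sum_right scaleR_scaleR mult.commute)
  finally have S: "S (X p) (Y p) = S (Y p) (X p)" .
  have "nab_along p (X p) (\<lambda>q. incl q (Y q)) - nab_along p (Y p) (\<lambda>q. incl q (X q)) =
      coord_vec N c p (vderiv M p (X p) (\<lambda>q. vderiv M q (Y q) (snd c))) -
      coord_vec N c p (vderiv M p (Y p) (\<lambda>q. vderiv M q (X q) (snd c)))"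
    unfolding nab_along_chart[OF V along_incl[OF V(1) X] c] nab_along_chart[OF V along_incl[OF V(1) Y] c] comp
      S_def[symmetric] S by (rule add_diff_cancel_right)
  also have "\<dots> = coord_vec N c p (vderiv M p (bracket M X Y p) (snd c))"
    unfolding linear_diff[OF linear_coord_vec[OF cc], symmetric]
      M.vderiv_bracket[OF W M.smooth_vf_subset[OF X sub] M.smooth_vf_subset[OF Y sub]
        smooth_fun_chart_map[OF W(1) c(1) Int_lower2]] by (rule refl)
  also have "\<dots> = incl p (bracket M X Y p)"
    unfolding incl_apply[OF cc, symmetric] by (rule tangent_eq_coord_vec[OF incl_tangent[OF p] cc, symmetric])
  finally show ?thesis .
qed

subsection \<open>Tangential and normal parts\<close>

text \<open>The Gram matrix of the coordinate fields of \<open>b\<close>, read as a linear map of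
  the coordinate space into itself; this is the form in which a linear system with smooth
  coefficients is solved.\<close>

definition gram :: "('a, 'd) chart \<Rightarrow> 'a \<Rightarrow> 'd \<Rightarrow> 'd" where
  "gram b p a = (\<Sum>j\<in>Basis. g p (incl p (coord_vec M b p a)) (incl p (coord_vec M b p j)) *\<^sub>R j)"

context
  fixes p assumes p: "p \<in> points M"
begin

lemma p_N: "p \<in> points N" using p points_subset by blast

lemma g_incl_pos: "u \<in> tangent_space M p \<Longrightarrow> u \<noteq> 0 \<Longrightarrow> g p (incl p u) (incl p u) > 0"
  using g_pos[OF p_N incl_tangent[OF p]] incl_eq_0_iff[OF p] by blast

text \<open>Uniqueness: the difference of two candidates includes to a vector orthogonal to itself,
  so it is 0 because the metric is positive and the inclusion immersive.\<close>

lemma tan_part_eqI: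
  assumes w: "w \<in> tangent_space N p" and v: "v \<in> tangent_space M p"
    and orth: "\<And>u. u \<in> tangent_space M p \<Longrightarrow> g p (w - incl p v) (incl p u) = 0"
  shows "tan_part p w = v"
  unfolding tan_part_def
proof (rule the_equality)
  fix v' assume v': "v' \<in> tangent_space M p \<and> (\<forall>u\<in>tangent_space M p. g p (w - incl p v') (incl p u) = 0)"
  let ?d = "v - v'"
  have d: "?d \<in> tangent_space M p" using v v' M.tangent_closed by blast
  note gl = g_linear_left[OF p_N incl_tangent[OF p, of ?d]]
  have "incl p ?d = (w - incl p v') - (w - incl p v)"
    unfolding linear_diff[OF linear_incl[OF p]] by (rule ext) simp
  then have "g p (incl p ?d) (incl p ?d) = g p (w - incl p v') (incl p ?d) - g p (w - incl p v) (incl p ?d)"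
    using linear_on_set_diff[OF gl subspace_tangent tangent_closed(2)[OF w incl_tangent[OF p]]
        tangent_closed(2)[OF w incl_tangent[OF p]]] by metis
  also have "\<dots> = 0" using orth d v' by simp
  finally have "?d = 0" using g_incl_pos[OF d] by auto
  then show "v' = v" by simp
qed (use v orth in blast)

context
  fixes b assumes b: "b \<in> Charts M" "p \<in> fst b"
begin

lemma linear_incl_coord: "linear (\<lambda>a. incl p (coord_vec M b p a))"
  using linear_compose[OF M.linear_coord_vec linear_incl[OF p], of b] b by (simp add: o_def)

lemma linear_gram: "linear (gram b p)"
proof -
  have "linear (\<lambda>a. g p (incl p (coord_vec M b p a)) w)" if w: "w \<in> tangent_space N p" for w
    by (rule linearI)
      (simp_all only: linear_add[OF linear_incl_coord] linear_scale[OF linear_incl_coord]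
        linear_on_set_add[OF g_linear_left[OF p_N w] incl_tangent[OF p] incl_tangent[OF p]]
        linear_on_set_scale[OF g_linear_left[OF p_N w] incl_tangent[OF p]])
  then have "linear (\<lambda>a. g p (incl p (coord_vec M b p a)) w *\<^sub>R j)" if "w \<in> tangent_space N p" for w and j :: 'd
    using linear_compose[OF _ bounded_linear.linear[OF bounded_linear_scaleR_left[of j]]] that by (force simp: o_def)
  then show ?thesis unfolding gram_def
    by (intro linear_compose_sum ballI) (use incl_tangent[OF p] in auto)
qed

text \<open>This turns the Gram system, which tests coordinate vectors only, into orthogonality
  against all vectors tangent to \<open>M\<close>.\<close>

lemma sum_g_basis:
  assumes w: "w \<in> tangent_space N p" and u: "u \<in> tangent_space M p"
  shows "(\<Sum>j\<in>Basis. g p w (incl p (coord_vec M b p j)) *\<^sub>R j) \<bullet> u b = g p w (incl p u)"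
proof -
  have "u = (\<Sum>j\<in>Basis. (u b \<bullet> j) *\<^sub>R coord_vec M b p j)" using M.tangent_basis[OF u] b by simp
  then have "g p w (incl p u) = g p w (incl p (\<Sum>j\<in>Basis. (u b \<bullet> j) *\<^sub>R coord_vec M b p j))"
    by (rule arg_cong)
  also have "\<dots> = g p w (\<Sum>j\<in>Basis. (u b \<bullet> j) *\<^sub>R incl p (coord_vec M b p j))"
    by (simp only: linear_sum[OF linear_incl[OF p]] linear_scale[OF linear_incl[OF p]])
  also have "\<dots> = (\<Sum>j\<in>Basis. (u b \<bullet> j) *\<^sub>R g p w (incl p (coord_vec M b p j)))"
    by (rule linear_on_set_sum[OF g_linear[OF p_N w] subspace_tangent incl_tangent[OF p]])
  finally show ?thesis by (simp add: inner_sum_left inner_commute[of "u b"] mult.commute)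
qed

lemma inj_gram: "inj (gram b p)"
  unfolding linear_injective_0[OF linear_gram]
proof (intro allI impI)
  fix a assume a: "gram b p a = 0"
  have u: "coord_vec M b p a \<in> tangent_space M p" using M.coord_vec_tangent b by simp
  have "g p (incl p (coord_vec M b p a)) (incl p (coord_vec M b p a)) = gram b p a \<bullet> coord_vec M b p a b"
    unfolding gram_def by (rule sum_g_basis[OF incl_tangent[OF p] u, symmetric])
  then have "coord_vec M b p a = 0" using g_incl_pos[OF u] a by auto
  then have "coord_vec M b p a b = 0" by simp
  then show "a = 0" using b by simp
qed

lemma tan_part_coord:
  assumes w: "w \<in> tangent_space N p"
    and a: "gram b p a = (\<Sum>j\<in>Basis. g p w (incl p (coord_vec M b p j)) *\<^sub>R j)"
  shows "tan_part p w = coord_vec M b p a"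
proof (rule tan_part_eqI[OF w])
  show v: "coord_vec M b p a \<in> tangent_space M p" using M.coord_vec_tangent b by simp
  fix u assume u: "u \<in> tangent_space M p"
  have "g p (incl p (coord_vec M b p a)) (incl p u) = g p w (incl p u)"
    using sum_g_basis[OF incl_tangent[OF p] u, of "coord_vec M b p a"] sum_g_basis[OF w u] a
    unfolding gram_def by simp
  then show "g p (w - incl p (coord_vec M b p a)) (incl p u) = 0"
    using linear_on_set_diff[OF g_linear_left[OF p_N incl_tangent[OF p]] subspace_tangent w incl_tangent[OF p]]
    by simp
qed

text \<open>Existence of the tangential part, on which the definite description rests: an injective
  linear map of a finite-dimensional space into itself is surjective, so the Gram system has a
  solution.\<close>

lemma gram_tan_part:
  assumes w: "w \<in> tangent_space N p"
  shows "gram b p (tan_part p w b) = (\<Sum>j\<in>Basis. g p w (incl p (coord_vec M b p j)) *\<^sub>R j)"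
    and "tan_part p w \<in> tangent_space M p"
    and "u \<in> tangent_space M p \<Longrightarrow> g p (w - incl p (tan_part p w)) (incl p u) = 0"
proof -
  have "surj (gram b p)" by (rule linear_injective_imp_surjective[OF linear_gram inj_gram refl])
  then obtain a where "(\<Sum>j\<in>Basis. g p w (incl p (coord_vec M b p j)) *\<^sub>R j) = gram b p a"
    by (rule surjE)
  note a = this[symmetric]
  note tan = tan_part_coord[OF w a]
  have tan_b: "tan_part p w b = a" using b by (simp add: tan)
  then show eq: "gram b p (tan_part p w b) = (\<Sum>j\<in>Basis. g p w (incl p (coord_vec M b p j)) *\<^sub>R j)"
    using a by simp
  show T: "tan_part p w \<in> tangent_space M p" using M.coord_vec_tangent b by (simp add: tan)
  show "g p (w - incl p (tan_part p w)) (incl p u) = 0" if u: "u \<in> tangent_space M p"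
  proof -
    have "g p (incl p (tan_part p w)) (incl p u) = g p w (incl p u)"
      using sum_g_basis[OF incl_tangent[OF p] u, of "tan_part p w"] sum_g_basis[OF w u] a
      unfolding gram_def tan by simp
    then show ?thesis
      using linear_on_set_diff[OF g_linear_left[OF p_N incl_tangent[OF p]] subspace_tangent w incl_tangent[OF p]]
      by simp
  qed
qed

end

lemma tan_part_tangent:
  assumes "w \<in> tangent_space N p" shows "tan_part p w \<in> tangent_space M p"
proof -
  obtain b where "b \<in> Charts M" "p \<in> fst b" using M.points_in_chart[OF p] by blast
  then show ?thesis using assms by (rule gram_tan_part(2))
qed

lemma tan_part_orthogonal:
  assumes "w \<in> tangent_space N p" "u \<in> tangent_space M p"
  shows "g p (w - incl p (tan_part p w)) (incl p u) = 0"
proof -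
  obtain b where "b \<in> Charts M" "p \<in> fst b" using M.points_in_chart[OF p] by blast
  then show ?thesis using assms by (rule gram_tan_part(3))
qed

lemma tan_part_incl: "v \<in> tangent_space M p \<Longrightarrow> tan_part p (incl p v) = v"
  by (rule tan_part_eqI[OF incl_tangent[OF p]], assumption, unfold diff_self)
    (rule linear_on_set_0[OF g_linear_left[OF p_N incl_tangent[OF p]] subspace_tangent])

lemma tan_part_add:
  assumes w: "w \<in> tangent_space N p" and w': "w' \<in> tangent_space N p"
  shows "tan_part p (w + w') = tan_part p w + tan_part p w'"
proof (rule tan_part_eqI)
  fix u assume u: "u \<in> tangent_space M p"
  have eq: "w + w' - incl p (tan_part p w + tan_part p w') =
      (w - incl p (tan_part p w)) + (w' - incl p (tan_part p w'))"
    unfolding linear_add[OF linear_incl[OF p]] by (rule add_diff_add)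
  show "g p (w + w' - incl p (tan_part p w + tan_part p w')) (incl p u) = 0"
    unfolding eq linear_on_set_add[OF g_linear_left[OF p_N incl_tangent[OF p]]
        tangent_closed(2)[OF w incl_tangent[OF p]] tangent_closed(2)[OF w' incl_tangent[OF p]]]
      tan_part_orthogonal[OF w u] tan_part_orthogonal[OF w' u] by (rule add_0)
qed (use w w' in \<open>auto intro: tangent_closed M.tangent_closed tan_part_tangent\<close>)

lemma tan_part_scaleR:
  assumes w: "w \<in> tangent_space N p"
  shows "tan_part p (r *\<^sub>R w) = r *\<^sub>R tan_part p w"
proof (rule tan_part_eqI)
  fix u assume u: "u \<in> tangent_space M p"
  have eq: "r *\<^sub>R w - incl p (r *\<^sub>R tan_part p w) = r *\<^sub>R (w - incl p (tan_part p w))"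
    unfolding linear_scale[OF linear_incl[OF p]] by (rule scaleR_diff_right[symmetric])
  show "g p (r *\<^sub>R w - incl p (r *\<^sub>R tan_part p w)) (incl p u) = 0"
    unfolding eq linear_on_set_scale[OF g_linear_left[OF p_N incl_tangent[OF p]]
        tangent_closed(2)[OF w incl_tangent[OF p]]] tan_part_orthogonal[OF w u] by (rule scaleR_zero_right)
qed (use w in \<open>auto intro: tangent_closed M.tangent_closed tan_part_tangent\<close>)

lemma linear_tan_part: "linear_on_set (tangent_space N p) (tan_part p)"
  unfolding linear_on_set_def using tan_part_add tan_part_scaleR by blast

lemma linear_nor_part: "linear_on_set (tangent_space N p) (nor_part p)"
  unfolding linear_on_set_def nor_part_def
proof (intro conjI ballI allI)
  show "u + v - incl p (tan_part p (u + v)) = u - incl p (tan_part p u) + (v - incl p (tan_part p v))"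
    if "u \<in> tangent_space N p" "v \<in> tangent_space N p" for u v
    unfolding tan_part_add[OF that] linear_add[OF linear_incl[OF p]] by (rule add_diff_add)
  show "a *\<^sub>R u - incl p (tan_part p (a *\<^sub>R u)) = a *\<^sub>R (u - incl p (tan_part p u))"
    if "u \<in> tangent_space N p" for a u
    unfolding tan_part_scaleR[OF that] linear_scale[OF linear_incl[OF p]] by (rule scaleR_diff_right[symmetric])
qed

lemma nor_part_incl: "v \<in> tangent_space M p \<Longrightarrow> nor_part p (incl p v) = 0"
  unfolding nor_part_def tan_part_incl by (rule diff_self)

end

lemma smooth_vf_tan_part:
  assumes V: "openin (Top M) V" and Y: "smooth_along V Y"
  shows "smooth_vf M V (\<lambda>p. tan_part p (Y p))"
proof (rule M.smooth_vf_chartI[OF V])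
  show "tan_part p (Y p) \<in> tangent_space M p" if "p \<in> V" for p
    using tan_part_tangent in_points[OF V that] along_tangent[OF Y that] by blast
  fix b assume b: "b \<in> Charts M"
  let ?W = "V \<inter> fst b"
  have W: "openin (Top M) ?W" by (rule M.chart_Int_open[OF b V])
  have S: "open (snd b ` ?W)" using M.chart_image_open[OF b V] by (simp add: Int_commute)
  have coord: "smooth_along ?W (\<lambda>q. incl q (coord_vec M b q a))" for a
    by (rule along_incl[OF W M.smooth_vf_subset[OF M.smooth_vf_coord[OF b]]]) auto
  have gram: "smooth_fun M ?W (\<lambda>q. gram b q a)" for a
    unfolding gram_def
    by (intro M.smooth_fun_sum M.smooth_fun_scaleR W smooth_fun_metric_along coord M.smooth_fun_const)
  have rhs: "smooth_fun M ?W (\<lambda>q. \<Sum>j\<in>Basis. g q (Y q) (incl q (coord_vec M b q j)) *\<^sub>R j)"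
    by (intro M.smooth_fun_sum M.smooth_fun_scaleR W smooth_fun_metric_along coord M.smooth_fun_const
        along_subset[OF Y Int_lower1])
  have Int: "fst b \<inter> ?W = ?W" by blast
  have "smooth_on (snd b ` ?W) (in_chart b (\<lambda>q. tan_part q (Y q) b))"
  proof (rule smooth_on_linear_system_solution[OF S,
        where G = "\<lambda>z a. in_chart b (\<lambda>q. gram b q a) z"
          and b = "in_chart b (\<lambda>q. \<Sum>j\<in>Basis. g q (Y q) (incl q (coord_vec M b q j)) *\<^sub>R j)"])
    show "smooth_on (snd b ` ?W) (\<lambda>z. in_chart b (\<lambda>q. gram b q a) z)" for a
      using M.smooth_funD[OF gram b] by (simp add: Int)
    show "smooth_on (snd b ` ?W) (in_chart b (\<lambda>q. \<Sum>j\<in>Basis. g q (Y q) (incl q (coord_vec M b q j)) *\<^sub>R j))"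
      using M.smooth_funD[OF rhs b] by (simp add: Int)
    fix z assume "z \<in> snd b ` ?W"
    then obtain q where q: "q \<in> V" "q \<in> fst b" "z = snd b q" by blast
    note qM = in_points[OF V q(1)]
    show "linear (\<lambda>a. in_chart b (\<lambda>q. gram b q a) z)"
      using linear_gram[OF qM b q(2)] b q by simp
    show "inj (\<lambda>a. in_chart b (\<lambda>q. gram b q a) z)"
      using inj_gram[OF qM b q(2)] b q by simp
    show "in_chart b (\<lambda>q. gram b q (in_chart b (\<lambda>q. tan_part q (Y q) b) z)) z =
        in_chart b (\<lambda>q. \<Sum>j\<in>Basis. g q (Y q) (incl q (coord_vec M b q j)) *\<^sub>R j) z"
      using gram_tan_part(1)[OF qM b q(2) along_tangent[OF Y q(1)]] b q by simp
  qed
  then show "smooth_fun M ?W (\<lambda>q. tan_part q (Y q) b)"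
    by (rule M.smooth_fun_chartI[OF W Int_lower2 b])
qed

lemma along_nor_part:
  "openin (Top M) V \<Longrightarrow> smooth_along V Y \<Longrightarrow> smooth_along V (\<lambda>p. nor_part p (Y p))"
  unfolding nor_part_def by (intro along_diff along_incl smooth_vf_tan_part)

subsection \<open>The second fundamental form\<close>

lemma smooth_vf_ind_conn:
  "openin (Top M) V \<Longrightarrow> smooth_vf M V X \<Longrightarrow> smooth_vf M V Y \<Longrightarrow> smooth_vf M V (ind_conn X Y)"
  unfolding ind_conn_def[abs_def] by (intro smooth_vf_tan_part along_nab_along along_incl)

lemma along_sff:
  "openin (Top M) V \<Longrightarrow> smooth_vf M V X \<Longrightarrow> smooth_vf M V Y \<Longrightarrow> smooth_along V (sff X Y)"
  unfolding sff_def[abs_def] by (intro along_nor_part along_nab_along along_incl)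

lemma nor_conn_cong:
  assumes "openin (Top M) V" "p \<in> V" "\<And>q. q \<in> V \<Longrightarrow> \<nu> q = \<nu>' q"
  shows "nor_conn X \<nu> p = nor_conn X \<nu>' p"
  unfolding nor_conn_def by (rule arg_cong[where f = "nor_part p"], rule nab_along_cong[OF assms])

lemma nor_conn_zero:
  assumes V: "openin (Top M) V" "p \<in> V" "\<And>q. q \<in> V \<Longrightarrow> \<nu> q = 0"
  shows "nor_conn X \<nu> p = 0"
proof -
  note p = in_points[OF V(1,2)]
  have "nor_conn X \<nu> p = nor_conn X (\<lambda>q. 0) p" by (rule nor_conn_cong[OF V])
  also have "\<dots> = nor_part p 0" unfolding nor_conn_def nab_along_zero[OF p] by (rule refl)
  also have "\<dots> = 0" by (rule linear_on_set_0[OF linear_nor_part[OF p] subspace_tangent])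
  finally show ?thesis .
qed

lemma ind_conn_zero:
  assumes V: "openin (Top M) V" "p \<in> V" "\<And>q. q \<in> V \<Longrightarrow> Y q = 0"
  shows "ind_conn X Y p = 0"
proof -
  note p = in_points[OF V(1,2)]
  have "nab_along p (X p) (\<lambda>q. incl q (Y q)) = nab_along p (X p) (\<lambda>q. 0)"
    by (rule nab_along_cong[OF V(1,2)]) (simp only: V(3) linear_0[OF linear_incl[OF in_points[OF V(1)]]])
  then show ?thesis
    unfolding ind_conn_def nab_along_zero[OF p] by (simp only: linear_on_set_0[OF linear_tan_part[OF p] subspace_tangent])
qed

context
  fixes V p assumes V: "openin (Top M) V" "p \<in> V"
begin

lemma nor_conn_add:
  assumes "smooth_vf M V X" "smooth_along V \<mu>" "smooth_along V \<nu>"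
  shows "nor_conn X (\<lambda>q. \<mu> q + \<nu> q) p = nor_conn X \<mu> p + nor_conn X \<nu> p"
  unfolding nor_conn_def nab_along_add[OF V assms(2,3)]
  by (rule linear_on_set_add[OF linear_nor_part[OF in_points[OF V]]]) (intro nab_along_tangent[OF V] assms(2,3))+

text \<open>By torsion-freeness the difference is the normal part of the bracket, and the bracket is
  tangent to \<open>M\<close>.\<close>

lemma sff_sym:
  assumes X: "smooth_vf M V X" and Y: "smooth_vf M V Y"
  shows "sff X Y p = sff Y X p"
proof -
  note p = in_points[OF V]
  note T = nab_along_tangent[OF V along_incl[OF V(1) X], of "Y p"]
    nab_along_tangent[OF V along_incl[OF V(1) Y], of "X p"]
  have "sff X Y p - sff Y X p = nor_part p (incl p (bracket M X Y p))"
    unfolding sff_def nab_along_torsion_free[OF V X Y, symmetric]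
    by (rule linear_on_set_diff[OF linear_nor_part[OF p] subspace_tangent T(2,1), symmetric])
  also have "\<dots> = 0" by (rule nor_part_incl[OF p M.bracket_tangent[OF V X Y]])
  finally show ?thesis unfolding right_minus_eq .
qed

context
  fixes Y assumes Y: "smooth_vf M V Y"
begin

lemma sff_scaleR_left: "Z p = a *\<^sub>R X p \<Longrightarrow> sff Z Y p = a *\<^sub>R sff X Y p"
  using linear_on_set_scale[OF linear_nor_part[OF in_points[OF V]] nab_along_tangent[OF V along_incl[OF V(1) Y]]]
  by (simp only: sff_def linear_scale[OF nab_along_linear[OF V along_incl[OF V(1) Y]]])

lemma sff_add_left: "Z p = X p + X' p \<Longrightarrow> sff Z Y p = sff X Y p + sff X' Y p"
  using linear_on_set_add[OF linear_nor_part[OF in_points[OF V]]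
      nab_along_tangent[OF V along_incl[OF V(1) Y]] nab_along_tangent[OF V along_incl[OF V(1) Y]]]
  by (simp only: sff_def linear_add[OF nab_along_linear[OF V along_incl[OF V(1) Y]]])

lemma sff_diff_left: "Z p = X p - X' p \<Longrightarrow> sff Z Y p = sff X Y p - sff X' Y p"
  using linear_on_set_diff[OF linear_nor_part[OF in_points[OF V]] subspace_tangent
      nab_along_tangent[OF V along_incl[OF V(1) Y]] nab_along_tangent[OF V along_incl[OF V(1) Y]]]
  by (simp only: sff_def linear_diff[OF nab_along_linear[OF V along_incl[OF V(1) Y]]])

text \<open>By definition \<open>sff\<close> depends on its first argument only through the value at
  \<open>p\<close>. Symmetry carries this over to the second argument, so the relation between the
  fields is assumed at \<open>p\<close> alone.\<close>

lemma sff_scaleR_right: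
  assumes "smooth_vf M V X" "smooth_vf M V Z" "Z p = a *\<^sub>R X p"
  shows "sff Y Z p = a *\<^sub>R sff Y X p"
  using sff_sym[OF Y assms(1)] sff_sym[OF Y assms(2)] sff_scaleR_left[where Z = Z and X = X, OF assms(3)] by simp

lemma sff_add_right:
  assumes "smooth_vf M V X" "smooth_vf M V X'" "smooth_vf M V Z" "Z p = X p + X' p"
  shows "sff Y Z p = sff Y X p + sff Y X' p"
  using sff_sym[OF Y assms(1)] sff_sym[OF Y assms(2)] sff_sym[OF Y assms(3)] sff_add_left[where Z = Z and X = X and X' = X', OF assms(4)]
  by simp

lemma sff_diff_right:
  assumes "smooth_vf M V X" "smooth_vf M V X'" "smooth_vf M V Z" "Z p = X p - X' p"
  shows "sff Y Z p = sff Y X p - sff Y X' p"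
  using sff_sym[OF Y assms(1)] sff_sym[OF Y assms(2)] sff_sym[OF Y assms(3)] sff_diff_left[where Z = Z and X = X and X' = X', OF assms(4)]
  by simp

end

lemma sff_at_eq:
  assumes X: "smooth_vf M V X" and Y: "smooth_vf M V Y"
  shows "sff_at p (X p) (Y p) = sff X Y p"
proof -
  let ?b = "chart_at M p"
  have b: "?b \<in> charts_at M p" "?b \<in> Charts M" "p \<in> fst ?b"
    using M.chart_at[OF in_points[OF V]] by auto
  have W: "openin (Top M) (V \<inter> fst ?b)" "p \<in> V \<inter> fst ?b"
    using M.chart_Int_open[OF b(2) V(1)] V(2) b(3) by auto
  have coord: "smooth_vf M (V \<inter> fst ?b) (\<lambda>q. coord_vec M ?b q a)" for a
    by (rule M.smooth_vf_subset[OF M.smooth_vf_coord[OF b(2)]]) auto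
  have coord_eq: "coord_vec M ?b p (Z p ?b) = Z p" if "smooth_vf M V Z" for Z
    using M.tangent_eq_coord_vec[OF M.smooth_vf_tangent[OF that V(2)] b(1)] by (rule sym)
  have "sff_at p (X p) (Y p) = sff X (\<lambda>q. coord_vec M ?b q (Y p ?b)) p"
    unfolding sff_at_def Let_def by (simp only: sff_def coord_eq[OF X])
  also have "\<dots> = sff (\<lambda>q. coord_vec M ?b q (Y p ?b)) X p"
    \<comment> \<open>The coordinate fields exist only on the smaller open set, while the
      surrounding context fixes \<open>V\<close>; hence the lemma is taken from the locale.\<close>
    by (rule submanifold.sff_sym[OF submanifold_axioms W M.smooth_vf_subset[OF X Int_lower1] coord])
  also have "\<dots> = sff Y X p" by (simp only: sff_def coord_eq[OF Y])
  also have "\<dots> = sff X Y p" by (rule sff_sym[OF Y X])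
  finally show ?thesis .
qed

end

lemma smooth_vf_ind_curv:
  "openin (Top M) V \<Longrightarrow> smooth_vf M V X \<Longrightarrow> smooth_vf M V Y \<Longrightarrow> smooth_vf M V Z \<Longrightarrow>
    smooth_vf M V (ind_curv X Y Z)"
  unfolding ind_curv_def[abs_def]
  by (intro M.smooth_vf_diff smooth_vf_ind_conn M.smooth_vf_bracket)

lemma nor_curv_zero:
  assumes V: "openin (Top M) V" "p \<in> V" "\<And>q. q \<in> V \<Longrightarrow> \<nu> q = 0"
  shows "nor_curv X Y \<nu> p = 0"
proof -
  have "nor_conn Z \<nu> q = 0" if "q \<in> V" for Z q by (rule nor_conn_zero[OF V(1) that V(3)])
  then have "nor_conn X (nor_conn Y \<nu>) p = 0" "nor_conn Y (nor_conn X \<nu>) p = 0"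
    "nor_conn (bracket M X Y) \<nu> p = 0"
    using V by (auto intro: nor_conn_zero[OF V(1,2)])
  then show ?thesis unfolding nor_curv_def by simp
qed

lemma totally_geodesicD:
  "totally_geodesic \<Longrightarrow> openin (Top M) V \<Longrightarrow> smooth_vf M V X \<Longrightarrow> smooth_vf M V Y \<Longrightarrow> p \<in> V \<Longrightarrow>
    sff X Y p = 0"
  unfolding totally_geodesic_def by blast

lemma nab_sff_zero:
  assumes "totally_geodesic" "openin (Top M) V" "p \<in> V"
    and "smooth_vf M V X" "smooth_vf M V Y" "smooth_vf M V Z"
  shows "nab_sff X Y Z p = 0"
proof -
  have "nor_conn X (sff Y Z) p = 0"
    by (rule nor_conn_zero[OF assms(2,3)]) (rule totally_geodesicD[OF assms(1,2,5,6)])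
  moreover have "sff (ind_conn X Y) Z p = 0" "sff Y (ind_conn X Z) p = 0"
    using assms by (auto intro!: totally_geodesicD[OF assms(1,2)] smooth_vf_ind_conn)
  ultimately show ?thesis unfolding nab_sff_def by simp
qed

lemma totally_geodesic_imp_parallel: "totally_geodesic \<Longrightarrow> parallel"
  unfolding parallel_def using nab_sff_zero by blast

text \<open>Differentiating \<open>\<nabla>\<^sub>Y (h(Z,U)) = h(\<nabla>\<^sub>Y Z, U) + h(Z, \<nabla>\<^sub>Y U)\<close> once more and skew-symmetrising shows
  that the curvature annihilates a parallel \<open>h\<close>.\<close>

lemma parallel_imp_semiparallel:
  assumes "parallel" shows "semiparallel"
  unfolding semiparallel_def
proof (intro allI impI ballI, elim conjE)
  fix V X Y Z U p
  assume V: "openin (Top M) V" and X: "smooth_vf M V X" and Y: "smooth_vf M V Y"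
    and Z: "smooth_vf M V Z" and U: "smooth_vf M V U" and p: "p \<in> V"
  have nor: "nor_conn A (sff B C) q = sff (ind_conn A B) C q + sff B (ind_conn A C) q"
    if "smooth_vf M V A" "smooth_vf M V B" "smooth_vf M V C" "q \<in> V" for A B C q
  proof -
    have "nab_sff A B C q = 0" using assms V that unfolding parallel_def by blast
    then show ?thesis unfolding nab_sff_def diff_diff_add by (rule iffD1[OF right_minus_eq])
  qed
  \<comment> \<open>The two mixed terms, with one derivative on each argument, change places when
    \<open>A\<close> and \<open>B\<close> do, so they cancel in the curvature.\<close>
  have second: "nor_conn A (nor_conn B (sff Z U)) p =
      (sff (ind_conn A (ind_conn B Z)) U p + sff (ind_conn B Z) (ind_conn A U) p) +
      (sff (ind_conn A Z) (ind_conn B U) p + sff Z (ind_conn A (ind_conn B U)) p)"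
    if A: "smooth_vf M V A" and B: "smooth_vf M V B" for A B
  proof -
    note BZ = smooth_vf_ind_conn[OF V B Z] and BU = smooth_vf_ind_conn[OF V B U]
    have "nor_conn A (nor_conn B (sff Z U)) p =
        nor_conn A (\<lambda>q. sff (ind_conn B Z) U q + sff Z (ind_conn B U) q) p"
      by (rule nor_conn_cong[OF V p]) (rule nor[OF B Z U])
    also have "\<dots> = nor_conn A (sff (ind_conn B Z) U) p + nor_conn A (sff Z (ind_conn B U)) p"
      by (rule nor_conn_add[OF V p A along_sff[OF V BZ U] along_sff[OF V Z BU]])
    finally show ?thesis unfolding nor[OF A BZ U p] nor[OF A Z BU p] .
  qed
  note XY = smooth_vf_ind_conn[OF V X smooth_vf_ind_conn[OF V Y]]
    and YX = smooth_vf_ind_conn[OF V Y smooth_vf_ind_conn[OF V X]]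
    and B = smooth_vf_ind_conn[OF V M.smooth_vf_bracket[OF V X Y]]
  have left: "sff (ind_curv X Y Z) U p = sff (ind_conn X (ind_conn Y Z)) U p -
      sff (ind_conn Y (ind_conn X Z)) U p - sff (ind_conn (bracket M X Y) Z) U p"
    using sff_diff_left[OF V p U, of "ind_curv X Y Z" "\<lambda>q. ind_conn X (ind_conn Y Z) q - ind_conn Y (ind_conn X Z) q"
        "ind_conn (bracket M X Y) Z"]
      sff_diff_left[OF V p U, of "\<lambda>q. ind_conn X (ind_conn Y Z) q - ind_conn Y (ind_conn X Z) q"
        "ind_conn X (ind_conn Y Z)" "ind_conn Y (ind_conn X Z)"]
    by (simp only: ind_curv_def)
  have right: "sff Z (ind_curv X Y U) p = sff Z (ind_conn X (ind_conn Y U)) p -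
      sff Z (ind_conn Y (ind_conn X U)) p - sff Z (ind_conn (bracket M X Y) U) p"
    using sff_diff_right[OF V p Z M.smooth_vf_diff[OF V XY[OF U] YX[OF U]] B[OF U] smooth_vf_ind_curv[OF V X Y U]]
      sff_diff_right[OF V p Z XY[OF U] YX[OF U] M.smooth_vf_diff[OF V XY[OF U] YX[OF U]]]
    by (simp only: ind_curv_def)
  show "curv_sff X Y Z U p = 0"
    unfolding curv_sff_def nor_curv_def second[OF X Y] second[OF Y X]
      nor[OF M.smooth_vf_bracket[OF V X Y] Z U p] left right
    by (rule ext) simp
qed

end

section \<open>Invariant submanifolds of SQ-Sasakian manifolds\<close>

locale sq_sasakian_manifold = riemannian_manifold N g nab
  for N :: "('a, 'e::euclidean_space) mfd"
    and g :: "'a \<Rightarrow> ('a, 'e) tvec \<Rightarrow> ('a, 'e) tvec \<Rightarrow> real"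
    and nab :: "('a, 'e) conn" +
  fixes \<phi> :: "'a \<Rightarrow> ('a, 'e) tvec \<Rightarrow> ('a, 'e) tvec"
    and \<xi> :: "('a, 'e) vfield"
    and \<eta> :: "'a \<Rightarrow> ('a, 'e) tvec \<Rightarrow> real"
    and \<beta> :: "'a \<Rightarrow> real"
  assumes sq: "sq_sasakian N \<phi> \<xi> \<eta> g nab \<beta>"
begin

lemma acm: "almost_contact_metric N \<phi> \<xi> \<eta> g"
  using sq by (simp only: sq_sasakian_def)

lemma phi_tensor: "tensor11 N \<phi>"
  and xi_smooth: "smooth_vf N (points N) \<xi>"
  and eta_form: "one_form N \<eta>"
  using acm by (simp_all only: almost_contact_metric_def)

lemma beta_smooth: "smooth_fun N (points N) \<beta>"
  using sq by (simp only: sq_sasakian_def)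

lemma phi_smooth: "openin (Top N) V \<Longrightarrow> smooth_vf N V X \<Longrightarrow> smooth_vf N V (\<lambda>p. \<phi> p (X p))"
  using phi_tensor[unfolded tensor11_def, THEN conjunct2, rule_format, of V X] by simp

context
  fixes p assumes p: "p \<in> points N"
begin

lemma phi_linear: "linear_on_set (tangent_space N p) (\<phi> p)"
  using phi_tensor p by (simp add: tensor11_def)

lemma phi_tangent: "u \<in> tangent_space N p \<Longrightarrow> \<phi> p u \<in> tangent_space N p"
  using phi_tensor p by (auto simp: tensor11_def)

lemma eta_linear: "linear_on_set (tangent_space N p) (\<eta> p)"
  using eta_form p by (simp add: one_form_def)

lemma xi_tangent: "\<xi> p \<in> tangent_space N p"
  using smooth_vf_tangent[OF xi_smooth p] .

lemmas acm_rules = acm[unfolded almost_contact_metric_def, THEN conjunct2, THEN conjunct2, THEN conjunct2,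
    THEN conjunct2, THEN conjunct2, THEN bspec, OF p]

lemma phi_xi: "\<phi> p (\<xi> p) = 0" and eta_xi: "\<eta> p (\<xi> p) = 1"
  using acm_rules by blast+

lemma phi_phi: "u \<in> tangent_space N p \<Longrightarrow> \<phi> p (\<phi> p u) = - u + \<eta> p u *\<^sub>R \<xi> p"
  and g_xi: "u \<in> tangent_space N p \<Longrightarrow> g p u (\<xi> p) = \<eta> p u"
  and eta_phi: "u \<in> tangent_space N p \<Longrightarrow> \<eta> p (\<phi> p u) = 0"
  using acm_rules[THEN conjunct2, THEN conjunct2, THEN bspec] by blast+

lemma xi_beta: "vderiv N p (\<xi> p) \<beta> = 0"
  and nab_xi: "u \<in> tangent_space N p \<Longrightarrow> nab p u \<xi> = - \<beta> p *\<^sub>R \<phi> p u"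
  using sq[unfolded sq_sasakian_def] p by blast+

end

lemma normality:
  assumes "openin (Top N) V" "p \<in> V" "smooth_vf N V X" "smooth_vf N V Y"
  shows "bracket N (\<lambda>q. \<phi> q (X q)) (\<lambda>q. \<phi> q (Y q)) p + \<phi> p (\<phi> p (bracket N X Y p))
     - \<phi> p (bracket N (\<lambda>q. \<phi> q (X q)) Y p) - \<phi> p (bracket N X (\<lambda>q. \<phi> q (Y q)) p)
     + (2 * ext_d1 N \<eta> X Y p) *\<^sub>R \<xi> p = 0"
proof -
  have "normal_structure N \<phi> \<xi> \<eta>" using sq by (simp only: sq_sasakian_def)
  from this[unfolded normal_structure_def, rule_format, of V X Y p] show ?thesis using assms by simp
qed

text \<open>Meant for \<phi>\<xi>, which vanishes on the point set but has no prescribed values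
  elsewhere. Torsion-freeness expresses the bracket by \<open>nab\<close>, which depends on a field
  only through its values on \<open>V\<close>.\<close>

lemma bracket_zero:
  assumes V: "openin (Top N) V" "p \<in> V" and X: "smooth_vf N V X" and Y: "\<And>q. q \<in> V \<Longrightarrow> Y q = 0"
  shows "bracket N X Y p = 0"
proof -
  have Y': "smooth_vf N V Y" by (rule smooth_vf_cong[OF V(1) _ smooth_vf_zero[OF V(1)]]) (simp only: Y)
  have "nab p (X p) Y = nab p (X p) (\<lambda>q. 0)"
    by (rule nab_cong[OF V smooth_vf_zero[OF V(1)] smooth_vf_tangent[OF X V(2)] Y])
  also have "\<dots> = 0" by (rule nab_zero[OF V X smooth_vf_tangent[OF X V(2)]])
  finally show ?thesis
    using torsion_free[OF V X Y', symmetric] linear_on_set_0[OF nab_linear[OF V X] subspace_tangent]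
    by (simp only: Y[OF V(2)] diff_0_right)
qed

text \<open>Normality, evaluated on \<open>X\<close> and \<open>\<xi>\<close>, shows that \<open>\<nabla>\<^sub>\<xi> \<phi> X - \<phi> \<nabla>\<^sub>\<xi> X\<close> is a multiple of \<open>\<xi>\<close>; its \<open>\<xi>\<close> component
  vanishes because \<open>\<nabla>\<^sub>\<xi> \<xi> = 0\<close>.\<close>

lemma nab_xi_phi:
  assumes V: "openin (Top N) V" "p \<in> V" and X: "smooth_vf N V X"
  shows "nab p (\<xi> p) (\<lambda>q. \<phi> q (X q)) = \<phi> p (nab p (\<xi> p) X)"
proof -
  have sub: "V \<subseteq> points N" using openin_subset[OF V(1)] .
  have p: "p \<in> points N" using sub V(2) by blast
  let ?\<phi>X = "\<lambda>q. \<phi> q (X q)" and ?T = "tangent_space N p"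
  have xi: "smooth_vf N V \<xi>" by (rule smooth_vf_subset[OF xi_smooth sub])
  have phiX: "smooth_vf N V ?\<phi>X" by (rule phi_smooth[OF V(1) X])
  note xT = xi_tangent[OF p] and XT = smooth_vf_tangent[OF X V(2)]
  note phiXT = phi_tangent[OF p XT]
  define A where "A = nab p (\<xi> p) ?\<phi>X"
  define B where "B = nab p (\<xi> p) X"
  have AT: "A \<in> ?T" unfolding A_def by (rule nab_tangent[OF V phiX xT])
  have BT: "B \<in> ?T" unfolding B_def by (rule nab_tangent[OF V X xT])
  note lin = phi_linear[OF p]
  note L = linear_on_set_add[OF lin] linear_on_set_diff[OF lin subspace_tangent] linear_on_set_scale[OF lin]
    linear_on_set_0[OF lin subspace_tangent] linear_on_set_minus[OF lin]
  have "nab p (\<xi> p) \<xi> = 0"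
    unfolding nab_xi[OF p xT] phi_xi[OF p] by (rule scaleR_zero_right)
  moreover have "vderiv N p (\<xi> p) (\<lambda>q. g q (\<phi> q (X q)) (\<xi> q)) = 0"
  proof -
    have "vderiv N p (\<xi> p) (\<lambda>q. g q (\<phi> q (X q)) (\<xi> q)) = vderiv N p (\<xi> p) (\<lambda>q. 0 :: real)"
    proof (rule vderiv_cong[OF V])
      fix q assume q: "q \<in> V"
      then have "q \<in> points N" using sub by blast
      then show "g q (\<phi> q (X q)) (\<xi> q) = 0"
        using g_xi phi_tangent eta_phi smooth_vf_tangent[OF X q] by simp
    qed
    then show ?thesis by simp
  qed
  ultimately have "g p A (\<xi> p) + g p (\<phi> p (X p)) 0 = 0"
    using metric_compatible[OF V phiX xi xT] by (simp add: A_def)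
  then have eta_A: "\<eta> p A = 0"
    using g_xi[OF p AT] linear_on_set_0[OF g_linear[OF p phiXT] subspace_tangent] by simp
  define c where "c = 2 * ext_d1 N \<eta> X \<xi> p"
  have b1: "bracket N ?\<phi>X (\<lambda>q. \<phi> q (\<xi> q)) p = 0" "bracket N X (\<lambda>q. \<phi> q (\<xi> q)) p = 0"
    by (rule bracket_zero[OF V phiX] bracket_zero[OF V X], use phi_xi sub in blast)+
  have b2: "bracket N X \<xi> p = - \<beta> p *\<^sub>R \<phi> p (X p) - B"
    using torsion_free[OF V X xi] nab_xi[OF p XT] by (simp only: B_def)
  have b3: "bracket N ?\<phi>X \<xi> p = - \<beta> p *\<^sub>R \<phi> p (\<phi> p (X p)) - A"
    using torsion_free[OF V phiX xi] nab_xi[OF p phiXT] by (simp only: A_def)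
  have E: "\<phi> p (\<phi> p (- \<beta> p *\<^sub>R \<phi> p (X p) - B)) - \<phi> p (- \<beta> p *\<^sub>R \<phi> p (\<phi> p (X p)) - A) + c *\<^sub>R \<xi> p = 0"
    using normality[OF V X xi] unfolding b1 b2 b3 c_def L(4) by (simp only: add_0 diff_0_right)
  have T: "\<phi> p (X p) \<in> ?T" "\<phi> p (\<phi> p (X p)) \<in> ?T" "\<phi> p B \<in> ?T" "\<phi> p A \<in> ?T" "\<phi> p (\<phi> p B) \<in> ?T"
    "\<phi> p (\<phi> p (\<phi> p (X p))) \<in> ?T"
    using phi_tangent[OF p] AT BT XT by auto
  have "\<phi> p (\<phi> p (- \<beta> p *\<^sub>R \<phi> p (X p) - B)) = - \<beta> p *\<^sub>R \<phi> p (\<phi> p (\<phi> p (X p))) - \<phi> p (\<phi> p B)"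
    by (simp only: L(2)[OF tangent_closed(3)[OF T(1)] BT] L(3)[OF T(1)] L(2)[OF tangent_closed(3)[OF T(2)] T(3)] L(3)[OF T(2)])
  moreover have "\<phi> p (- \<beta> p *\<^sub>R \<phi> p (\<phi> p (X p)) - A) = - \<beta> p *\<^sub>R \<phi> p (\<phi> p (\<phi> p (X p))) - \<phi> p A"
    by (simp only: L(2)[OF tangent_closed(3)[OF T(2)] AT] L(3)[OF T(2)])
  ultimately have "\<phi> p A - \<phi> p (\<phi> p B) + c *\<^sub>R \<xi> p = 0" using E by simp
  \<comment> \<open>A further \<phi> removes the multiple of \<xi>, and with it d\<eta>, without
    computing it. As \<open>A\<close> and \<open>\<phi> p B\<close> have no \<xi> component,
    \<phi>^2 acts on both as -1.\<close>
  then have "\<phi> p (\<phi> p A - \<phi> p (\<phi> p B) + c *\<^sub>R \<xi> p) = 0" by (simp only: L(4))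
  then have "\<phi> p (\<phi> p A) - \<phi> p (\<phi> p (\<phi> p B)) = 0"
    unfolding L(1)[OF tangent_closed(2)[OF T(4,5)] tangent_closed(3)[OF xT]] L(2)[OF T(4,5)] L(3)[OF xT] phi_xi[OF p]
      scaleR_zero_right add_0_right .
  then have "- A + \<phi> p B = 0"
    unfolding phi_phi[OF p AT] phi_phi[OF p T(3)] eta_A eta_phi[OF p BT] scaleR_zero_left add_0_right diff_minus_eq_add .
  then show ?thesis unfolding A_def B_def by (simp only: neg_eq_iff_add_eq_0[symmetric] minus_minus)
qed

end

locale invariant_submanifold =
  submanifold N g nab M + sq_sasakian_manifold N g nab \<phi> \<xi> \<eta> \<beta>
  for N :: "('a, 'e::euclidean_space) mfd"
    and g :: "'a \<Rightarrow> ('a, 'e) tvec \<Rightarrow> ('a, 'e) tvec \<Rightarrow> real"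
    and nab :: "('a, 'e) conn"
    and M :: "('a, 'd::euclidean_space) mfd"
    and \<phi> :: "'a \<Rightarrow> ('a, 'e) tvec \<Rightarrow> ('a, 'e) tvec"
    and \<xi> :: "('a, 'e) vfield"
    and \<eta> :: "'a \<Rightarrow> ('a, 'e) tvec \<Rightarrow> real"
    and \<beta> :: "'a \<Rightarrow> real" +
  assumes inv: "invariant \<phi> \<xi>"
begin

section \<open>The structure tensors induced on the submanifold\<close>

text \<open>Vectors of \<open>M\<close> and of \<open>N\<close> have different types. On the image
  of \<open>incl\<close>, \<open>tan_part\<close> is its inverse, so by invariance \<xi> and \<phi>
  return to \<open>M\<close> without loss, and smoothness of the result is that of tangential
  parts.\<close>

definition xiM :: "('a, 'd) vfield" where
  "xiM p = tan_part p (\<xi> p)"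

definition phiM :: "'a \<Rightarrow> ('a, 'd) tvec \<Rightarrow> ('a, 'd) tvec" where
  "phiM p v = tan_part p (\<phi> p (incl p v))"

context
  fixes p assumes p: "p \<in> points M"
begin

lemma incl_xiM: "incl p (xiM p) = \<xi> p"
proof -
  obtain v where v: "v \<in> tangent_space M p" "\<xi> p = incl p v"
    using inv p by (auto simp: invariant_def)
  show ?thesis unfolding xiM_def v(2) tan_part_incl[OF p v(1)] by (rule refl)
qed

lemma xiM_tangent: "xiM p \<in> tangent_space M p"
  unfolding xiM_def by (rule tan_part_tangent[OF p xi_tangent[OF p_N[OF p]]])

lemma incl_phiM:
  assumes u: "u \<in> tangent_space M p"
  shows "incl p (phiM p u) = \<phi> p (incl p u)"
proof -
  have "\<phi> p (incl p u) \<in> incl p ` tangent_space M p"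
    using inv p u unfolding invariant_def by blast
  then obtain v where v: "v \<in> tangent_space M p" "\<phi> p (incl p u) = incl p v" by blast
  show ?thesis unfolding phiM_def v(2) tan_part_incl[OF p v(1)] by (rule refl)
qed

lemma phiM_tangent: "phiM p u \<in> tangent_space M p"
  unfolding phiM_def by (rule tan_part_tangent[OF p phi_tangent[OF p_N[OF p] incl_tangent[OF p]]])

lemma incl_eqI:
  assumes "u \<in> tangent_space M p" "v \<in> tangent_space M p" "incl p u = incl p v"
  shows "u = v"
  using arg_cong[OF assms(3), of "tan_part p"] unfolding tan_part_incl[OF p assms(1)] tan_part_incl[OF p assms(2)] .

lemma phiM_linear: "linear (phiM p)"
  unfolding phiM_def
  by (rule linearI)
    (simp_all only: linear_add[OF linear_incl[OF p]] linear_scale[OF linear_incl[OF p]]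
      linear_on_set_add[OF phi_linear[OF p_N[OF p]] incl_tangent[OF p] incl_tangent[OF p]]
      linear_on_set_scale[OF phi_linear[OF p_N[OF p]] incl_tangent[OF p]]
      tan_part_add[OF p phi_tangent[OF p_N[OF p] incl_tangent[OF p]] phi_tangent[OF p_N[OF p] incl_tangent[OF p]]]
      tan_part_scaleR[OF p phi_tangent[OF p_N[OF p] incl_tangent[OF p]]])

lemma phiM_xiM: "phiM p (xiM p) = 0"
  unfolding phiM_def incl_xiM phi_xi[OF p_N[OF p]]
  by (rule linear_on_set_0[OF linear_tan_part[OF p] subspace_tangent])

lemma phiM_phiM:
  assumes u: "u \<in> tangent_space M p"
  shows "phiM p (phiM p u) = - u + \<eta> p (incl p u) *\<^sub>R xiM p"
proof (rule incl_eqI)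
  show "phiM p (phiM p u) \<in> tangent_space M p" by (rule phiM_tangent)
  show "- u + \<eta> p (incl p u) *\<^sub>R xiM p \<in> tangent_space M p"
    by (intro M.tangent_closed u xiM_tangent)
  show "incl p (phiM p (phiM p u)) = incl p (- u + \<eta> p (incl p u) *\<^sub>R xiM p)"
    unfolding incl_phiM[OF phiM_tangent] incl_phiM[OF u] phi_phi[OF p_N[OF p] incl_tangent[OF p]]
      linear_add[OF linear_incl[OF p]] linear_neg[OF linear_incl[OF p]] linear_scale[OF linear_incl[OF p]] incl_xiM
    by (rule refl)
qed

lemma nab_along_xiM:
  assumes u: "u \<in> tangent_space M p"
  shows "nab_along p u (\<lambda>q. incl q (xiM q)) = incl p (- \<beta> p *\<^sub>R phiM p u)"
proof -
  have "nab_along p u (\<lambda>q. incl q (xiM q)) = nab_along p u \<xi>"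
  proof (rule nab_along_cong[OF openin_topspace p])
    show "incl q (xiM q) = \<xi> q" if "q \<in> points M" for q
      by (rule invariant_submanifold.incl_xiM[OF invariant_submanifold_axioms that])
  qed
  also have "\<dots> = nab p (incl p u) \<xi>"
    by (rule nab_along_restrict[OF p p_N[OF p] openin_topspace xi_smooth])
  also have "\<dots> = - \<beta> p *\<^sub>R \<phi> p (incl p u)" by (rule nab_xi[OF p_N[OF p] incl_tangent[OF p]])
  also have "\<dots> = incl p (- \<beta> p *\<^sub>R phiM p u)"
    unfolding linear_scale[OF linear_incl[OF p]] incl_phiM[OF u] by (rule refl)
  finally show ?thesis .
qed

lemma ind_conn_xiM: "X p \<in> tangent_space M p \<Longrightarrow> ind_conn X xiM p = - \<beta> p *\<^sub>R phiM p (X p)"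
  unfolding ind_conn_def nab_along_xiM by (rule tan_part_incl[OF p M.tangent_closed(3)[OF phiM_tangent]])

lemma sff_xiM: "X p \<in> tangent_space M p \<Longrightarrow> sff X xiM p = 0"
  unfolding sff_def nab_along_xiM by (rule nor_part_incl[OF p M.tangent_closed(3)[OF phiM_tangent]])

lemma ind_metric_xiM: "ind_metric p (xiM p) (xiM p) = 1"
  unfolding ind_metric_def incl_xiM g_xi[OF p_N[OF p] xi_tangent[OF p_N[OF p]]] by (rule eta_xi[OF p_N[OF p]])

end

lemma smooth_xiM: "openin (Top M) V \<Longrightarrow> smooth_vf M V xiM"
  unfolding xiM_def[abs_def] using openin_subset[of "Top M" V] points_subset
  by (intro smooth_vf_tan_part along_restrict[OF _ xi_smooth openin_topspace]) auto

lemma smooth_phiM: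
  assumes V: "openin (Top M) V" and X: "smooth_vf M V X"
  shows "smooth_vf M V (\<lambda>p. phiM p (X p))"
  unfolding phiM_def by (rule smooth_vf_tan_part[OF V along_tensor11[OF V along_incl[OF V X] phi_tensor]])

lemma beta_smooth_M: "openin (Top M) V \<Longrightarrow> smooth_fun M V \<beta>"
  using openin_subset[of "Top M" V] points_subset
  by (auto intro: smooth_fun_restrict[OF beta_smooth openin_topspace])

text \<open>\<open>nab_xi_phi\<close> concerns fields of \<open>N\<close>, but it is needed for
  included fields of \<open>M\<close>. Expanding \<open>Y\<close> in coordinate fields reduces to
  fields of \<open>N\<close>; the derivatives of the coefficients commute with \<phi> by
  linearity.\<close>

lemma nab_along_xiM_phi:
  assumes V: "openin (Top M) V" "p \<in> V" and Y: "smooth_along V Y"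
  shows "nab_along p (xiM p) (\<lambda>q. \<phi> q (Y q)) = \<phi> p (nab_along p (xiM p) Y)"
proof -
  obtain c where c: "c \<in> Charts N" "p \<in> fst c" using points_in_chart in_points_N[OF V] by blast
  have cc: "c \<in> charts_at N p" using c by simp
  let ?W = "V \<inter> fst c" and ?E = "\<lambda>i q. coord_vec N c q i"
  have W: "openin (Top M) ?W" "p \<in> ?W" using openin_Int_chart[OF V(1) c(1)] V c by auto
  note pM = in_points[OF V] and pN = in_points_N[OF V]
  note E = smooth_vf_coord[OF c(1)] and O = chart_open[OF c(1)]
  note phiE = phi_smooth[OF O E]
  note lin = phi_linear[OF pN]
  have ET: "?E i p \<in> tangent_space N p" for i by (rule coord_vec_tangent[OF cc])
  have nabT: "nab p (\<xi> p) (?E i) \<in> tangent_space N p" for i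
    by (rule nab_tangent[OF O c(2) E xi_tangent[OF pN]])
  define a where "a i = vderiv M p (xiM p) (\<lambda>q. Y q c \<bullet> i)" for i
  have "nab_along p (xiM p) (\<lambda>q. \<phi> q (Y q)) =
      nab_along p (xiM p) (\<lambda>q. \<Sum>i\<in>Basis. (Y q c \<bullet> i) *\<^sub>R \<phi> q (?E i q))"
  proof (rule nab_along_cong[OF W])
    fix q assume q: "q \<in> ?W"
    have qN: "q \<in> points N" using in_points_N[OF W(1) q] .
    have "\<phi> q (Y q) = \<phi> q (\<Sum>i\<in>Basis. (Y q c \<bullet> i) *\<^sub>R ?E i q)"
      by (rule arg_cong[where f = "\<phi> q"], rule along_frame[OF V(1) Y c(1)]) (use q in auto)
    also have "\<dots> = (\<Sum>i\<in>Basis. (Y q c \<bullet> i) *\<^sub>R \<phi> q (?E i q))"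
      by (rule linear_on_set_sum[OF phi_linear[OF qN] subspace_tangent], rule coord_vec_tangent) (use q c in auto)
    finally show "\<phi> q (Y q) = (\<Sum>i\<in>Basis. (Y q c \<bullet> i) *\<^sub>R \<phi> q (?E i q))" .
  qed
  also have "\<dots> = (\<Sum>i\<in>Basis. a i *\<^sub>R \<phi> p (?E i p) + (Y p c \<bullet> i) *\<^sub>R nab_along p (xiM p) (\<lambda>q. \<phi> q (?E i q)))"
    unfolding a_def
    by (rule nab_along_sum[OF W finite_Basis along_coefficient[OF V(1) Y c(1)] along_restrict[OF W(1) phiE O Int_lower2]])
  also have "\<dots> = (\<Sum>i\<in>Basis. a i *\<^sub>R \<phi> p (?E i p) + (Y p c \<bullet> i) *\<^sub>R \<phi> p (nab p (\<xi> p) (?E i)))"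
    unfolding nab_along_restrict[OF pM c(2) O phiE] incl_xiM[OF pM] nab_xi_phi[OF O c(2) E] by (rule refl)
  also have "\<dots> = \<phi> p (\<Sum>i\<in>Basis. a i *\<^sub>R ?E i p) + \<phi> p (\<Sum>i\<in>Basis. (Y p c \<bullet> i) *\<^sub>R nab p (\<xi> p) (?E i))"
    unfolding linear_on_set_sum[OF lin subspace_tangent ET] linear_on_set_sum[OF lin subspace_tangent nabT] sum.distrib
    by (rule refl)
  also have "\<dots> = \<phi> p ((\<Sum>i\<in>Basis. a i *\<^sub>R ?E i p) + (\<Sum>i\<in>Basis. (Y p c \<bullet> i) *\<^sub>R nab p (\<xi> p) (?E i)))"
    by (rule linear_on_set_add[OF lin, symmetric]; intro tangent_closed ET nabT)
  also have "\<dots> = \<phi> p (nab_along p (xiM p) Y)"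
    unfolding nab_along_frame[OF V Y c] incl_xiM[OF pM] sum.distrib a_def by (rule refl)
  finally show ?thesis .
qed

context
  fixes V p assumes V: "openin (Top M) V" "p \<in> V"
begin

lemma sff_xiM_left: "smooth_vf M V X \<Longrightarrow> sff xiM X p = 0"
  using sff_sym[OF V smooth_xiM[OF V(1)]] sff_xiM[of p X] in_points[OF V] M.smooth_vf_tangent V(2) by simp

text \<open>\<phi>^2 is -1 up to a multiple of \<xi>, which h annihilates. The factor
  \<open>a\<close> is 1 for the Chaki condition and -\<beta>^2 for the curvature.\<close>

lemma sff_phiM_phiM:
  assumes X: "smooth_vf M V X" and Z: "smooth_vf M V Z" and W: "smooth_vf M V W"
    and eq: "W p = a *\<^sub>R phiM p (phiM p (X p))"
  shows "sff Z W p = - a *\<^sub>R sff Z X p"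
proof -
  note pM = in_points[OF V]
  have "W p = (- a) *\<^sub>R X p + (a * \<eta> p (incl p (X p))) *\<^sub>R xiM p"
    unfolding eq phiM_phiM[OF pM M.smooth_vf_tangent[OF X V(2)]]
    by (rule ext) (simp add: algebra_simps)
  then have "sff Z W p = sff Z (\<lambda>q. (- a) *\<^sub>R X q) p + sff Z (\<lambda>q. (a * \<eta> p (incl p (X p))) *\<^sub>R xiM q) p"
    by (intro sff_add_right[OF V Z _ _ W] M.smooth_vf_scaleR[OF V(1) M.smooth_fun_const] X smooth_xiM[OF V(1)])
  also have "\<dots> = - a *\<^sub>R sff Z X p + (a * \<eta> p (incl p (X p))) *\<^sub>R sff Z xiM p"
    unfolding sff_scaleR_right[OF V Z X M.smooth_vf_scaleR[OF V(1) M.smooth_fun_const X] refl]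
      sff_scaleR_right[OF V Z smooth_xiM[OF V(1)] M.smooth_vf_scaleR[OF V(1) M.smooth_fun_const smooth_xiM[OF V(1)]] refl]
    by (rule refl)
  finally show ?thesis
    unfolding sff_xiM[where X = Z, OF pM M.smooth_vf_tangent[OF Z V(2)]] scaleR_zero_right add_0_right .
qed

lemma nab_sff_xiM:
  assumes X: "smooth_vf M V X" and Y: "smooth_vf M V Y"
  shows "nab_sff X Y xiM p = \<beta> p *\<^sub>R sff Y (\<lambda>q. phiM q (X q)) p"
proof -
  note pM = in_points[OF V]
  have "nor_conn X (sff Y xiM) p = 0"
    by (rule nor_conn_zero[OF V], rule sff_xiM[OF in_points[OF V(1)] M.smooth_vf_tangent[OF Y]])
  moreover have "sff (ind_conn X Y) xiM p = 0"
    by (rule sff_xiM[OF pM], rule M.smooth_vf_tangent[OF smooth_vf_ind_conn[OF V(1) X Y] V(2)])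
  moreover have "sff Y (ind_conn X xiM) p = - \<beta> p *\<^sub>R sff Y (\<lambda>q. phiM q (X q)) p"
    by (rule sff_scaleR_right[OF V Y smooth_phiM[OF V(1) X] smooth_vf_ind_conn[OF V(1) X smooth_xiM[OF V(1)]]])
      (rule ind_conn_xiM[where X = X, OF pM M.smooth_vf_tangent[OF X V(2)]])
  ultimately show ?thesis unfolding nab_sff_def by simp
qed

lemma ind_curv_xiM:
  assumes X: "smooth_vf M V X"
  shows "ind_curv X xiM xiM p = - (\<beta> p)\<^sup>2 *\<^sub>R phiM p (phiM p (X p))"
proof -
  note pM = in_points[OF V] and pN = in_points_N[OF V]
  note XT = M.smooth_vf_tangent[OF X V(2)] and xi = smooth_xiM[OF V(1)]
  note phiX = smooth_phiM[OF V(1) X]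
  let ?B = "bracket M X xiM p"
  have BT: "?B \<in> tangent_space M p" by (rule M.bracket_tangent[OF V X xi])
  have "ind_conn xiM xiM q = 0" if "q \<in> V" for q
    unfolding ind_conn_xiM[where X = xiM, OF in_points[OF V(1) that] xiM_tangent[OF in_points[OF V(1) that]]]
      phiM_xiM[OF in_points[OF V(1) that]] by (rule scaleR_zero_right)
  then have t1: "ind_conn X (ind_conn xiM xiM) p = 0" by (rule ind_conn_zero[OF V])
  \<comment> \<open>The derivative of \<open>X\<close> along \<xi> is not known by itself.
    Torsion-freeness expresses it through the derivative of \<xi> along \<open>X\<close> and the
    bracket \<open>?B\<close>, whose contribution to the curvature cancels against
    \<open>t3\<close>.\<close>
  define D where "D = nab_along p (xiM p) (\<lambda>q. incl q (X q))"
  have D: "D = incl p (- \<beta> p *\<^sub>R phiM p (X p) - ?B)"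
  proof -
    have "nab_along p (X p) (\<lambda>q. incl q (xiM q)) - D = incl p ?B"
      unfolding D_def by (rule nab_along_torsion_free[OF V X xi])
    then have "D = nab_along p (X p) (\<lambda>q. incl q (xiM q)) - incl p ?B" by (metis diff_diff_eq2 add_diff_cancel_left')
    then show ?thesis unfolding nab_along_xiM[OF pM XT] linear_diff[OF linear_incl[OF pM]] .
  qed
  have DT: "- \<beta> p *\<^sub>R phiM p (X p) - ?B \<in> tangent_space M p"
    by (intro M.tangent_closed phiM_tangent[OF pM] BT)
  have nb: "smooth_fun M V (\<lambda>q. - \<beta> q)"
    using M.smooth_fun_bounded_linear[OF V(1) bounded_linear_minus[OF bounded_linear_ident] beta_smooth_M[OF V(1)]] .
  have dbeta: "vderiv M p (xiM p) (\<lambda>q. - \<beta> q) = 0"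
    using M.vderiv_bounded_linear[OF V bounded_linear_minus[OF bounded_linear_ident] beta_smooth_M[OF V(1)], of "xiM p"]
      vderiv_incl[OF pM pN openin_topspace beta_smooth, of "xiM p"] xi_beta[OF pN] incl_xiM[OF pM] by simp
  note phi_along = along_tensor11[OF V(1) along_incl[OF V(1) X] phi_tensor]
  have "nab_along p (xiM p) (\<lambda>q. incl q (ind_conn X xiM q)) = nab_along p (xiM p) (\<lambda>q. (- \<beta> q) *\<^sub>R \<phi> q (incl q (X q)))"
  proof (rule nab_along_cong[OF V])
    fix q assume q: "q \<in> V"
    note qM = in_points[OF V(1) q] and XTq = M.smooth_vf_tangent[OF X q]
    show "incl q (ind_conn X xiM q) = (- \<beta> q) *\<^sub>R \<phi> q (incl q (X q))"
      unfolding ind_conn_xiM[where X = X, OF qM XTq] linear_scale[OF linear_incl[OF qM]] incl_phiM[OF qM XTq] by (rule refl)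
  qed
  also have "\<dots> = - \<beta> p *\<^sub>R nab_along p (xiM p) (\<lambda>q. \<phi> q (incl q (X q)))"
    unfolding nab_along_scaleR[OF V nb phi_along] dbeta scaleR_zero_left add_0 by (rule refl)
  also have "\<dots> = - \<beta> p *\<^sub>R \<phi> p (incl p (- \<beta> p *\<^sub>R phiM p (X p) - ?B))"
    unfolding nab_along_xiM_phi[OF V along_incl[OF V(1) X]] D_def[symmetric] D by (rule refl)
  also have "\<dots> = incl p (- \<beta> p *\<^sub>R phiM p (- \<beta> p *\<^sub>R phiM p (X p) - ?B))"
    unfolding linear_scale[OF linear_incl[OF pM]] incl_phiM[OF pM DT] by (rule refl)
  finally have t2: "ind_conn xiM (ind_conn X xiM) p = - \<beta> p *\<^sub>R phiM p (- \<beta> p *\<^sub>R phiM p (X p) - ?B)"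
    unfolding ind_conn_def[of xiM "ind_conn X xiM"]
    by (simp only: tan_part_incl[OF pM M.tangent_closed(3)[OF phiM_tangent[OF pM]]])
  have t3: "ind_conn (bracket M X xiM) xiM p = - \<beta> p *\<^sub>R phiM p ?B"
    by (rule ind_conn_xiM[OF pM], rule BT)
  show ?thesis
    unfolding ind_curv_def t1 t2 t3 linear_diff[OF phiM_linear[OF pM]] linear_scale[OF phiM_linear[OF pM]]
    by (rule ext) (simp add: algebra_simps power2_eq_square)
qed

lemma curv_sff_xiM:
  assumes X: "smooth_vf M V X" and Z: "smooth_vf M V Z"
  shows "curv_sff X xiM Z xiM p = - (\<beta> p)\<^sup>2 *\<^sub>R sff Z X p"
proof -
  note pM = in_points[OF V] and xi = smooth_xiM[OF V(1)]
  have "nor_curv X xiM (sff Z xiM) p = 0"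
    by (rule nor_curv_zero[OF V], rule sff_xiM[OF in_points[OF V(1)] M.smooth_vf_tangent[OF Z]])
  moreover have "sff (ind_curv X xiM Z) xiM p = 0"
    by (rule sff_xiM[OF pM], rule M.smooth_vf_tangent[OF smooth_vf_ind_curv[OF V(1) X xi Z] V(2)])
  moreover have "sff Z (ind_curv X xiM xiM) p = - (- (\<beta> p)\<^sup>2) *\<^sub>R sff Z X p"
    by (rule sff_phiM_phiM[OF X Z smooth_vf_ind_curv[OF V(1) X xi xi] ind_curv_xiM[OF X]])
  ultimately show ?thesis unfolding curv_sff_def by simp
qed

lemma Q_sff_xiM:
  assumes X: "smooth_vf M V X" and Z: "smooth_vf M V Z"
  shows "Q_sff Z xiM X xiM p = sff X Z p"
  using sff_xiM[of p X] sff_xiM[of p xiM] sff_xiM_left[OF Z] in_points[OF V] M.smooth_vf_tangent[OF X V(2)]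
    xiM_tangent ind_metric_xiM
  unfolding Q_sff_def by simp

end

section \<open>From the conditions to the vanishing of h, and back\<close>

text \<open>For fixed \<open>X\<close> and \<open>Y\<close> the values h(X,Y) and h(Y,\<phi>X) solve
  a homogeneous system of two linear equations with coefficients \<alpha>(\<xi>) and \<beta>; the
  sum of squares is its determinant.\<close>

lemma chaki_imp_sff_zero:
  assumes chaki: "chaki_pseudo_parallel \<alpha>" and V: "openin (Top M) V" "p \<in> V"
    and X: "smooth_vf M V X" and Y: "smooth_vf M V Y" and nz: "(\<alpha> p (xiM p))\<^sup>2 + (\<beta> p)\<^sup>2 \<noteq> 0"
  shows "sff X Y p = 0"
proof -
  let ?\<phi>X = "\<lambda>q. phiM q (X q)"
  note xi = smooth_xiM[OF V(1)] and phiX = smooth_phiM[OF V(1) X]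
  note phi_phiX = smooth_phiM[OF V(1) phiX]
  \<comment> \<open>With \<xi> in the last slot, two of the three terms on the Chaki side contain
    h(.,\<xi>) and vanish.\<close>
  have *: "\<beta> p *\<^sub>R sff Y (\<lambda>q. phiM q (A q)) p = \<alpha> p (xiM p) *\<^sub>R sff A Y p" if A: "smooth_vf M V A" for A
  proof -
    have "nab_sff A Y xiM p =
        (2 * \<alpha> p (A p)) *\<^sub>R sff Y xiM p + \<alpha> p (Y p) *\<^sub>R sff A xiM p + \<alpha> p (xiM p) *\<^sub>R sff A Y p"
      using chaki[unfolded chaki_pseudo_parallel_def, THEN conjunct2, THEN conjunct2, rule_format, of V A Y xiM p]
        V A Y xi by simp
    then show ?thesis
      unfolding nab_sff_xiM[OF V A Y] sff_xiM[where X = Y, OF in_points[OF V] M.smooth_vf_tangent[OF Y V(2)]]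
        sff_xiM[where X = A, OF in_points[OF V] M.smooth_vf_tangent[OF A V(2)]] by simp
  qed
  have "sff Y (\<lambda>q. phiM q (phiM q (X q))) p = - 1 *\<^sub>R sff Y X p"
    by (rule sff_phiM_phiM[OF V X Y phi_phiX]) simp
  then have 1: "- (\<beta> p *\<^sub>R sff X Y p) = \<alpha> p (xiM p) *\<^sub>R sff Y ?\<phi>X p"
    using *[OF phiX] sff_sym[OF V X Y] sff_sym[OF V phiX Y] by simp
  have "- ((\<beta> p)\<^sup>2 *\<^sub>R sff X Y p) = \<beta> p *\<^sub>R (- (\<beta> p *\<^sub>R sff X Y p))"
    by (rule ext) (simp add: power2_eq_square)
  also have "\<dots> = \<alpha> p (xiM p) *\<^sub>R (\<beta> p *\<^sub>R sff Y ?\<phi>X p)"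
    unfolding 1 by (rule scaleR_left_commute)
  also have "\<dots> = (\<alpha> p (xiM p))\<^sup>2 *\<^sub>R sff X Y p"
    unfolding *[OF X] by (simp only: scaleR_scaleR power2_eq_square)
  finally have "((\<alpha> p (xiM p))\<^sup>2 + (\<beta> p)\<^sup>2) *\<^sub>R sff X Y p = 0"
    unfolding scaleR_add_left by (simp only: neg_eq_iff_add_eq_0 add.commute)
  then show ?thesis using nz by (simp only: scaleR_eq_0_iff simp_thms)
qed

text \<open>The Deszcz computation with right side 0. Semiparallelity is imposed at every point, so
  umbilic points need no separate treatment here.\<close>

lemma semiparallel_imp_sff_zero:
  assumes "semiparallel" and V: "openin (Top M) V" "p \<in> V"
    and X: "smooth_vf M V X" and Y: "smooth_vf M V Y" and nz: "\<beta> p \<noteq> 0"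
  shows "sff X Y p = 0"
proof -
  have "curv_sff Y xiM X xiM p = 0"
    using assms(1)[unfolded semiparallel_def, rule_format, of V Y xiM X xiM p] V X Y smooth_xiM[OF V(1)] by simp
  then have "- (\<beta> p)\<^sup>2 *\<^sub>R sff X Y p = 0" unfolding curv_sff_xiM[OF V Y X] .
  then show ?thesis using nz by (simp only: scaleR_eq_0_iff neg_equal_0_iff_equal zero_eq_power2 simp_thms)
qed

text \<open>Where h vanishes, so does the mean curvature. This closes the contradiction in the
  Deszcz case and makes the Deszcz condition vacuous for a totally geodesic
  \<open>M\<close>.\<close>

lemma sff_zero_imp_umbilic:
  assumes p: "p \<in> points M"
    and zero: "\<And>V X Y. openin (Top M) V \<Longrightarrow> p \<in> V \<Longrightarrow> smooth_vf M V X \<Longrightarrow> smooth_vf M V Y \<Longrightarrow> sff X Y p = 0"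
  shows "p \<notin> non_umbilic_points"
proof -
  have b: "chart_at M p \<in> Charts M" "p \<in> fst (chart_at M p)" using M.chart_at[OF p] by auto
  have "sff_at p u v = 0" for u v
    unfolding sff_at_def Let_def
    by (rule zero[OF M.chart_open[OF b(1)] b(2) M.smooth_vf_coord[OF b(1)] M.smooth_vf_coord[OF b(1)]])
  \<comment> \<open>All summands of the mean curvature are 0, whatever set the choice operator picks
    as orthonormal basis.\<close>
  then show ?thesis by (simp only: non_umbilic_points_def mean_curvature_def sum.neutral_const scaleR_zero_right
      diff_self mem_Collect_eq) simp
qed

text \<open>At an umbilic point, \<open>H = h(\<xi>, \<xi>) = 0\<close>.\<close>

lemma umbilic_imp_sff_zero:
  assumes V: "openin (Top M) V" "p \<in> V" and umb: "p \<notin> non_umbilic_points"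
    and X: "smooth_vf M V X" and Y: "smooth_vf M V Y"
  shows "sff X Y p = 0"
proof -
  note pM = in_points[OF V]
  have eq: "sff_at p u v = ind_metric p u v *\<^sub>R mean_curvature p"
    if "u \<in> tangent_space M p" "v \<in> tangent_space M p" for u v
  proof -
    have "sff_at p u v - ind_metric p u v *\<^sub>R mean_curvature p = 0"
      using umb pM that unfolding non_umbilic_points_def by blast
    then show ?thesis unfolding right_minus_eq .
  qed
  have "sff_at p (xiM p) (xiM p) = 0"
    unfolding sff_at_eq[OF V smooth_xiM[OF V(1)] smooth_xiM[OF V(1)]] by (rule sff_xiM[where X = xiM, OF pM xiM_tangent[OF pM]])
  then have H: "mean_curvature p = 0"
    unfolding eq[OF xiM_tangent[OF pM] xiM_tangent[OF pM]] ind_metric_xiM[OF pM] scaleR_one .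
  show ?thesis
    using eq[OF M.smooth_vf_tangent[OF X V(2)] M.smooth_vf_tangent[OF Y V(2)]]
    unfolding sff_at_eq[OF V X Y] H scaleR_zero_right .
qed

lemma deszcz_imp_sff_zero:
  assumes deszcz: "deszcz_pseudo_parallel L" and V: "openin (Top M) V" "p \<in> V"
    and X: "smooth_vf M V X" and Y: "smooth_vf M V Y"
    and nz: "\<And>p. p \<in> non_umbilic_points \<Longrightarrow> L p + (\<beta> p)\<^sup>2 \<noteq> 0"
  shows "sff X Y p = 0"
proof -
  have "p \<notin> non_umbilic_points"
  proof
    assume W: "p \<in> non_umbilic_points"
    \<comment> \<open>The fields live on an arbitrary neighbourhood \<open>U\<close> of
      \<open>p\<close>, because the test for umbilicity uses coordinate fields on a chart of its
      own.\<close>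
    have "sff A B p = 0"
      if U: "openin (Top M) U" "p \<in> U" and A: "smooth_vf M U A" and B: "smooth_vf M U B" for U A B
    proof -
      have "curv_sff A xiM B xiM p = L p *\<^sub>R Q_sff B xiM A xiM p"
        using deszcz[unfolded deszcz_pseudo_parallel_def, rule_format, of U A xiM B xiM p]
          U W A B smooth_xiM[OF U(1)] by simp
      then have "- (\<beta> p)\<^sup>2 *\<^sub>R sff A B p = L p *\<^sub>R sff A B p"
        unfolding curv_sff_xiM[OF U A B] Q_sff_xiM[OF U A B] sff_sym[OF U B A] .
      then have "(L p + (\<beta> p)\<^sup>2) *\<^sub>R sff A B p = 0"
        unfolding scaleR_add_left scaleR_minus_left by (simp only: neg_eq_iff_add_eq_0 add.commute)
      then show ?thesis using nz[OF W] by (simp only: scaleR_eq_0_iff simp_thms)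
    qed
    then show False using sff_zero_imp_umbilic[OF in_points[OF V]] W by blast
  qed
  then show ?thesis by (rule umbilic_imp_sff_zero[OF V _ X Y])
qed

lemma one_form_eta_incl: "one_form M (\<lambda>p u. \<eta> p (incl p u))"
  unfolding one_form_def
proof (intro conjI ballI allI impI, goal_cases)
  case (1 p)
  show ?case
    unfolding linear_on_set_def
    by (simp only: linear_add[OF linear_incl[OF 1]] linear_scale[OF linear_incl[OF 1]]
      linear_on_set_add[OF eta_linear[OF p_N[OF 1]] incl_tangent[OF 1] incl_tangent[OF 1]]
      linear_on_set_scale[OF eta_linear[OF p_N[OF 1]] incl_tangent[OF 1]]
      simp_thms ball_triv)
next
  case (2 V X)
  then show ?case using smooth_fun_one_form_along[OF _ along_incl eta_form, of V X] by blast
qed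

text \<open>With h = 0 both sides of the Chaki condition vanish for every form. The restriction of
  \<eta> is chosen because it takes the value 1 on \<xi>: it is nowhere zero, and \<alpha>(\<xi>)^2
  + \<beta>^2 is positive even where \<beta> vanishes.\<close>

lemma totally_geodesic_imp_chaki:
  assumes "totally_geodesic"
  shows "chaki_pseudo_parallel (\<lambda>p u. \<eta> p (incl p u))"
  unfolding chaki_pseudo_parallel_def
proof (intro conjI one_form_eta_incl ballI allI impI, goal_cases)
  case (1 p)
  show ?case
    by (rule bexI[OF _ xiM_tangent[OF 1]]) (simp add: incl_xiM[OF 1] eta_xi[OF p_N[OF 1]])
next
  case (2 V X Y Z p)
  then show ?case
    using nab_sff_zero[OF assms, of V p X Y Z] totally_geodesicD[OF assms, of V] by simp
qed

end

text \<open>Where \<beta> = 0, parallel does not imply totally geodesic. The complex quadric z0^2 +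
  z1^2 + z2^2 = 0 in the complex projective plane has parallel h \<noteq> 0; times a line, it is an
  invariant submanifold of the plane times the line, a structure with \<beta> = 0. Hence the way
  back from (ii) and (iii) is claimed for nowhere vanishing \<beta>, while (iv) and (v) carry their
  own conditions of this kind.\<close>

theorem theorem3p3:
  fixes N :: "('a, 'e::euclidean_space) mfd"
    and M :: "('a, 'd::euclidean_space) mfd"
    and \<phi> :: "'a \<Rightarrow> ('a, 'e) tvec \<Rightarrow> ('a, 'e) tvec"
    and \<xi> :: "('a, 'e) vfield"
    and \<eta> :: "'a \<Rightarrow> ('a, 'e) tvec \<Rightarrow> real"
    and g :: "'a \<Rightarrow> ('a, 'e) tvec \<Rightarrow> ('a, 'e) tvec \<Rightarrow> real"
    and nab :: "('a, 'e) conn"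
    and \<beta> :: "'a \<Rightarrow> real"
    and n m :: nat
  assumes "DIM('e) = 2 * n + 1" and "2 * n + 1 > 3"
    and "DIM('d) = 2 * m + 1" and "m < n"
    and "sq_sasakian N \<phi> \<xi> \<eta> g nab \<beta>"
    and "submanifold_geometry.immersed_submanifold N M"
    and "submanifold_geometry.invariant N M \<phi> \<xi>"
  shows
    "let i = submanifold_geometry.totally_geodesic N g nab M;
         ii = submanifold_geometry.parallel N g nab M;
         iii = submanifold_geometry.semiparallel N g nab M;
         iv = (\<exists>\<alpha>. submanifold_geometry.chaki_pseudo_parallel N g nab M \<alpha> \<and>
                 (\<forall>p\<in>points M.
                    (\<alpha> p (submanifold_geometry.tan_part N g M p (\<xi> p)))\<^sup>2 + (\<beta> p)\<^sup>2 \<noteq> 0));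
         v = (\<exists>L. submanifold_geometry.deszcz_pseudo_parallel N g nab M L \<and>
                 (\<forall>p\<in>submanifold_geometry.non_umbilic_points N g nab M. L p + (\<beta> p)\<^sup>2 \<noteq> 0))
     in (i \<longleftrightarrow> iv) \<and> (i \<longleftrightarrow> v) \<and> (i \<longrightarrow> ii) \<and> (ii \<longrightarrow> iii) \<and>
        ((\<forall>p\<in>points M. \<beta> p \<noteq> 0) \<longrightarrow> (i \<longleftrightarrow> ii) \<and> (i \<longleftrightarrow> iii))"
proof -
  have acm: "almost_contact_metric N \<phi> \<xi> \<eta> g" and lc: "levi_civita N g nab"
    using assms(5) by (simp_all only: sq_sasakian_def)
  interpret invariant_submanifold N g nab M \<phi> \<xi> \<eta> \<beta>
    by unfold_locales (use acm lc assms(5-7) in \<open>simp_all only: almost_contact_metric_def\<close>)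
  have iv: "totally_geodesic \<longleftrightarrow> (\<exists>\<alpha>. chaki_pseudo_parallel \<alpha> \<and>
      (\<forall>p\<in>points M. (\<alpha> p (tan_part p (\<xi> p)))\<^sup>2 + (\<beta> p)\<^sup>2 \<noteq> 0))"
  proof
    assume i: "totally_geodesic"
    have "(\<eta> p (incl p (tan_part p (\<xi> p))))\<^sup>2 + (\<beta> p)\<^sup>2 \<noteq> 0" if p: "p \<in> points M" for p
      using incl_xiM[OF p] eta_xi[OF p_N[OF p]] add_pos_nonneg[OF zero_less_one zero_le_power2[of "\<beta> p"]]
      unfolding xiM_def by simp
    then show "\<exists>\<alpha>. chaki_pseudo_parallel \<alpha> \<and>
        (\<forall>p\<in>points M. (\<alpha> p (tan_part p (\<xi> p)))\<^sup>2 + (\<beta> p)\<^sup>2 \<noteq> 0)"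
      using totally_geodesic_imp_chaki[OF i] by (intro exI[of _ "\<lambda>p u. \<eta> p (incl p u)"]) blast
  next
    assume "\<exists>\<alpha>. chaki_pseudo_parallel \<alpha> \<and> (\<forall>p\<in>points M. (\<alpha> p (tan_part p (\<xi> p)))\<^sup>2 + (\<beta> p)\<^sup>2 \<noteq> 0)"
    then obtain \<alpha> where \<alpha>: "chaki_pseudo_parallel \<alpha>"
        "\<And>p. p \<in> points M \<Longrightarrow> (\<alpha> p (xiM p))\<^sup>2 + (\<beta> p)\<^sup>2 \<noteq> 0"
      unfolding xiM_def by blast
    show "totally_geodesic"
      unfolding totally_geodesic_def
    proof (intro allI impI ballI, elim conjE)
      fix V X Y p
      assume V: "openin (Top M) V" "p \<in> V" and "smooth_vf M V X" "smooth_vf M V Y"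
      then show "sff X Y p = 0"
        by (intro chaki_imp_sff_zero[OF \<alpha>(1) V] \<alpha>(2) in_points[OF V])
    qed
  qed
  have v: "totally_geodesic \<longleftrightarrow> (\<exists>L. deszcz_pseudo_parallel L \<and>
      (\<forall>p\<in>non_umbilic_points. L p + (\<beta> p)\<^sup>2 \<noteq> 0))"
  proof
    assume i: "totally_geodesic"
    have "p \<notin> non_umbilic_points" for p
    proof
      assume p: "p \<in> non_umbilic_points"
      then have "p \<in> points M" by (simp add: non_umbilic_points_def)
      then show False using sff_zero_imp_umbilic totally_geodesicD[OF i] p by blast
    qed
    \<comment> \<open>There are no non-umbilic points, so both conditions on \<open>L\<close> are
      vacuous and any function serves.\<close>
    then show "\<exists>L. deszcz_pseudo_parallel L \<and> (\<forall>p\<in>non_umbilic_points. L p + (\<beta> p)\<^sup>2 \<noteq> 0)"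
      unfolding deszcz_pseudo_parallel_def by blast
  next
    assume "\<exists>L. deszcz_pseudo_parallel L \<and> (\<forall>p\<in>non_umbilic_points. L p + (\<beta> p)\<^sup>2 \<noteq> 0)"
    then obtain L where L: "deszcz_pseudo_parallel L" "\<And>p. p \<in> non_umbilic_points \<Longrightarrow> L p + (\<beta> p)\<^sup>2 \<noteq> 0"
      by blast
    show "totally_geodesic"
      unfolding totally_geodesic_def using deszcz_imp_sff_zero[OF L(1) _ _ _ _ L(2)] by blast
  qed
  have iii: "totally_geodesic" if "semiparallel" "\<forall>p\<in>points M. \<beta> p \<noteq> 0"
    unfolding totally_geodesic_def
  proof (intro allI impI ballI, elim conjE)
    fix V X Y p
    assume V: "openin (Top M) V" "p \<in> V" and "smooth_vf M V X" "smooth_vf M V Y"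
    then show "sff X Y p = 0"
      using that(2) in_points[OF V] by (intro semiparallel_imp_sff_zero[OF that(1) V]) auto
  qed
  show ?thesis
    unfolding Let_def
    using iv v iii totally_geodesic_imp_parallel parallel_imp_semiparallel by satx
qed

end
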